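(* Let $S_t^{B,d}=\langle\xi_t^d,v_t^d\rangle$, $t\ge0$, be the angular momentum process of the stationary $d$-dimensional Bouncy Particle Sampler with standard normal target and refreshment rate $\rho>0$. The expected number of switches of $S^{B,d}$ over a time interval $(0,T]$ does not depend on $d$ and is given by $$\mathbb{E}\left[\sum_{0\le t\le T}1_{\{\Delta S_t^{B,d}\ne0\}}\right]=T\left(\frac1{\sqrt{2\pi}}+\rho\right),$$ where $\Delta X_t=X_t-X_{t-}$.
   Context: Bouncy Particle Sampler (BPS) with target $\mathcal{N}(0,I_d)$ on $\mathbb{R}^d$: $\langle\cdot,\cdot\rangle$ and $\|\cdot\|$ are the Euclidean inner product and norm, and $\mathbb{S}^{d-1}$ is the unit sphere of $\mathbb{R}^d$ with uniform distribution $\psi_d$. For a constant $\rho>0$ not depending on $d$, $(\xi_t^d,v_t^d)_{t\ge0}$ is the process on $\mathbb{R}^d\times\mathbb{S}^{d-1}$ with $\xi_t^d=\xi_0^d+\int_0^tv_s^d\,ds$ and $$v_t^d=v_0^d+\int_{(0,t]\times\mathbb{R}_+}(\kappa^d(\xi_{s-}^d,v_{s-}^d)-v_{s-}^d)1_{\{z\le\langle\xi_{s-}^d,v_{s-}^d\rangle^+\}}N(ds,dz)+\int_{(0,t]\times\mathbb{S}^{d-1}}(u-v_{s-}^d)R_d(ds,du),$$ where $x^+=\max\{x,0\}$, $\kappa^d(\xi,v)=v-2\frac{\langle\xi,v\rangle}{\|\xi\|^2}\xi$, $N$ is a homogeneous Poisson random measure on $\mathbb{R}_+\times\mathbb{R}_+$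 with intensity $ds\,dz$, and $R_d$ is a homogeneous Poisson random measure, independent of $N$, with intensity $\rho\,ds\,\psi_d(du)$. The process is stationary: $\xi_0^d\sim\mathcal{N}(0,I_d)$ and $v_0^d\sim\psi_d$, independent of each other and of the random measures. By the usual convention $X_{0-}=X_0$, so there is no jump at time $0$.
   Formalization: The dimension d is assumed to be at least 2; for d = 1 a uniform refreshment on {-1,1} keeps the velocity with probability 1/2, so the expected number of switches would be T(1/√(2π)+ρ/2) and the stated formula fails. *)

theory Defs
  imports "HOL-Probability.Probability"
begin

section \<open>The two laws on Euclidean space\<close>

definition std_gaussian :: "'a::euclidean_space measure" where
  "std_gaussian = density lborel (\<lambda>x. ennreal (\<Prod>b\<in>Basis. std_normal_density (x \<bullet> b)))"

text \<open>Uniform distribution on the unit sphere, as the normalised cone measure: the direction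
  \<open>x / \<parallel>x\<parallel>\<close> (this is \<^term>\<open>sgn x\<close>) of a uniformly distributed point of the unit ball. It is a
  Borel measure on the whole space that is concentrated on \<^term>\<open>sphere 0 1\<close>; the null event
  \<open>x = 0\<close> is irrelevant.\<close>

definition sphere_uniform :: "'a::euclidean_space measure" where
  "sphere_uniform = distr (uniform_measure lborel (ball 0 1)) borel sgn"


section \<open>Poisson random measures\<close>

text \<open>A random measure is a map into measures on a fixed measurable space. The formula for the law
  of the counts covers \<open>\<mu> A = 0\<close> as well, because \<open>0 ^ 0 = 1\<close>.\<close>

definition poisson_random_measure ::
    "'w measure \<Rightarrow> 'e measure \<Rightarrow> ('w \<Rightarrow> 'e measure) \<Rightarrow> bool" where
  "poisson_random_measure M \<mu> N \<longleftrightarrow>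
     (\<forall>\<omega>\<in>space M. sets (N \<omega>) = sets \<mu>) \<and>
     (\<forall>A\<in>sets \<mu>. (\<lambda>\<omega>. emeasure (N \<omega>) A) \<in> borel_measurable M) \<and>
     (\<forall>A\<in>sets \<mu>. emeasure \<mu> A < \<infinity> \<longrightarrow>
        (\<forall>k::nat. measure M {\<omega>\<in>space M. emeasure (N \<omega>) A = of_nat k} =
           measure \<mu> A ^ k / fact k * exp (- measure \<mu> A))) \<and>
     (\<forall>A\<in>sets \<mu>. emeasure \<mu> A = \<infinity> \<longrightarrow> (AE \<omega> in M. emeasure (N \<omega>) A = \<infinity>)) \<and>
     (\<forall>F. F \<subseteq> sets \<mu> \<longrightarrow> finite F \<longrightarrow> disjoint F \<longrightarrow>
        prob_space.indep_vars M (\<lambda>_. borel) (\<lambda>A \<omega>. emeasure (N \<omega>) A) F)"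

text \<open>The sigma-algebra generated by a random measure is the one generated by its evaluations.\<close>

definition random_measure_sigma ::
    "'w measure \<Rightarrow> 'e measure \<Rightarrow> ('w \<Rightarrow> 'e measure) \<Rightarrow> 'w set set" where
  "random_measure_sigma M \<mu> N =
     sets (vimage_algebra (space M) (\<lambda>\<omega>. \<lambda>A\<in>sets \<mu>. emeasure (N \<omega>) A) (PiM (sets \<mu>) (\<lambda>_. borel)))"

definition random_variable_sigma ::
    "'w measure \<Rightarrow> ('w \<Rightarrow> 'a::topological_space) \<Rightarrow> 'w set set" where
  "random_variable_sigma M X = sets (vimage_algebra (space M) X borel)"


section \<open>Paths and processes indexed by nonnegative time\<close>

text \<open>\<open>X\<^bsub>t-\<^esub>\<close>, with the convention \<open>X\<^bsub>0-\<^esub> = X\<^bsub>0\<^esub>\<close>. For \<open>t > 0\<close> it is meaningful only where the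
  left limit exists.\<close>

definition left_limit :: "(real \<Rightarrow> 'a::t2_space) \<Rightarrow> real \<Rightarrow> 'a" where
  "left_limit X t = (if t = 0 then X 0 else Lim (at_left t) X)"

definition jump :: "(real \<Rightarrow> 'a::real_normed_vector) \<Rightarrow> real \<Rightarrow> 'a" where
  "jump X t = X t - left_limit X t"

definition cadlag :: "(real \<Rightarrow> 'a::t2_space) \<Rightarrow> bool" where
  "cadlag X \<longleftrightarrow>
     (\<forall>t\<ge>0. continuous (at_right t) X) \<and> (\<forall>t>0. \<exists>l. (X \<longlongrightarrow> l) (at_left t))"

text \<open>Strict stationarity: the law of the whole process is invariant under time shifts.\<close>

definition stationary_process :: "'w measure \<Rightarrow> (real \<Rightarrow> 'w \<Rightarrow> 'b::topological_space) \<Rightarrow> bool" where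
  "stationary_process M Z \<longleftrightarrow>
     (\<forall>h\<ge>0. distr M (PiM {0..} (\<lambda>_. borel)) (\<lambda>\<omega>. \<lambda>t\<in>{0..}. Z (t + h) \<omega>) =
             distr M (PiM {0..} (\<lambda>_. borel)) (\<lambda>\<omega>. \<lambda>t\<in>{0..}. Z t \<omega>))"


section \<open>The Bouncy Particle Sampler with standard normal target\<close>

definition bounce :: "'a::euclidean_space \<Rightarrow> 'a \<Rightarrow> 'a" where
  "bounce x v = v - (2 * (x \<bullet> v) / (norm x)\<^sup>2) *\<^sub>R x"

definition bounce_intensity :: "(real \<times> real) measure" where
  "bounce_intensity = restrict_space lborel {0..} \<Otimes>\<^sub>M restrict_space lborel {0..}"

definition refresh_intensity :: "real \<Rightarrow> (real \<times> 'a::euclidean_space) measure" where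
  "refresh_intensity \<rho> = scale_measure (ennreal \<rho>)
     (restrict_space lborel {0..} \<Otimes>\<^sub>M restrict_space sphere_uniform (sphere 0 1))"

definition bounce_integrand ::
    "(real \<Rightarrow> 'a::euclidean_space) \<Rightarrow> (real \<Rightarrow> 'a) \<Rightarrow> real \<times> real \<Rightarrow> 'a" where
  "bounce_integrand x v = (\<lambda>(s, z).
     indicator {..max 0 (left_limit x s \<bullet> left_limit v s)} z *\<^sub>R
       (bounce (left_limit x s) (left_limit v s) - left_limit v s))"

definition refresh_integrand ::
    "(real \<Rightarrow> 'a::euclidean_space) \<Rightarrow> real \<times> 'a \<Rightarrow> 'a" where
  "refresh_integrand v = (\<lambda>(s, u). u - left_limit v s)"

text \<open>The pathwise equations, driven by realisations \<open>N\<close> and \<open>R\<close> of the two Poisson random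
  measures. Integrability is required explicitly since the Bochner integral of a non-integrable
  function is \<open>0\<close> by convention.\<close>

definition bps_path ::
    "(real \<times> real) measure \<Rightarrow> (real \<times> 'a::euclidean_space) measure \<Rightarrow>
     (real \<Rightarrow> 'a) \<Rightarrow> (real \<Rightarrow> 'a) \<Rightarrow> bool" where
  "bps_path N R x v \<longleftrightarrow>
     cadlag v \<and>
     (\<forall>t\<ge>0. v t \<in> sphere 0 1 \<and>
        set_integrable lborel {0..t} v \<and>
        x t = x 0 + (LINT s:{0..t}|lborel. v s) \<and>
        set_integrable N ({0<..t} \<times> {0..}) (bounce_integrand x v) \<and>
        set_integrable R ({0<..t} \<times> sphere 0 1) (refresh_integrand v) \<and>
        v t = v 0
          + (LINT p:{0<..t} \<times> {0..}|N. bounce_integrand x v p)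
          + (LINT p:{0<..t} \<times> sphere 0 1|R. refresh_integrand v p))"

locale stationary_bps = prob_space M
  for M :: "'w measure" and \<rho> :: real
    and N :: "'w \<Rightarrow> (real \<times> real) measure"
    and R :: "'w \<Rightarrow> (real \<times> 'a::euclidean_space) measure"
    and \<xi> v :: "real \<Rightarrow> 'w \<Rightarrow> 'a" +
  assumes rate_pos: "\<rho> > 0"
    and position_measurable: "\<And>t. t \<ge> 0 \<Longrightarrow> \<xi> t \<in> borel_measurable M"
    and velocity_measurable: "\<And>t. t \<ge> 0 \<Longrightarrow> v t \<in> borel_measurable M"
    and bounce_poisson: "poisson_random_measure M bounce_intensity N"
    and refresh_poisson: "poisson_random_measure M (refresh_intensity \<rho>) R"
    and initial_position: "distr M borel (\<xi> 0) = std_gaussian"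
    and initial_velocity: "distr M borel (v 0) = sphere_uniform"
    and independence: "indep_sets
          (\<lambda>i. [random_variable_sigma M (\<xi> 0),
                random_variable_sigma M (v 0),
                random_measure_sigma M bounce_intensity N,
                random_measure_sigma M (refresh_intensity \<rho>) R] ! i) {..<4::nat}"
    and paths: "AE \<omega> in M. bps_path (N \<omega>) (R \<omega>) (\<lambda>t. \<xi> t \<omega>) (\<lambda>t. v t \<omega>)"
    and stationary: "stationary_process M (\<lambda>t \<omega>. (\<xi> t \<omega>, v t \<omega>))"

definition angular_momentum ::
    "(real \<Rightarrow> 'w \<Rightarrow> 'a::real_inner) \<Rightarrow> (real \<Rightarrow> 'w \<Rightarrow> 'a) \<Rightarrow> real \<Rightarrow> 'w \<Rightarrow> real" where
  "angular_momentum \<xi> v t \<omega> = \<xi> t \<omega> \<bullet> v t \<omega>"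

text \<open>Number of jump times in \<open>[0, T]\<close> as an unordered sum, possibly infinite.\<close>

definition switches :: "(real \<Rightarrow> real) \<Rightarrow> real \<Rightarrow> ennreal" where
  "switches X T = (\<Sum>\<^sub>\<infinity>t\<in>{0..T}. if jump X t \<noteq> 0 then 1 else 0)"

end

theory Submission
  imports Defs
begin

text \<open>
  Between two events the velocity \<open>v\<close> is a constant unit vector and the position moves along it, so
  the angular momentum \<open>S = \<xi> \<bullet> v\<close> grows with slope one. Hence \<open>S t - t\<close>, called the clock below, is a
  step function of time, and the switches are its jumps. The number of jumps of a step function on
  \<open>[0, T]\<close> is the increasing limit of the number of dyadic intervals of length \<open>T / 2 ^ n\<close> across which
  it changes (\<open>switches_eq_SUP_dyadic\<close>). By monotone convergence and stationarity, the expected number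
  of switches is the limit of \<open>2 ^ n\<close> times the probability that the clock changes between the times
  \<open>0\<close> and \<open>T / 2 ^ n\<close> (\<open>expected_switches_eq_SUP\<close>). So only a short interval that starts at time \<open>0\<close>
  matters, and there the initial state is independent of both Poisson random measures: elementary
  Poisson probabilities, conditionally on the initial state, take the place of a compensator.

  Let \<open>h\<close> be the length of the interval and \<open>S\<^sup>+\<close> the positive part of the initial momentum. For
  the clock to change, there must be a refreshment, or a mark of the bounce measure below the level
  \<open>S\<^sup>+ + h\<close> that the momentum cannot exceed before the first event. The expected numbers of such
  marks give the upper bound \<open>h * (\<rho> + E S\<^sup>+ + 2 * h)\<close> (\<open>change_probability_upper\<close>). Conversely, the
  clock does change if the only event is one refreshment, or if the only mark within reach is one
  below \<open>S\<^sup>+\<close>. A bounce reverses the sign of a positive momentum. A refreshment from \<open>w\<close> to \<open>u\<close> at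
  time \<open>s\<close> leaves the momentum unchanged only if the Gaussian vector \<open>\<xi> 0\<close> lies on a certain
  hyperplane orthogonal to \<open>u - w\<close>, which is a null event because \<open>u \<noteq> w\<close> almost surely in dimension
  at least two. The probabilities of these two disjoint events and Fatou's lemma give the matching
  lower bound (\<open>change_probability_lower\<close>).

  It remains to evaluate \<open>E S\<^sup>+\<close>. The projection of a standard Gaussian vector to a fixed unit vector
  is a standard normal variable in every dimension, so \<open>E S\<^sup>+ = 1 / sqrt (2 * pi)\<close>
  (\<open>expected_momentum\<close>).
\<close>

section \<open>Locally finite sums of unit masses on the half-line\<close>

text \<open>
  Only intervals with rational endpoints are tested, so that for a random measure the property is a
  countable conjunction of events of probability one. The property says that the
  measure is a locally finite sum of unit masses on the positive half-line.
\<close>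

definition counts_on_line :: "real measure \<Rightarrow> bool" where
  "counts_on_line \<mu> \<longleftrightarrow> sets \<mu> = sets borel \<and>
     (\<forall>p\<in>\<rat>. \<forall>q\<in>\<rat>. 0 \<le> p \<longrightarrow> p < q \<longrightarrow> emeasure \<mu> {p<..q} \<in> range (of_nat :: nat \<Rightarrow> ennreal))"

lemma of_nat_ennreal_less_one:
  "(x::ennreal) \<in> range of_nat \<Longrightarrow> x < 1 \<Longrightarrow> x = 0"
proof (clarify)
  fix n :: nat assume "(of_nat n :: ennreal) < 1"
  then have "(of_nat n :: ennreal) < of_nat 1" by simp
  then have "n < 1" by (simp only: of_nat_less_iff)
  then show "(of_nat n :: ennreal) = 0" by simp
qed

lemma counts_on_line_finite:
  assumes "counts_on_line \<mu>" "0 \<le> a"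
  shows "emeasure \<mu> {a<..b} < \<infinity>"
proof (cases "a < b")
  case True
  define q where "q = real (nat \<lceil>b\<rceil>)"
  have q: "q \<in> \<rat>" "b \<le> q" "0 < q"
    using True assms by (auto simp: q_def; linarith)+
  have "emeasure \<mu> {a<..b} \<le> emeasure \<mu> {0<..q}"
    using assms q by (intro emeasure_mono) (auto simp: counts_on_line_def)
  also have "\<dots> < \<infinity>"
    using assms q by (force simp: counts_on_line_def less_top[symmetric])
  finally show ?thesis .
qed auto

text \<open>
  Rational subintervals of a set of mass below one have integer mass below one, so mass zero, and
  countably many of them cover the open interval.
\<close>

lemma counts_on_line_light_interval_null:
  assumes \<mu>: "counts_on_line \<mu>" and "0 \<le> a" and light: "emeasure \<mu> {a<..<b} < 1"
  shows "emeasure \<mu> {a<..<b} = 0"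
proof -
  have [simp, measurable_cong]: "sets \<mu> = sets borel"
    using \<mu> by (simp add: counts_on_line_def)
  define I where "I = {(p, q). p \<in> \<rat> \<and> q \<in> \<rat> \<and> a < p \<and> p < q \<and> q < (b::real)}"
  have "I \<subseteq> \<rat> \<times> \<rat>"
    by (auto simp: I_def)
  then have cI: "countable I"
    by (meson countable_SIGMA countable_rat countable_subset)
  have null: "emeasure \<mu> {p<..q} = 0" if "(p, q) \<in> I" for p q
  proof (rule of_nat_ennreal_less_one)
    show "emeasure \<mu> {p<..q} \<in> range of_nat"
      using that \<mu> \<open>0 \<le> a\<close> by (force simp: I_def counts_on_line_def)
    have "emeasure \<mu> {p<..q} \<le> emeasure \<mu> {a<..<b}"
      using that by (intro emeasure_mono) (auto simp: I_def)
    then show "emeasure \<mu> {p<..q} < 1"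
      using light by simp
  qed
  have "{a<..<b} \<subseteq> (\<Union>(p, q)\<in>I. {p<..q})"
  proof
    fix x assume x: "x \<in> {a<..<b}"
    obtain p q where "p \<in> \<rat>" "a < p" "p < x" "q \<in> \<rat>" "x < q" "q < b"
      using Rats_dense_in_real[of a x] Rats_dense_in_real[of x b] x by auto
    then have "(p, q) \<in> I" "x \<in> {p<..q}" by (auto simp: I_def)
    then show "x \<in> (\<Union>(p, q)\<in>I. {p<..q})" by blast
  qed
  moreover have "(\<Union>(p, q)\<in>I. {p<..q}) \<in> null_sets \<mu>"
    using null by (intro null_sets_UN' cI) (auto simp: null_sets_def)
  ultimately show ?thesis
    by (metis emeasure_eq_0 null_setsD1 null_setsD2)
qed

text \<open>
  The intervals on one side of \<open>t\<close> decrease to the empty set, so their mass tends to zero; once it is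
  below one, it is zero.
\<close>

lemma counts_on_line_null_right:
  assumes \<mu>: "counts_on_line \<mu>" and "0 \<le> t"
  shows "\<exists>\<epsilon>>0. emeasure \<mu> {t<..<t + \<epsilon>} = 0"
proof -
  have [simp]: "sets \<mu> = sets borel"
    using \<mu> by (simp add: counts_on_line_def)
  define B where "B n = {t<..<t + 1 / Suc n}" for n
  have "(\<lambda>n. emeasure \<mu> (B n)) \<longlonglongrightarrow> emeasure \<mu> (\<Inter>n. B n)"
  proof (rule Lim_emeasure_decseq)
    show "decseq B"
      unfolding B_def
    proof (rule decseq_SucI)
      fix n
      have "1 / real (Suc (Suc n)) \<le> 1 / real (Suc n)"
        by (simp add: frac_le)
      then show "{t<..<t + 1 / real (Suc (Suc n))} \<subseteq> {t<..<t + 1 / real (Suc n)}"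
        by auto
    qed
    show "emeasure \<mu> (B n) \<noteq> \<infinity>" for n
    proof -
      have "emeasure \<mu> (B n) \<le> emeasure \<mu> {t<..t + 1 / Suc n}"
        by (intro emeasure_mono) (auto simp: B_def)
      then show ?thesis
        using counts_on_line_finite[OF \<mu> \<open>0 \<le> t\<close>, of "t + 1 / Suc n"] by (simp add: less_top top_unique)
    qed
  qed (auto simp: B_def)
  moreover have "(\<Inter>n. B n) = {}"
  proof -
    have "x \<notin> (\<Inter>n. B n)" for x
    proof
      assume x: "x \<in> (\<Inter>n. B n)"
      then have "x - t > 0" by (auto simp: B_def)
      then obtain n where "inverse (real (Suc n)) < x - t"
        using reals_Archimedean by blast
      with x show False by (auto simp: B_def field_simps dest: spec[of _ n])
    qed
    then show ?thesis by blast
  qed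
  ultimately have "(\<lambda>n. emeasure \<mu> (B n)) \<longlonglongrightarrow> 0" by simp
  then have "\<forall>\<^sub>F n in sequentially. emeasure \<mu> (B n) < 1"
    by (rule order_tendstoD) simp
  then obtain n where "emeasure \<mu> (B n) < 1"
    by (auto simp: eventually_sequentially)
  then have "emeasure \<mu> {t<..<t + 1 / Suc n} = 0"
    using counts_on_line_light_interval_null[OF \<mu> \<open>0 \<le> t\<close>] by (simp add: B_def)
  then show ?thesis
    by (intro exI[of _ "1 / Suc n"]) simp
qed

lemma counts_on_line_null_left:
  assumes \<mu>: "counts_on_line \<mu>" and "0 < t"
  shows "\<exists>\<epsilon>>0. \<epsilon> \<le> t \<and> emeasure \<mu> {t - \<epsilon><..<t} = 0"
proof -
  have [simp]: "sets \<mu> = sets borel"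
    using \<mu> by (simp add: counts_on_line_def)
  define B where "B n = {t - t / Suc n<..<t}" for n
  have div_le: "t / Suc n \<le> t" for n
    using \<open>0 < t\<close> by (simp add: divide_le_eq)
  have "(\<lambda>n. emeasure \<mu> (B n)) \<longlonglongrightarrow> emeasure \<mu> (\<Inter>n. B n)"
  proof (rule Lim_emeasure_decseq)
    show "decseq B"
      unfolding B_def
    proof (rule decseq_SucI)
      fix n
      have "t / Suc (Suc n) \<le> t / Suc n"
        using \<open>0 < t\<close> by (simp add: frac_le)
      then show "{t - t / real (Suc (Suc n))<..<t} \<subseteq> {t - t / real (Suc n)<..<t}"
        by auto
    qed
    show "emeasure \<mu> (B n) \<noteq> \<infinity>" for n
    proof -
      have "emeasure \<mu> (B n) \<le> emeasure \<mu> {0<..t}"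
        using div_le[of n] by (intro emeasure_mono) (auto simp: B_def)
      then show ?thesis
        using counts_on_line_finite[OF \<mu>, of 0 t] by (simp add: less_top top_unique)
    qed
  qed (auto simp: B_def)
  moreover have "(\<Inter>n. B n) = {}"
  proof -
    have "x \<notin> (\<Inter>n. B n)" for x
    proof
      assume x: "x \<in> (\<Inter>n. B n)"
      then have "(t - x) / t > 0" using \<open>0 < t\<close> by (auto simp: B_def)
      then obtain n where n: "inverse (real (Suc n)) < (t - x) / t"
        using reals_Archimedean by blast
      have "t / Suc n < t - x"
        using n \<open>0 < t\<close> by (simp add: field_simps)
      moreover have "t - t / Suc n < x"
        using x by (auto simp: B_def)
      ultimately show False by simp
    qed
    then show ?thesis by blast
  qed
  ultimately have "(\<lambda>n. emeasure \<mu> (B n)) \<longlonglongrightarrow> 0" by simp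
  then have "\<forall>\<^sub>F n in sequentially. emeasure \<mu> (B n) < 1"
    by (rule order_tendstoD) simp
  then obtain n where "emeasure \<mu> (B n) < 1"
    by (auto simp: eventually_sequentially)
  then have "emeasure \<mu> {t - t / Suc n<..<t} = 0"
    using counts_on_line_light_interval_null[OF \<mu>, of "t - t / Suc n"] div_le[of n] by (simp add: B_def)
  then show ?thesis
    using div_le[of n] \<open>0 < t\<close> by (intro exI[of _ "t / Suc n"]) simp
qed

lemma counts_on_line_atom:
  assumes \<mu>: "counts_on_line \<mu>" and "0 < t"
  shows "emeasure \<mu> {t} \<in> range (of_nat :: nat \<Rightarrow> ennreal)"
proof -
  have [simp]: "sets \<mu> = sets borel"
    using \<mu> by (simp add: counts_on_line_def)
  obtain a where a: "0 < a" "a \<le> t" "emeasure \<mu> {t - a<..<t} = 0"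
    using counts_on_line_null_left[OF assms] by auto
  obtain b where b: "0 < b" "emeasure \<mu> {t<..<t + b} = 0"
    using counts_on_line_null_right[OF \<mu>, of t] assms by auto
  obtain p where p: "p \<in> \<rat>" "t - a < p" "p < t"
    using Rats_dense_in_real[of "t - a" t] a by auto
  obtain q where q: "q \<in> \<rat>" "t < q" "q < t + b"
    using Rats_dense_in_real[of t "t + b"] b by auto
  have "{p<..<t} \<subseteq> {t - a<..<t}" "{t<..q} \<subseteq> {t<..<t + b}"
    using p q by auto
  then have "emeasure \<mu> {p<..<t} = 0" "emeasure \<mu> {t<..q} = 0"
    by (auto intro: emeasure_eq_0[OF _ a(3)] emeasure_eq_0[OF _ b(2)])
  then have "{p<..<t} \<union> {t<..q} \<in> null_sets \<mu>"
    by (intro null_sets.Un) (auto simp: null_sets_def)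
  then have "emeasure \<mu> ({t} \<union> ({p<..<t} \<union> {t<..q})) = emeasure \<mu> {t}"
    by (intro emeasure_Un_null_set) auto
  moreover have "{t} \<union> ({p<..<t} \<union> {t<..q}) = {p<..q}"
    using p q by auto
  ultimately have "emeasure \<mu> {p<..q} = emeasure \<mu> {t}"
    by simp
  moreover have "emeasure \<mu> {p<..q} \<in> range of_nat"
    using \<mu> p q a by (auto simp: counts_on_line_def)
  ultimately show ?thesis by simp
qed

text \<open>
  Each point has a neighbourhood that is null apart from the point itself. If all points were null,
  then by compactness \<open>{0..h}\<close> would be null. So some point has positive mass, which is an integer and
  therefore takes up the whole mass one.
\<close>

lemma counts_on_line_single_point:
  assumes \<mu>: "counts_on_line \<mu>" and one: "emeasure \<mu> {0<..h} = 1"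
  shows "\<exists>s. 0 < s \<and> s \<le> h \<and> emeasure \<mu> {s} = 1 \<and> emeasure \<mu> ({0<..h} - {s}) = 0"
proof -
  have [simp]: "sets \<mu> = sets borel"
    using \<mu> by (simp add: counts_on_line_def)
  have "\<exists>s\<in>{0<..h}. emeasure \<mu> {s} \<noteq> 0"
  proof (rule ccontr)
    assume no: "\<not> ?thesis"
    have "\<exists>U. open U \<and> t \<in> U \<and> emeasure \<mu> (U \<inter> {0<..h}) = 0" if t: "t \<in> {0..h}" for t
    proof -
      obtain b where b: "0 < b" "emeasure \<mu> {t<..<t + b} = 0"
        using counts_on_line_null_right[OF \<mu>, of t] t by auto
      obtain a where a: "0 < a" "emeasure \<mu> ({t - a<..<t} \<inter> {0<..h}) = 0"
      proof (cases "t = 0")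
        case True
        then have "{t - 1<..<t} \<inter> {0<..h} = {}" by auto
        then have "emeasure \<mu> ({t - 1<..<t} \<inter> {0<..h}) = 0"
          by (simp only: emeasure_empty)
        then show ?thesis by (rule that[rotated]) simp
      next
        case False
        then obtain a where "0 < a" "emeasure \<mu> {t - a<..<t} = 0"
          using counts_on_line_null_left[OF \<mu>, of t] t by auto
        moreover from this have "emeasure \<mu> ({t - a<..<t} \<inter> {0<..h}) = 0"
          by (intro emeasure_eq_0[OF _ _ Int_lower1]) auto
        ultimately show ?thesis by (intro that[of a])
      qed
      have "emeasure \<mu> ({t} \<inter> {0<..h}) = 0"
      proof (cases "t \<in> {0<..h}")
        case True
        then show ?thesis using no by (simp add: Int_absorb2)
      qed simp
      moreover have "emeasure \<mu> ({t<..<t + b} \<inter> {0<..h}) = 0"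
        using b by (intro emeasure_eq_0[OF _ _ Int_lower1]) auto
      moreover have "{t - a<..<t + b} \<inter> {0<..h} =
          ({t - a<..<t} \<inter> {0<..h}) \<union> ({t} \<inter> {0<..h}) \<union> ({t<..<t + b} \<inter> {0<..h})"
        using a b by auto
      ultimately have "{t - a<..<t + b} \<inter> {0<..h} \<in> null_sets \<mu>"
        using a by (simp only:) (intro null_sets.Un, auto simp: null_sets_def)
      then have "emeasure \<mu> ({t - a<..<t + b} \<inter> {0<..h}) = 0"
        by (rule null_setsD1)
      then show ?thesis
        using a b by (intro exI[of _ "{t - a<..<t + b}"]) auto
    qed
    then obtain U where U: "\<And>t. t \<in> {0..h} \<Longrightarrow> open (U t) \<and> t \<in> U t \<and> emeasure \<mu> (U t \<inter> {0<..h}) = 0"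
      by metis
    have "compact {0..h}" by simp
    then obtain F where F: "F \<subseteq> {0..h}" "finite F" "{0..h} \<subseteq> (\<Union>t\<in>F. U t)"
      by (rule compactE_image[where C="{0..h}" and f=U]) (use U in auto)
    have "(\<Union>t\<in>F. U t \<inter> {0<..h}) \<in> null_sets \<mu>"
      using F U by (intro null_sets_UN') (auto simp: countable_finite null_sets_def subset_iff)
    then have "emeasure \<mu> (\<Union>t\<in>F. U t \<inter> {0<..h}) = 0"
      by (rule null_setsD1)
    moreover have "{0<..h} = (\<Union>t\<in>F. U t \<inter> {0<..h})"
      using F by force
    ultimately show False using one by simp
  qed
  then obtain s where s: "0 < s" "s \<le> h" "emeasure \<mu> {s} \<noteq> 0" by auto
  have le: "emeasure \<mu> {s} \<le> 1"
    unfolding one[symmetric] using s by (intro emeasure_mono) auto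
  then have 1: "emeasure \<mu> {s} = 1"
    using counts_on_line_atom[OF \<mu> s(1)] s(3) of_nat_ennreal_less_one[of "emeasure \<mu> {s}"]
    by (auto simp: less_le)
  have "emeasure \<mu> ({0<..h} - {s}) = emeasure \<mu> {0<..h} - emeasure \<mu> {s}"
    using s 1 by (intro emeasure_Diff) auto
  then show ?thesis using s 1 one by auto
qed

section \<open>Counting the jumps of a step function\<close>

definition right_step_at :: "(real \<Rightarrow> 'b) \<Rightarrow> real \<Rightarrow> bool" where
  "right_step_at D t \<longleftrightarrow> (\<exists>\<epsilon>>0. \<forall>s\<in>{t..<t + \<epsilon>}. D s = D t)"

definition steps_from_left_to :: "(real \<Rightarrow> 'b) \<Rightarrow> real \<Rightarrow> 'b \<Rightarrow> bool" where
  "steps_from_left_to D t c \<longleftrightarrow> (\<exists>\<epsilon>>0. \<forall>s\<in>{t - \<epsilon><..<t}. D s = c)"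

lemma steps_from_left_unique:
  assumes "steps_from_left_to D t c" "steps_from_left_to D t c'"
  shows "c = c'"
proof -
  obtain e e' where "0 < e" "\<forall>s\<in>{t - e<..<t}. D s = c" "0 < e'" "\<forall>s\<in>{t - e'<..<t}. D s = c'"
    using assms by (auto simp: steps_from_left_to_def)
  moreover define s where "s = t - min e e' / 2"
  ultimately have "s \<in> {t - e<..<t}" "s \<in> {t - e'<..<t}"
    by auto
  then show ?thesis
    using \<open>\<forall>s\<in>{t - e<..<t}. D s = c\<close> \<open>\<forall>s\<in>{t - e'<..<t}. D s = c'\<close> by metis
qed

text \<open>
  At the infimum \<open>\<tau>\<close> of the times where \<open>D\<close> differs from \<open>D a\<close>, the value is still \<open>D a\<close> by \<open>no_exit\<close>,
  and it persists for a while by \<open>right\<close>; so \<open>\<tau>\<close> is no infimum of such times.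
\<close>

lemma constant_by_no_first_exit:
  fixes D :: "real \<Rightarrow> 'b"
  assumes "a \<le> b"
    and right: "\<And>t. a \<le> t \<Longrightarrow> t < b \<Longrightarrow> right_step_at D t"
    and no_exit: "\<And>t. a < t \<Longrightarrow> t \<le> b \<Longrightarrow> (\<forall>s\<in>{a..<t}. D s = D a) \<Longrightarrow> D t = D a"
  shows "\<forall>s\<in>{a..b}. D s = D a"
proof (rule ccontr)
  assume neg: "\<not> ?thesis"
  define B where "B = {t\<in>{a..b}. D t \<noteq> D a}"
  define \<tau> where "\<tau> = Inf B"
  have B: "B \<noteq> {}" "bdd_below B"
    using neg by (auto simp: B_def bdd_below_def)
  have \<tau>: "a \<le> \<tau>" "\<tau> \<le> b"
  proof -
    show "a \<le> \<tau>"
      unfolding \<tau>_def using B by (intro cInf_greatest) (auto simp: B_def)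
    obtain t where "t \<in> B" using B by auto
    then show "\<tau> \<le> b"
      using cInf_lower[of t B] B by (auto simp: \<tau>_def B_def)
  qed
  have before: "D s = D a" if "s \<in> {a..<\<tau>}" for s
  proof (rule ccontr)
    assume "D s \<noteq> D a"
    then have "s \<in> B" using that \<tau> by (auto simp: B_def)
    then show False using cInf_lower[OF _ B(2), of s] that by (auto simp: \<tau>_def)
  qed
  have at: "D \<tau> = D a"
  proof (cases "\<tau> = a")
    case False
    then have "a < \<tau>" using \<tau> by simp
    then show ?thesis
    proof (rule no_exit[OF _ \<tau>(2)])
      show "\<forall>s\<in>{a..<\<tau>}. D s = D a" using before by blast
    qed
  qed simp
  obtain e where e: "0 < e" "\<forall>s\<in>B. \<tau> + e \<le> s"
  proof (cases "\<tau> < b")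
    case True
    then obtain e where "0 < e" and after: "\<forall>s\<in>{\<tau>..<\<tau> + e}. D s = D \<tau>"
      using right[OF \<tau>(1)] unfolding right_step_at_def by blast
    have "\<tau> + e \<le> s" if "s \<in> B" for s
    proof (rule ccontr)
      assume "\<not> \<tau> + e \<le> s"
      moreover have s: "a \<le> s" "D s \<noteq> D a" using that by (simp_all add: B_def)
      ultimately have "s \<in> {a..<\<tau>} \<or> s \<in> {\<tau>..<\<tau> + e}" by auto
      then show False
        using before after at s(2) by metis
    qed
    then show ?thesis
      using \<open>0 < e\<close> by (intro that[of e]) auto
  next
    case False
    then have "b = \<tau>" using \<tau> by simp
    have "D s = D a" if "s \<in> {a..b}" for s
    proof (cases "s = \<tau>")
      case False
      then have "s \<in> {a..<\<tau>}" using that \<open>b = \<tau>\<close> by auto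
      then show ?thesis by (rule before)
    qed (simp add: at)
    then have "B = {}" unfolding B_def by blast
    then show ?thesis using B by simp
  qed
  have "\<tau> + e \<le> Inf B"
    using e B by (intro cInf_greatest) auto
  then show False using e by (simp add: \<tau>_def)
qed

definition jumps_at :: "(real \<Rightarrow> 'b) \<Rightarrow> real \<Rightarrow> bool" where
  "jumps_at D t \<longleftrightarrow> \<not> steps_from_left_to D t (D t)"

lemma change_imp_jump:
  fixes D :: "real \<Rightarrow> 'b"
  assumes "a \<le> b" "D a \<noteq> D b" and right: "\<And>t. a \<le> t \<Longrightarrow> right_step_at D t"
  shows "\<exists>t\<in>{a<..b}. jumps_at D t"
proof (rule ccontr)
  assume no: "\<not> ?thesis"
  have "\<forall>s\<in>{a..b}. D s = D a"
  proof (rule constant_by_no_first_exit)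
    fix t assume t: "a < t" "t \<le> b" and const: "\<forall>s\<in>{a..<t}. D s = D a"
    have "steps_from_left_to D t (D t)"
      using no t by (auto simp: jumps_at_def)
    moreover have "steps_from_left_to D t (D a)"
      unfolding steps_from_left_to_def using t const
      by (intro exI[of _ "t - a"] conjI ballI bspec[OF const]) auto
    ultimately show "D t = D a"
      by (rule steps_from_left_unique)
  qed (use assms in auto)
  then have "D b = D a" using \<open>a \<le> b\<close> by (metis atLeastAtMost_iff order_refl)
  with assms(2) show False by simp
qed

definition dyadic_changes :: "(real \<Rightarrow> 'b) \<Rightarrow> real \<Rightarrow> nat \<Rightarrow> nat set" where
  "dyadic_changes D T n = {k. k < 2 ^ n \<and> D (real k * (T / 2 ^ n)) \<noteq> D (real (Suc k) * (T / 2 ^ n))}"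

lemma finite_dyadic_changes [simp]: "finite (dyadic_changes D T n)"
  by (rule finite_subset[of _ "{..<2 ^ n}"]) (auto simp: dyadic_changes_def)

text \<open>
  A function that takes different values at the ends of an interval does so at the ends of one of its
  two halves; \<open>f\<close> below selects such a half.
\<close>

lemma card_dyadic_changes_mono:
  "card (dyadic_changes D T n) \<le> card (dyadic_changes D T (Suc n))"
proof -
  define h where "h = T / 2 ^ Suc n"
  have h2: "T / 2 ^ n = 2 * h" by (simp add: h_def)
  define f where "f k = (if D (real (2 * k) * h) \<noteq> D (real (2 * k + 1) * h) then 2 * k else 2 * k + 1)" for k
  have "inj_on f (dyadic_changes D T n)"
  proof (rule inj_onI)
    fix k l assume "f k = f l"
    moreover have "f k div 2 = k" for k by (simp add: f_def)
    ultimately show "k = l" by metis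
  qed
  moreover have "f ` dyadic_changes D T n \<subseteq> dyadic_changes D T (Suc n)"
  proof safe
    fix k assume k: "k \<in> dyadic_changes D T n"
    then have "k < 2 ^ n" "D (real (2 * k) * h) \<noteq> D (real (2 * k + 2) * h)"
      unfolding dyadic_changes_def h2 by (auto simp: algebra_simps)
    then show "f k \<in> dyadic_changes D T (Suc n)"
      unfolding dyadic_changes_def h_def[symmetric] f_def by (auto simp: algebra_simps)
  qed
  ultimately show ?thesis
    by (rule card_inj_on_le) simp
qed

text \<open>
  A change across an interval is caused by a jump inside it, and different dyadic intervals give
  different jumps.
\<close>

lemma card_dyadic_changes_le:
  fixes D :: "real \<Rightarrow> 'b"
  assumes right: "\<And>t. 0 \<le> t \<Longrightarrow> right_step_at D t" and "0 \<le> T"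
  shows "\<exists>F. finite F \<and> F \<subseteq> {t\<in>{0<..T}. jumps_at D t} \<and> card F = card (dyadic_changes D T n)"
proof -
  define h where "h = T / 2 ^ n"
  have h: "0 \<le> h" "T = 2 ^ n * h" using assms by (auto simp: h_def)
  have "\<exists>t\<in>{real k * h<..real (Suc k) * h}. jumps_at D t" if "k \<in> dyadic_changes D T n" for k
  proof (rule change_imp_jump)
    show "real k * h \<le> real (Suc k) * h"
      using h by (intro mult_right_mono) auto
    show "D (real k * h) \<noteq> D (real (Suc k) * h)"
      using that unfolding dyadic_changes_def h_def by blast
    show "right_step_at D t" if "real k * h \<le> t" for t
      using that h by (intro right) (meson mult_nonneg_nonneg of_nat_0_le_iff order_trans)
  qed
  then obtain \<phi> where \<phi>: "\<And>k. k \<in> dyadic_changes D T n \<Longrightarrow> \<phi> k \<in> {real k * h<..real (Suc k) * h} \<and> jumps_at D (\<phi> k)"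
    by metis
  have less: "\<phi> k < \<phi> l" if "k < l" "k \<in> dyadic_changes D T n" "l \<in> dyadic_changes D T n" for k l
  proof -
    have "real (Suc k) * h \<le> real l * h"
      using that h by (intro mult_right_mono) auto
    then show ?thesis using \<phi>[of k] \<phi>[of l] that by auto
  qed
  have "inj_on \<phi> (dyadic_changes D T n)"
    by (rule inj_onI) (metis less less_irrefl nat_neq_iff)
  moreover have "\<phi> ` dyadic_changes D T n \<subseteq> {t\<in>{0<..T}. jumps_at D t}"
  proof safe
    fix k assume k: "k \<in> dyadic_changes D T n"
    then have "k < 2 ^ n" by (auto simp: dyadic_changes_def)
    then have "real (Suc k) \<le> 2 ^ n"
      by (metis Suc_leI of_nat_le_iff of_nat_numeral of_nat_power)
    then have "real (Suc k) * h \<le> 2 ^ n * h"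
      using h by (intro mult_right_mono)
    moreover have "0 \<le> real k * h" using h by simp
    ultimately show "\<phi> k \<in> {0<..T}" "jumps_at D (\<phi> k)"
      using \<phi>[OF k] unfolding h(2) greaterThanAtMost_iff by linarith+
  qed
  ultimately show ?thesis
    by (intro exI[of _ "\<phi> ` dyadic_changes D T n"]) (auto simp: card_image)
qed

lemma dyadic_interval_of:
  assumes "0 < t" "t \<le> T"
  shows "\<exists>k<2 ^ n. t \<in> {real k * (T / 2 ^ n)<..real (Suc k) * (T / 2 ^ n)}"
proof -
  define h where "h = T / 2 ^ n"
  have h: "0 < h" "T = 2 ^ n * h" using assms by (auto simp: h_def)
  define m where "m = nat \<lceil>t / h\<rceil>"
  have th: "0 < t / h" using h assms by simp
  then have m: "real m - 1 < t / h" "t / h \<le> real m" "1 \<le> m"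
    unfolding m_def by linarith+
  have "t / h \<le> 2 ^ n" using assms h by (simp add: field_simps)
  then have "\<lceil>t / h\<rceil> \<le> 2 ^ n" by (simp add: ceiling_le_iff)
  then have "m \<le> 2 ^ n" by (simp add: m_def nat_le_iff)
  then show ?thesis
    using m h unfolding h_def[symmetric]
    by (intro exI[of _ "m - 1"]) (auto simp: field_simps of_nat_diff)
qed

text \<open>
  If the mesh is smaller than the stretches of constancy next to finitely many jumps, then each of these
  jumps lies in a dyadic interval of its own and is the only reason for the values at its ends to
  differ.
\<close>

lemma card_jumps_le_dyadic:
  fixes D :: "real \<Rightarrow> 'b"
  assumes right: "\<And>t. 0 \<le> t \<Longrightarrow> right_step_at D t"
    and left: "\<And>t. 0 < t \<Longrightarrow> \<exists>c. steps_from_left_to D t c"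
    and F: "finite F" "F \<subseteq> {t\<in>{0<..T}. jumps_at D t}"
  shows "\<exists>n. card F \<le> card (dyadic_changes D T n)"
proof (cases "F = {}")
  case False
  then have "0 < T" using F by force
  have "\<exists>e>0. (\<exists>c. c \<noteq> D t \<and> (\<forall>s\<in>{t - e<..<t}. D s = c)) \<and> (\<forall>s\<in>{t..<t + e}. D s = D t)" if "t \<in> F" for t
  proof -
    have t: "0 < t" "jumps_at D t" using that F by auto
    obtain c e where c: "0 < e" "\<forall>s\<in>{t - e<..<t}. D s = c"
      using left[OF t(1)] unfolding steps_from_left_to_def by blast
    then have "c \<noteq> D t"
      using t(2) by (auto simp: jumps_at_def steps_from_left_to_def)
    obtain e' where e': "0 < e'" "\<forall>s\<in>{t..<t + e'}. D s = D t"
      using right[OF less_imp_le[OF t(1)]] unfolding right_step_at_def by blast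
    have "\<forall>s\<in>{t - min e e'<..<t}. D s = c"
      by (intro ballI bspec[OF c(2)]) auto
    moreover have "\<forall>s\<in>{t..<t + min e e'}. D s = D t"
      by (intro ballI bspec[OF e'(2)]) auto
    ultimately show ?thesis
      using c(1) e'(1) \<open>c \<noteq> D t\<close> by (metis min_less_iff_conj)
  qed
  then obtain e c where e: "\<And>t. t \<in> F \<Longrightarrow> 0 < e t"
    "\<And>t. t \<in> F \<Longrightarrow> c t \<noteq> D t"
    "\<And>t s. t \<in> F \<Longrightarrow> s \<in> {t - e t<..<t} \<Longrightarrow> D s = c t"
    "\<And>t s. t \<in> F \<Longrightarrow> s \<in> {t..<t + e t} \<Longrightarrow> D s = D t"
    by metis
  define d where "d = Min (e ` F)"
  have d: "0 < d" "\<And>t. t \<in> F \<Longrightarrow> d \<le> e t"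
    using F False e(1) by (auto simp: d_def)
  have "(\<lambda>n. T / 2 ^ n) \<longlonglongrightarrow> 0"
    using LIMSEQ_divide_realpow_zero[of 2 T] by simp
  then have "\<forall>\<^sub>F n in sequentially. T / 2 ^ n < d"
    using d by (intro order_tendstoD) auto
  then obtain n where n: "T / 2 ^ n < d"
    by (auto simp: eventually_sequentially)
  define h where "h = T / 2 ^ n"
  have h: "0 < h" "h < d" using n \<open>0 < T\<close> by (auto simp: h_def)
  have "\<forall>t\<in>F. \<exists>k. k < 2 ^ n \<and> t \<in> {real k * h<..real (Suc k) * h}"
    using dyadic_interval_of[of _ T n] F unfolding h_def by force
  then obtain \<kappa> where \<kappa>: "\<And>t. t \<in> F \<Longrightarrow> \<kappa> t < 2 ^ n"
    "\<And>t. t \<in> F \<Longrightarrow> t \<in> {real (\<kappa> t) * h<..real (Suc (\<kappa> t)) * h}"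
    by metis
  have step: "real (Suc k) * h = real k * h + h" for k by (simp add: algebra_simps)
  have ends: "D (real (\<kappa> t) * h) = c t" "D (real (Suc (\<kappa> t)) * h) = D t" if "t \<in> F" for t
  proof -
    have "real (\<kappa> t) * h \<in> {t - e t<..<t}" "real (Suc (\<kappa> t)) * h \<in> {t..<t + e t}"
      using \<kappa>[OF that] d(2)[OF that] h unfolding step by auto
    then show "D (real (\<kappa> t) * h) = c t" "D (real (Suc (\<kappa> t)) * h) = D t"
      using e(3,4)[OF that] by blast+
  qed
  have "inj_on \<kappa> F"
  proof (rule inj_onI, rule ccontr)
    fix s t assume st: "s \<in> F" "t \<in> F" "\<kappa> s = \<kappa> t" "s \<noteq> t"
    have False if "s < t" "s \<in> F" "t \<in> F" "\<kappa> s = \<kappa> t" for s t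
    proof -
      have "s \<in> {t - e t<..<t}" "t \<in> {s..<s + e s}"
        using \<kappa>(2)[of s] \<kappa>(2)[of t] that d(2)[of s] d(2)[of t] h unfolding step by auto
      then have "D s = c t" "D t = D s"
        using e(3)[OF \<open>t \<in> F\<close>] e(4)[OF \<open>s \<in> F\<close>] by blast+
      then show False using e(2)[of t] that by simp
    qed
    then show False using st by (metis linorder_neqE_linordered_idom)
  qed
  moreover have "\<kappa> ` F \<subseteq> dyadic_changes D T n"
    using \<kappa>(1) ends e(2) by (auto simp: dyadic_changes_def simp flip: h_def)
  ultimately have "card F \<le> card (dyadic_changes D T n)"
    by (rule card_inj_on_le) simp
  then show ?thesis by blast
qed auto

lemma switches_eq_SUP_card:
  "switches X T = (SUP F\<in>{F. finite F \<and> F \<subseteq> {t\<in>{0..T}. jump X t \<noteq> 0}}. of_nat (card F))"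
proof -
  have "switches X T = (\<Sum>\<^sub>\<infinity>t\<in>{t\<in>{0..T}. jump X t \<noteq> 0}. 1)"
    unfolding switches_def by (rule infsum_cong_neutral) auto
  then show ?thesis
    by (simp add: nonneg_infsum_complete)
qed

text \<open>
  Subtracting the continuous function \<open>t\<close> does not affect the jumps of \<open>X\<close>.
\<close>

lemma switches_eq_SUP_dyadic:
  fixes X :: "real \<Rightarrow> real"
  assumes right: "\<And>t. 0 \<le> t \<Longrightarrow> right_step_at (\<lambda>t. X t - t) t"
    and left: "\<And>t. 0 < t \<Longrightarrow> \<exists>c. steps_from_left_to (\<lambda>t. X t - t) t c" and "0 \<le> T"
  shows "switches X T = (SUP n. of_nat (card (dyadic_changes (\<lambda>t. X t - t) T n)))"
proof -
  let ?D = "\<lambda>t. X t - t"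
  have jump: "jump X t \<noteq> 0 \<longleftrightarrow> jumps_at ?D t" if "0 < t" for t
  proof -
    obtain c where c: "steps_from_left_to ?D t c" using left \<open>0 < t\<close> by blast
    then obtain e where e: "0 < e" "\<forall>s\<in>{t - e<..<t}. X s = c + s"
      by (auto simp: steps_from_left_to_def algebra_simps)
    have "\<forall>\<^sub>F s in at_left t. s \<in> {t - e<..<t}"
      using e by (intro eventually_at_left_real) auto
    then have "\<forall>\<^sub>F s in at_left t. c + s = X s"
      by eventually_elim (use e in auto)
    moreover have "((\<lambda>s. c + s) \<longlongrightarrow> c + t) (at_left t)"
      by (intro tendsto_intros)
    ultimately have "(X \<longlongrightarrow> c + t) (at_left t)"
      by (rule Lim_transform_eventually[rotated])
    then have "left_limit X t = c + t"
      using \<open>0 < t\<close> by (auto simp: left_limit_def intro!: tendsto_Lim)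
    then have "jump X t = ?D t - c" by (simp add: jump_def)
    moreover have "jumps_at ?D t \<longleftrightarrow> ?D t \<noteq> c"
      unfolding jumps_at_def using c steps_from_left_unique by metis
    ultimately show ?thesis by auto
  qed
  have [simp]: "jump X 0 = 0" by (simp add: jump_def left_limit_def)
  have "{t\<in>{0..T}. jump X t \<noteq> 0} = {t\<in>{0<..T}. jump X t \<noteq> 0}"
    by (auto simp: less_le)
  also have "\<dots> = {t\<in>{0<..T}. jumps_at ?D t}"
    using jump by auto
  finally have set: "{t\<in>{0..T}. jump X t \<noteq> 0} = {t\<in>{0<..T}. jumps_at ?D t}" .
  show ?thesis unfolding switches_eq_SUP_card set
  proof (rule antisym)
    show "(SUP F\<in>{F. finite F \<and> F \<subseteq> {t\<in>{0<..T}. jumps_at ?D t}}. of_nat (card F))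
        \<le> (SUP n. of_nat (card (dyadic_changes ?D T n)) :: ennreal)"
    proof (rule SUP_least, clarify)
      fix F assume "finite F" "F \<subseteq> {t\<in>{0<..T}. jumps_at ?D t}"
      then obtain n where "card F \<le> card (dyadic_changes ?D T n)"
        using card_jumps_le_dyadic[OF right left] by blast
      then show "of_nat (card F) \<le> (SUP n. of_nat (card (dyadic_changes ?D T n)) :: ennreal)"
        by (intro SUP_upper2[of n]) auto
    qed
    show "(SUP n. of_nat (card (dyadic_changes ?D T n)) :: ennreal)
      \<le> (SUP F\<in>{F. finite F \<and> F \<subseteq> {t\<in>{0<..T}. jumps_at ?D t}}. of_nat (card F))"
    proof (rule SUP_least)
      fix n
      obtain F where "finite F" "F \<subseteq> {t\<in>{0<..T}. jumps_at ?D t}" "card F = card (dyadic_changes ?D T n)"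
        using card_dyadic_changes_le[OF right \<open>0 \<le> T\<close>] by blast
      then show "of_nat (card (dyadic_changes ?D T n)) \<le>
          (SUP F\<in>{F. finite F \<and> F \<subseteq> {t\<in>{0<..T}. jumps_at ?D t}}. of_nat (card F) :: ennreal)"
        by (intro SUP_upper2[of F]) auto
    qed
  qed
qed

section \<open>Single paths of the Bouncy Particle Sampler\<close>

text \<open>
  The image on the time axis of the restriction of \<open>m\<close> to \<open>A\<close>. It reduces statements about the times
  of the atoms in \<open>A\<close> to measures on the line.
\<close>

definition time_count :: "(real \<times> 'b) measure \<Rightarrow> (real \<times> 'b) set \<Rightarrow> real measure" where
  "time_count m A = distr (density m (indicator A)) borel fst"

lemma sets_time_count [simp, measurable_cong]: "sets (time_count m A) = sets borel"
  by (simp add: time_count_def)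

lemma emeasure_time_count:
  assumes m: "sets m = sets (restrict_space lborel {0..} \<Otimes>\<^sub>M K)"
    and A: "A \<in> sets m" and B: "B \<in> sets borel"
  shows "emeasure (time_count m A) B = emeasure m {p \<in> A. fst p \<in> B}"
proof -
  have "fst \<in> m \<rightarrow>\<^sub>M restrict_space lborel {0..}"
    by (subst measurable_cong_sets[OF m refl]) simp
  then have fst: "fst \<in> m \<rightarrow>\<^sub>M borel"
    by (simp add: measurable_restrict_space2_iff)
  have "{p \<in> A. fst p \<in> B} = A \<inter> (fst -` B \<inter> space m)"
    using sets.sets_into_space[OF A] by auto
  moreover have pre: "fst -` B \<inter> space m \<in> sets m"
    using fst B by (rule measurable_sets)
  ultimately show ?thesis
    using A fst B by (simp add: time_count_def emeasure_distr emeasure_density nn_integral_indicator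
        flip: indicator_inter_arith)
qed

lemma mark_measurable:
  fixes m :: "(real \<times> 'a::euclidean_space) measure"
  assumes m: "sets m = sets (restrict_space lborel {0..} \<Otimes>\<^sub>M restrict_space sphere_uniform (sphere 0 1))"
  shows "fst \<in> borel_measurable m" "snd \<in> borel_measurable m"
proof -
  have "fst \<in> m \<rightarrow>\<^sub>M restrict_space lborel {0..}"
    by (subst measurable_cong_sets[OF m refl]) simp
  then show "fst \<in> borel_measurable m" by (simp add: measurable_restrict_space2_iff)
  have "snd \<in> m \<rightarrow>\<^sub>M restrict_space sphere_uniform (sphere 0 1)"
    by (subst measurable_cong_sets[OF m refl]) simp
  then show "snd \<in> borel_measurable m"
    by (simp add: measurable_restrict_space2_iff sphere_uniform_def)
qed

text \<open>
  One path, together with the almost sure properties of its driving measures that the pathwise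
  arguments use. Integer levels suffice because they cut off the bounce measure above any bound for
  the momentum.
\<close>

locale bps_realisation =
  fixes N :: "(real \<times> real) measure" and R :: "(real \<times> 'a::euclidean_space) measure"
    and x v :: "real \<Rightarrow> 'a"
  assumes path: "bps_path N R x v"
    and sets_N: "sets N = sets (restrict_space lborel {0..} \<Otimes>\<^sub>M restrict_space lborel {0..})"
    and sets_R: "sets R = sets (restrict_space lborel {0..} \<Otimes>\<^sub>M restrict_space sphere_uniform (sphere 0 1))"
    and N_counts: "\<And>k::nat. counts_on_line (time_count N ({0..} \<times> {0..real k}))"
    and R_counts: "counts_on_line (time_count R ({0..} \<times> sphere 0 1))"
begin

lemma N_sets:
  assumes "B \<in> sets borel" "B \<subseteq> {0..}" "C \<in> sets borel" "C \<subseteq> {0..}"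
  shows "B \<times> C \<in> sets N"
  unfolding sets_N using assms by (intro pair_measureI) (auto simp: sets_restrict_space_iff)

lemma R_sets:
  assumes "B \<in> sets borel" "B \<subseteq> {0..}"
  shows "B \<times> sphere 0 1 \<in> sets R"
  unfolding sets_R
proof (rule pair_measureI)
  show "B \<in> sets (restrict_space lborel {0..})"
    using assms by (auto simp: sets_restrict_space_iff)
  have "space (restrict_space sphere_uniform (sphere 0 1 :: 'a set)) = sphere 0 1"
    by (simp add: space_restrict_space sphere_uniform_def)
  then show "sphere 0 1 \<in> sets (restrict_space sphere_uniform (sphere 0 1 :: 'a set))"
    by (metis sets.top)
qed

lemma time_count_N:
  assumes "B \<in> sets borel" "B \<subseteq> {0..}"
  shows "emeasure (time_count N ({0..} \<times> {0..a})) B = emeasure N (B \<times> {0..a})"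
proof -
  have "{p \<in> {0..} \<times> {0..a}. fst p \<in> B} = B \<times> {0..a}" using assms by auto
  then show ?thesis
    using emeasure_time_count[OF sets_N, of "{0..} \<times> {0..a}" B] assms
    by (simp add: N_sets)
qed

lemma time_count_R:
  assumes "B \<in> sets borel" "B \<subseteq> {0..}"
  shows "emeasure (time_count R ({0..} \<times> sphere 0 1)) B = emeasure R (B \<times> sphere 0 1)"
proof -
  have "{p \<in> {0..} \<times> sphere (0::'a) 1. fst p \<in> B} = B \<times> sphere 0 1" using assms by auto
  from this[simplified] show ?thesis
    using emeasure_time_count[OF sets_R, of "{0..} \<times> sphere 0 1" B] R_sets[of "{0..}"] assms
    by simp
qed

lemma path_equations:
  assumes "0 \<le> t"
  shows norm_velocity: "norm (v t) = 1"
    and velocity_integrable_from_0: "set_integrable lborel {0..t} v"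
    and position_equation: "x t = x 0 + (LINT s:{0..t}|lborel. v s)"
    and bounce_integrable_from_0: "set_integrable N ({0<..t} \<times> {0..}) (bounce_integrand x v)"
    and refresh_integrable_from_0: "set_integrable R ({0<..t} \<times> sphere 0 1) (refresh_integrand v)"
    and velocity_equation: "v t = v 0 + (LINT p:{0<..t} \<times> {0..}|N. bounce_integrand x v p)
          + (LINT p:{0<..t} \<times> sphere 0 1|R. refresh_integrand v p)"
proof -
  have "v t \<in> sphere 0 1" using path assms unfolding bps_path_def by blast
  then show "norm (v t) = 1" by simp
qed (use path assms in \<open>unfold bps_path_def, blast\<close>)+

lemma inner_velocity_self: "0 \<le> t \<Longrightarrow> v t \<bullet> v t = 1"
  using norm_velocity[of t] by (simp add: dot_square_norm)

lemma velocity_integrable: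
  assumes "0 \<le> s" "s \<le> t"
  shows "set_integrable lborel {s<..t} v"
proof -
  have "set_integrable lborel {0..t} v" using assms by (intro velocity_integrable_from_0) auto
  then show ?thesis by (rule set_integrable_subset) (use assms in auto)
qed

lemma position_increment:
  assumes "0 \<le> s" "s \<le> t"
  shows "x t = x s + (LINT r:{s<..t}|lborel. v r)"
proof -
  have "set_integrable lborel {0..s} v" using assms by (intro velocity_integrable_from_0)
  then have "(LINT r:{0..s} \<union> {s<..t}|lborel. v r) = (LINT r:{0..s}|lborel. v r) + (LINT r:{s<..t}|lborel. v r)"
    using velocity_integrable[OF assms] by (intro set_integral_Un) auto
  moreover have "{0..s} \<union> {s<..t} = {0..t}" using assms by auto
  ultimately have "(LINT r:{0..t}|lborel. v r) = (LINT r:{0..s}|lborel. v r) + (LINT r:{s<..t}|lborel. v r)"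
    by simp
  then show ?thesis
    using position_equation[of s] position_equation[of t] assms by (metis add.assoc order_trans)
qed

text \<open>
  The end point \<open>b\<close> is a null set for the integral of the velocity, so the velocity may change there;
  this covers the interval up to the first event.
\<close>

lemma position_linear:
  assumes "0 \<le> a" "a \<le> b" and v: "\<And>r. r \<in> {a..<b} \<Longrightarrow> v r = w"
  shows "x b = x a + (b - a) *\<^sub>R w"
proof -
  have "(LINT r:{a<..b}|lborel. v r) = (LINT r:{a<..b}|lborel. w)"
    unfolding set_lebesgue_integral_def
  proof (rule integral_cong_AE)
    show "(\<lambda>r. indicator {a<..b} r *\<^sub>R v r) \<in> borel_measurable lborel"
      using velocity_integrable[OF assms(1,2)] unfolding set_integrable_def
      by (rule borel_measurable_integrable)
    show "AE r in lborel. indicator {a<..b} r *\<^sub>R v r = indicator {a<..b} r *\<^sub>R w"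
      using AE_lborel_singleton[of b]
    proof eventually_elim
      case (elim r)
      then show ?case
        by (cases "r \<in> {a<..b}") (simp_all add: v)
    qed
  qed simp
  also have "\<dots> = (b - a) *\<^sub>R w"
    using assms(1,2) by (subst set_integral_const) auto
  finally show ?thesis
    using position_increment[OF assms(1,2)] by simp
qed

lemma position_lipschitz:
  assumes "0 \<le> s" "s \<le> t"
  shows "norm (x t - x s) \<le> t - s"
proof -
  have "norm (LINT r:{s<..t}|lborel. v r) \<le> (LINT r:{s<..t}|lborel. norm (v r))"
    using velocity_integrable[OF assms] by (rule set_integral_norm_bound)
  also have "\<dots> = (LINT r:{s<..t}|lborel. 1)"
    using assms norm_velocity by (intro set_lebesgue_integral_cong) auto
  also have "\<dots> = t - s"
    using assms by (simp add: set_lebesgue_integral_def)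
  finally show ?thesis
    using position_increment[OF assms] by simp
qed

lemma norm_position: "0 \<le> t \<Longrightarrow> norm (x t) \<le> norm (x 0) + t"
  using position_lipschitz[of 0 t] norm_triangle_sub[of "x t" "x 0"] by simp

lemma position_left_limit:
  assumes "0 \<le> s" shows "left_limit x s = x s"
proof (cases "s = 0")
  case False
  have "((\<lambda>r. x r - x s) \<longlongrightarrow> 0) (at_left s)"
  proof (rule Lim_null_comparison)
    have "\<forall>\<^sub>F r in at_left s. r \<in> {0<..<s}"
      using False assms by (intro eventually_at_left_real) auto
    then show "\<forall>\<^sub>F r in at_left s. norm (x r - x s) \<le> s - r"
      by eventually_elim (use position_lipschitz[of _ s] in \<open>auto simp: norm_minus_commute\<close>)
    have "((\<lambda>r. s - r) \<longlongrightarrow> s - s) (at_left s)" by (intro tendsto_intros)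
    then show "((\<lambda>r. s - r) \<longlongrightarrow> 0) (at_left s)" by simp
  qed
  then have "(x \<longlongrightarrow> x s) (at_left s)" by (simp add: LIM_zero_iff)
  then show ?thesis using False by (auto simp: left_limit_def intro!: tendsto_Lim)
qed (simp add: left_limit_def)

lemma norm_velocity_left_limit:
  assumes "0 \<le> s" shows "norm (left_limit v s) = 1"
proof (cases "s = 0")
  case False
  then obtain l where l: "(v \<longlongrightarrow> l) (at_left s)"
    using path assms unfolding bps_path_def cadlag_def by (metis less_le)
  have "\<forall>\<^sub>F r in at_left s. r \<in> {0<..<s}"
    using False assms by (intro eventually_at_left_real) auto
  then have "\<forall>\<^sub>F r in at_left s. 1 = norm (v r)"
    by eventually_elim (simp add: norm_velocity)
  then have "((\<lambda>r. norm (v r)) \<longlongrightarrow> 1) (at_left s)"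
    by (rule Lim_transform_eventually[OF tendsto_const])
  then have "norm l = 1"
    using tendsto_norm[OF l] tendsto_unique[OF trivial_limit_at_left_real] by metis
  then show ?thesis
    using False tendsto_Lim[OF _ l] by (simp add: left_limit_def)
qed (simp add: left_limit_def norm_velocity)

lemma velocity_left_limit_const:
  assumes "0 \<le> a" "a < s" and v: "\<And>r. r \<in> {a..<s} \<Longrightarrow> v r = w"
  shows "left_limit v s = w"
proof -
  have "\<forall>\<^sub>F r in at_left s. r \<in> {a<..<s}"
    using assms by (intro eventually_at_left_real) auto
  then have "\<forall>\<^sub>F r in at_left s. w = v r"
    by eventually_elim (simp add: v)
  then have "(v \<longlongrightarrow> w) (at_left s)"
    by (rule Lim_transform_eventually[OF tendsto_const])
  then show ?thesis
    using assms by (auto simp: left_limit_def intro!: tendsto_Lim)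
qed

lemma velocity_increment:
  assumes "0 \<le> s" "s \<le> t"
  shows "v t = v s + (LINT p:{s<..t} \<times> {0..}|N. bounce_integrand x v p)
                   + (LINT p:{s<..t} \<times> sphere 0 1|R. refresh_integrand v p)"
proof -
  have "set_integrable N ({0<..t} \<times> {0..}) (bounce_integrand x v)"
    and "set_integrable R ({0<..t} \<times> sphere 0 1) (refresh_integrand v)"
    using assms by (auto intro: bounce_integrable_from_0 refresh_integrable_from_0)
  then have iN: "set_integrable N ({s<..t} \<times> {0..}) (bounce_integrand x v)"
      "set_integrable N ({0<..s} \<times> {0..}) (bounce_integrand x v)"
    and iR: "set_integrable R ({s<..t} \<times> sphere 0 1) (refresh_integrand v)"
      "set_integrable R ({0<..s} \<times> sphere 0 1) (refresh_integrand v)"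
    using assms by (auto elim!: set_integrable_subset intro!: N_sets R_sets)
  have eq: "{0<..s} \<times> C \<union> {s<..t} \<times> C = {0<..t} \<times> C" for C :: "'c set"
    using assms by auto
  have 1: "(LINT p:{0<..t} \<times> {0..}|N. bounce_integrand x v p) =
      (LINT p:{0<..s} \<times> {0..}|N. bounce_integrand x v p) + (LINT p:{s<..t} \<times> {0..}|N. bounce_integrand x v p)"
    unfolding eq[symmetric] by (intro set_integral_Un iN) auto
  have 2: "(LINT p:{0<..t} \<times> sphere 0 1|R. refresh_integrand v p) =
      (LINT p:{0<..s} \<times> sphere 0 1|R. refresh_integrand v p) + (LINT p:{s<..t} \<times> sphere 0 1|R. refresh_integrand v p)"
    unfolding eq[symmetric] by (intro set_integral_Un iR) auto
  show ?thesis
    unfolding velocity_equation[OF order_trans[OF assms]] velocity_equation[OF assms(1)] 1 2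
    by (simp only: add_ac)
qed

text \<open>
  The bounce integrand at time \<open>r\<close> vanishes on marks above the momentum just before \<open>r\<close>, so marks
  above \<open>K\<close> do not contribute, and below \<open>K\<close> there are none.
\<close>

lemma bounce_integral_zero:
  assumes "0 \<le> s" and null: "emeasure N ({s<..t} \<times> {0..K}) = 0" and "0 \<le> K"
    and low: "\<And>r. r \<in> {s<..t} \<Longrightarrow> left_limit x r \<bullet> left_limit v r \<le> K"
  shows "(LINT p:{s<..t} \<times> {0..}|N. bounce_integrand x v p) = 0"
  unfolding set_lebesgue_integral_def
proof (rule integral_eq_zero_AE)
  have "AE p in N. p \<notin> {s<..t} \<times> {0..K}"
    using null assms by (intro AE_not_in) (auto simp: null_sets_def intro!: N_sets)
  then show "AE p in N. indicator ({s<..t} \<times> {0..}) p *\<^sub>R bounce_integrand x v p = 0"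
  proof eventually_elim
    case (elim p)
    then show ?case
      using low[of "fst p"] \<open>0 \<le> K\<close>
      by (cases p) (auto simp: bounce_integrand_def indicator_def max_def)
  qed
qed

lemma refresh_integral_zero:
  assumes "0 \<le> s" and null: "emeasure R ({s<..t} \<times> sphere 0 1) = 0"
  shows "(LINT p:{s<..t} \<times> sphere 0 1|R. refresh_integrand v p) = 0"
  unfolding set_lebesgue_integral_def
proof (rule integral_eq_zero_AE)
  have "AE p in R. p \<notin> {s<..t} \<times> sphere 0 1"
    using null assms by (intro AE_not_in) (auto simp: null_sets_def intro!: R_sets)
  then show "AE p in R. indicator ({s<..t} \<times> sphere 0 1) p *\<^sub>R refresh_integrand v p = 0"
    by eventually_elim auto
qed

lemma left_momentum_le_norm:
  assumes "0 \<le> r" shows "left_limit x r \<bullet> left_limit v r \<le> norm (x 0) + r"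
proof -
  have "left_limit x r \<bullet> left_limit v r \<le> norm (x r) * 1"
    using norm_cauchy_schwarz[of "left_limit x r" "left_limit v r"] assms
    by (simp add: position_left_limit norm_velocity_left_limit)
  then show ?thesis using norm_position[OF assms] by simp
qed

lemma velocity_constant:
  assumes "0 \<le> s" "s \<le> t" "norm (x 0) + t \<le> K"
    and "emeasure N ({s<..t} \<times> {0..K}) = 0" "emeasure R ({s<..t} \<times> sphere 0 1) = 0"
  shows "v t = v s"
proof -
  have "0 \<le> K" using assms norm_ge_zero[of "x 0"] by linarith
  have "left_limit x r \<bullet> left_limit v r \<le> K" if "r \<in> {s<..t}" for r
    using left_momentum_le_norm[of r] that assms(1,3) by auto
  then have "(LINT p:{s<..t} \<times> {0..}|N. bounce_integrand x v p) = 0"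
    by (rule bounce_integral_zero[OF assms(1,4) \<open>0 \<le> K\<close>])
  then show ?thesis
    using velocity_increment[OF assms(1,2)] refresh_integral_zero[OF assms(1,5)] by simp
qed

text \<open>
  Between events, \<open>x\<close> moves along the unit vector \<open>v\<close>, so the momentum grows with slope one and this
  difference is constant.
\<close>

definition clock :: "real \<Rightarrow> real" where
  "clock t = x t \<bullet> v t - t"

lemma clock_constant:
  assumes "0 \<le> a" "a \<le> b" and v: "\<And>r. r \<in> {a..b} \<Longrightarrow> v r = v a"
  shows "clock b = clock a"
proof -
  have "x b = x a + (b - a) *\<^sub>R v a"
    using assms(1,2) by (rule position_linear) (rule v, auto)
  moreover have "v b = v a" using assms(1,2) by (intro v) auto
  ultimately show ?thesis
    using assms(1) inner_velocity_self[of a] by (simp add: clock_def inner_simps)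
qed

lemma clock_constant_interval:
  assumes "0 \<le> s" "s \<le> t" "norm (x 0) + t \<le> K"
    and N: "emeasure N ({s<..t} \<times> {0..K}) = 0" and R: "emeasure R ({s<..t} \<times> sphere 0 1) = 0"
  shows "clock t = clock s"
proof (rule clock_constant[OF assms(1,2)])
  fix r assume r: "r \<in> {s..t}"
  have "emeasure N ({s<..r} \<times> {0..K}) = 0" "emeasure R ({s<..r} \<times> sphere 0 1) = 0"
    using r assms by (auto intro!: emeasure_eq_0[OF _ N] emeasure_eq_0[OF _ R] N_sets R_sets)
  then show "v r = v s"
    using r assms by (intro velocity_constant[where K=K]) auto
qed

lemma N_null_right:
  assumes "0 \<le> t" obtains d where "0 < d" "emeasure N ({t<..<t + d} \<times> {0..real k}) = 0"
proof -
  obtain d where d: "0 < d" "emeasure (time_count N ({0..} \<times> {0..real k})) {t<..<t + d} = 0"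
    using counts_on_line_null_right[OF N_counts assms] by blast
  then show thesis
    using assms by (intro that[of d]) (simp_all add: time_count_N subset_iff)
qed

lemma R_null_right:
  assumes "0 \<le> t" obtains d where "0 < d" "emeasure R ({t<..<t + d} \<times> sphere 0 1) = 0"
proof -
  obtain d where d: "0 < d" "emeasure (time_count R ({0..} \<times> sphere 0 1)) {t<..<t + d} = 0"
    using counts_on_line_null_right[OF R_counts assms] by blast
  then show thesis
    using assms by (intro that[of d]) (simp_all add: time_count_R subset_iff)
qed

lemma N_null_left:
  assumes "0 < t" obtains d where "0 < d" "d \<le> t" "emeasure N ({t - d<..<t} \<times> {0..real k}) = 0"
proof -
  obtain d where d: "0 < d" "d \<le> t" "emeasure (time_count N ({0..} \<times> {0..real k})) {t - d<..<t} = 0"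
    using counts_on_line_null_left[OF N_counts assms] by blast
  then show thesis
    using assms by (intro that[of d]) (simp_all add: time_count_N subset_iff)
qed

lemma R_null_left:
  assumes "0 < t" obtains d where "0 < d" "d \<le> t" "emeasure R ({t - d<..<t} \<times> sphere 0 1) = 0"
proof -
  obtain d where d: "0 < d" "d \<le> t" "emeasure (time_count R ({0..} \<times> sphere 0 1)) {t - d<..<t} = 0"
    using counts_on_line_null_left[OF R_counts assms] by blast
  then show thesis
    using assms by (intro that[of d]) (simp_all add: time_count_R subset_iff)
qed

lemma clock_right_step:
  assumes "0 \<le> t" shows "right_step_at clock t"
proof -
  obtain k :: nat where k: "norm (x 0) + t + 1 \<le> real k"
    using real_arch_simple by blast
  obtain d where d: "0 < d" "emeasure N ({t<..<t + d} \<times> {0..real k}) = 0"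
    using N_null_right[OF assms] by blast
  obtain e where e: "0 < e" "emeasure R ({t<..<t + e} \<times> sphere 0 1) = 0"
    using R_null_right[OF assms] by blast
  have const: "clock s = clock t" if "s \<in> {t..<t + min 1 (min d e)}" for s
  proof (rule clock_constant_interval)
    have "{t<..s} \<times> {0..real k} \<subseteq> {t<..<t + d} \<times> {0..real k}" "{t<..s} \<times> sphere 0 1 \<subseteq> {t<..<t + e} \<times> sphere (0::'a) 1"
      using that by auto
    then show "emeasure N ({t<..s} \<times> {0..real k}) = 0" "emeasure R ({t<..s} \<times> sphere 0 1) = 0"
      using d(2) e(2) assms
      by (auto intro!: emeasure_eq_0[OF _ d(2)] emeasure_eq_0[OF _ e(2)] N_sets R_sets)
  qed (use that assms k in auto)
  then show ?thesis
    unfolding right_step_at_def using d(1) e(1)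
    by (intro exI[of _ "min 1 (min d e)"] conjI ballI const) auto
qed

lemma clock_left_step:
  assumes "0 < t" shows "\<exists>c. steps_from_left_to clock t c"
proof -
  obtain k :: nat where k: "norm (x 0) + t + 1 \<le> real k"
    using real_arch_simple by blast
  obtain d where d: "0 < d" "d \<le> t" "emeasure N ({t - d<..<t} \<times> {0..real k}) = 0"
    using N_null_left[OF assms] by blast
  obtain e where e: "0 < e" "e \<le> t" "emeasure R ({t - e<..<t} \<times> sphere 0 1) = 0"
    using R_null_left[OF assms] by blast
  have const: "clock s = clock r" if "r \<le> s" "r \<in> {t - min d e<..<t}" "s \<in> {t - min d e<..<t}" for r s
  proof (rule clock_constant_interval)
    have "{r<..s} \<times> {0..real k} \<subseteq> {t - d<..<t} \<times> {0..real k}" "{r<..s} \<times> sphere 0 1 \<subseteq> {t - e<..<t} \<times> sphere (0::'a) 1"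
      using that by auto
    then show "emeasure N ({r<..s} \<times> {0..real k}) = 0" "emeasure R ({r<..s} \<times> sphere 0 1) = 0"
      using d e assms
      by (auto intro!: emeasure_eq_0[OF _ d(3)] emeasure_eq_0[OF _ e(3)] N_sets R_sets)
  qed (use that assms k d e in auto)
  define m where "m = t - min d e / 2"
  have "m \<in> {t - min d e<..<t}" using d e by (auto simp: m_def)
  then have "\<forall>s\<in>{t - min d e<..<t}. clock s = clock m"
    using const by (metis linear)
  then show ?thesis
    unfolding steps_from_left_to_def using d e by (metis min_less_iff_conj)
qed

text \<open>
  As long as no event has occurred, the momentum at time \<open>r\<close> equals \<open>x 0 \<bullet> v 0 + r\<close>. So the first
  bounce needs a mark below this sharp level, while the later path is only known to stay below
  \<open>norm (x 0) + h\<close>. The argument by first exit avoids the cruder level.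
\<close>

lemma clock_undisturbed:
  assumes "0 \<le> h" and R0: "emeasure R ({0<..h} \<times> sphere 0 1) = 0"
    and N0: "emeasure N ({0<..h} \<times> {0..b}) = 0"
    and b: "max 0 (x 0 \<bullet> v 0) + h \<le> b"
  shows "clock h = clock 0"
proof -
  have const: "\<forall>s\<in>{0..h}. v s = v 0"
  proof (rule constant_by_no_first_exit[OF \<open>0 \<le> h\<close>])
    fix t assume t: "0 \<le> t" "t < h"
    obtain k :: nat where k: "norm (x 0) + t + 1 \<le> real k"
      using real_arch_simple by blast
    obtain d where d: "0 < d" "emeasure N ({t<..<t + d} \<times> {0..real k}) = 0"
      using N_null_right[OF t(1)] by blast
    have const: "v s = v t" if "s \<in> {t..<t + min (min 1 (h - t)) d}" for s
    proof (rule velocity_constant)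
      have "{t<..s} \<times> {0..real k} \<subseteq> {t<..<t + d} \<times> {0..real k}" "{t<..s} \<times> sphere 0 1 \<subseteq> {0<..h} \<times> sphere (0::'a) 1"
        using that t by auto
      then show "emeasure N ({t<..s} \<times> {0..real k}) = 0" "emeasure R ({t<..s} \<times> sphere 0 1) = 0"
        using t by (auto intro!: emeasure_eq_0[OF _ d(2)] emeasure_eq_0[OF _ R0] N_sets R_sets)
    qed (use that t k in auto)
    then show "right_step_at v t"
      unfolding right_step_at_def using d(1) t
      by (intro exI[of _ "min (min 1 (h - t)) d"] conjI ballI const) auto
  next
    fix t assume t: "0 < t" "t \<le> h" and const: "\<forall>s\<in>{0..<t}. v s = v 0"
    have N: "emeasure N ({0<..t} \<times> {0..b}) = 0" and R: "emeasure R ({0<..t} \<times> sphere 0 1) = 0"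
      using t by (auto intro!: emeasure_eq_0[OF _ N0] emeasure_eq_0[OF _ R0] N_sets R_sets)
    have low: "left_limit x r \<bullet> left_limit v r \<le> b" if r: "r \<in> {0<..t}" for r
    proof -
      have "left_limit v r = v 0"
        using t r by (intro velocity_left_limit_const[of 0] bspec[OF const]) auto
      moreover have "x r = x 0 + (r - 0) *\<^sub>R v 0"
        using t r by (intro position_linear bspec[OF const]) auto
      ultimately show ?thesis
        using r b t inner_velocity_self[of 0] max.cobounded2[of "x 0 \<bullet> v 0" 0]
        by (simp add: position_left_limit inner_simps del: max.cobounded2)
    qed
    have "(LINT p:{0<..t} \<times> {0..}|N. bounce_integrand x v p) = 0"
      using b \<open>0 \<le> h\<close> by (intro bounce_integral_zero[OF _ N] low) auto
    then show "v t = v 0"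
      using velocity_increment[of 0 t] refresh_integral_zero[OF _ R] t by simp
  qed
  show ?thesis
    using \<open>0 \<le> h\<close> by (intro clock_constant bspec[OF const]) auto
qed

lemma clock_single_velocity_change:
  assumes s: "0 < s" "s \<le> h" and before: "\<And>r. r \<in> {0..<s} \<Longrightarrow> v r = v 0"
    and after: "\<And>r. r \<in> {s..h} \<Longrightarrow> v r = v s"
  shows "clock h - clock 0 = (x 0 + s *\<^sub>R v 0) \<bullet> (v h - v 0)"
proof -
  have "x s = x 0 + (s - 0) *\<^sub>R v 0"
    using s by (intro position_linear before) auto
  moreover have "clock h = clock s"
    using s by (intro clock_constant after) auto
  moreover have "v h = v s" using s by (intro after) auto
  ultimately show ?thesis
    using inner_velocity_self[of 0] by (simp add: clock_def inner_simps)
qed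

text \<open>
  The velocity is \<open>v 0\<close> up to the time \<open>s\<close> of the refreshment, and then it is the new direction. Both
  \<open>s\<close> and the new direction are written as integrals with respect to \<open>R\<close>, which exhibits them as
  measurable functions of \<open>R\<close> and so as independent of the initial state.
\<close>

lemma clock_one_refresh:
  assumes R1: "emeasure R ({0<..h} \<times> sphere 0 1) = 1"
    and N0: "emeasure N ({0<..h} \<times> {0..K}) = 0" and K: "norm (x 0) + h \<le> K"
  shows "clock h - clock 0 =
      (x 0 + (LINT p:{0<..h} \<times> sphere 0 1|R. fst p) *\<^sub>R v 0) \<bullet>
      ((LINT p:{0<..h} \<times> sphere 0 1|R. snd p) - v 0)"
proof -
  have "emeasure (time_count R ({0..} \<times> sphere 0 1)) {0<..h} = 1"
    using R1 by (subst time_count_R) auto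
  then obtain s where s: "0 < s" "s \<le> h"
    and off': "emeasure (time_count R ({0..} \<times> sphere 0 1)) ({0<..h} - {s}) = 0"
    using counts_on_line_single_point[OF R_counts] by blast
  have off: "emeasure R (({0<..h} - {s}) \<times> sphere 0 1) = 0"
    using off' by (subst (asm) time_count_R) auto
  have "0 \<le> K" using K s norm_ge_zero[of "x 0"] by linarith
  have const: "v r = v r'" if "0 \<le> r'" "r' \<le> r" "r \<le> h" "s \<notin> {r'<..r}" for r r'
  proof (rule velocity_constant)
    show "emeasure N ({r'<..r} \<times> {0..K}) = 0" "emeasure R ({r'<..r} \<times> sphere 0 1) = 0"
      using that by (auto intro!: emeasure_eq_0[OF _ N0] emeasure_eq_0[OF _ off] N_sets R_sets)
  qed (use that K in auto)
  have before: "v r = v 0" if "r \<in> {0..<s}" for r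
    using that s by (intro const) auto
  have "left_limit v s = v 0"
    using s by (intro velocity_left_limit_const[of 0] before) auto
  have AE: "AE p in R. p \<in> {0<..h} \<times> sphere 0 1 \<longrightarrow> fst p = s"
  proof -
    have "AE p in R. p \<notin> ({0<..h} - {s}) \<times> sphere 0 1"
      using off by (intro AE_not_in) (auto simp: null_sets_def intro!: R_sets)
    then show ?thesis by eventually_elim auto
  qed
  have set: "{0<..h} \<times> sphere 0 1 \<in> sets R" by (intro R_sets) auto
  have int_one: "(LINT p:{0<..h} \<times> sphere 0 1|R. c) = c" for c :: "'c::euclidean_space"
    using R1 set by (simp add: set_lebesgue_integral_def measure_def)
  have int_c: "set_integrable R ({0<..h} \<times> sphere 0 1) (\<lambda>_. c)" for c :: 'a
    using R1 set by (auto simp: set_integrable_def)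
  note [measurable] = mark_measurable[OF sets_R]
  have S: "(LINT p:{0<..h} \<times> sphere 0 1|R. fst p) = s"
  proof -
    have "(LINT p:{0<..h} \<times> sphere 0 1|R. fst p) = (LINT p:{0<..h} \<times> sphere 0 1|R. s)"
      using AE set by (intro set_lebesgue_integral_cong_AE) auto
    then show ?thesis by (simp add: int_one)
  qed
  have int_snd: "set_integrable R ({0<..h} \<times> sphere 0 1) snd"
    unfolding set_integrable_def
    using R1 set by (intro integrableI_bounded_set_indicator[where B=1]) (auto simp: less_top[symmetric])
  have "(LINT p:{0<..h} \<times> sphere 0 1|R. refresh_integrand v p) = (LINT p:{0<..h} \<times> sphere 0 1|R. snd p - v 0)"
    unfolding set_lebesgue_integral_def
  proof (rule integral_cong_AE)
    show "(\<lambda>p. indicator ({0<..h} \<times> sphere 0 1) p *\<^sub>R refresh_integrand v p) \<in> borel_measurable R"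
      using refresh_integrable_from_0[of h] s by (simp add: set_integrable_def borel_measurable_integrable)
    show "(\<lambda>p. indicator ({0<..h} \<times> sphere 0 1) p *\<^sub>R (snd p - v 0)) \<in> borel_measurable R"
      using set by measurable
    show "AE p in R. indicator ({0<..h} \<times> sphere 0 1) p *\<^sub>R refresh_integrand v p =
        indicator ({0<..h} \<times> sphere 0 1) p *\<^sub>R (snd p - v 0)"
      using AE by eventually_elim
        (auto simp: indicator_def refresh_integrand_def \<open>left_limit v s = v 0\<close>)
  qed
  also have "\<dots> = (LINT p:{0<..h} \<times> sphere 0 1|R. snd p) - v 0"
    using set_integral_diff(2)[OF int_snd int_c, of "v 0"] by (simp add: int_one)
  finally have "v h = (LINT p:{0<..h} \<times> sphere 0 1|R. snd p)"
  proof -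
    have "left_limit x r \<bullet> left_limit v r \<le> K" if "r \<in> {0<..h}" for r
      using left_momentum_le_norm[of r] that K by auto
    then have "(LINT p:{0<..h} \<times> {0..}|N. bounce_integrand x v p) = 0"
      using \<open>0 \<le> K\<close> N0 by (intro bounce_integral_zero) auto
    moreover assume "(LINT p:{0<..h} \<times> sphere 0 1|R. refresh_integrand v p) = (LINT p:{0<..h} \<times> sphere 0 1|R. snd p) - v 0"
    ultimately show ?thesis using velocity_increment[of 0 h] s by simp
  qed
  moreover have "clock h - clock 0 = (x 0 + s *\<^sub>R v 0) \<bullet> (v h - v 0)"
    using s by (intro clock_single_velocity_change[OF _ _ before] const) auto
  ultimately show ?thesis using S by simp
qed

text \<open>
  Before the time \<open>s\<close> of the mark the velocity is \<open>v 0\<close>, so the momentum just before \<open>s\<close> is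
  \<open>x 0 \<bullet> v 0 + s\<close>. It exceeds the height of the mark, and the bounce changes its sign.
\<close>

lemma clock_one_bounce:
  assumes R0: "emeasure R ({0<..h} \<times> sphere 0 1) = 0"
    and N1: "emeasure N ({0<..h} \<times> {0..a}) = 1"
    and N0: "emeasure N ({0<..h} \<times> {a<..K}) = 0" and K: "norm (x 0) + h \<le> K"
    and counts: "counts_on_line (time_count N ({0..} \<times> {0..a}))"
    and a: "0 \<le> a" "a \<le> x 0 \<bullet> v 0" and pos: "0 < x 0 \<bullet> v 0"
  shows "clock h \<noteq> clock 0"
proof -
  have "emeasure (time_count N ({0..} \<times> {0..a})) {0<..h} = 1"
    using N1 by (subst time_count_N) auto
  then obtain s where s: "0 < s" "s \<le> h"
    and on': "emeasure (time_count N ({0..} \<times> {0..a})) {s} = 1"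
    and off': "emeasure (time_count N ({0..} \<times> {0..a})) ({0<..h} - {s}) = 0"
    using counts_on_line_single_point[OF counts] by blast
  have off: "emeasure N (({0<..h} - {s}) \<times> {0..a}) = 0"
    using off' by (subst (asm) time_count_N) auto
  have on: "emeasure N ({s} \<times> {0..a}) = 1"
    using on' s by (subst (asm) time_count_N) auto
  have "x 0 \<bullet> v 0 \<le> norm (x 0)"
    using norm_cauchy_schwarz[of "x 0" "v 0"] norm_velocity[of 0] by simp
  then have aK: "a \<le> K" using a K s by linarith
  have AE: "AE p in N. p \<in> {0<..h} \<times> {0..K} \<longrightarrow> p \<in> {s} \<times> {0..a}"
  proof -
    have "AE p in N. p \<notin> ({0<..h} - {s}) \<times> {0..a}"
      using off by (intro AE_not_in) (auto simp: null_sets_def intro!: N_sets)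
    moreover have "AE p in N. p \<notin> {0<..h} \<times> {a<..K}"
      using N0 a by (intro AE_not_in) (auto simp: null_sets_def intro!: N_sets)
    ultimately show ?thesis by eventually_elim auto
  qed
  have const: "v r = v r'" if "0 \<le> r'" "r' \<le> r" "r \<le> h" "s \<notin> {r'<..r}" for r r'
  proof (rule velocity_constant)
    have "AE p in N. p \<notin> {r'<..r} \<times> {0..K}"
      using AE by eventually_elim (use that in auto)
    moreover have "{r'<..r} \<times> {0..K} \<in> sets N"
      using that by (intro N_sets) auto
    ultimately show "emeasure N ({r'<..r} \<times> {0..K}) = 0"
      by (simp add: AE_iff_null_sets[symmetric] null_setsD1)
    show "emeasure R ({r'<..r} \<times> sphere 0 1) = 0"
      using that by (auto intro!: emeasure_eq_0[OF _ R0] R_sets)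
  qed (use that K in auto)
  have before: "v r = v 0" if "r \<in> {0..<s}" for r
    using that s by (intro const) auto
  have lv: "left_limit v s = v 0"
    using s by (intro velocity_left_limit_const[of 0] before) auto
  have xs: "x s = x 0 + (s - 0) *\<^sub>R v 0"
    using s by (intro position_linear before) auto
  then have mom: "x s \<bullet> v 0 = x 0 \<bullet> v 0 + s"
    using inner_velocity_self[of 0] by (simp add: inner_simps)
  define c where "c = bounce (x s) (v 0) - v 0"
  have sset: "{s} \<times> {0..a} \<in> sets N"
    using s by (intro N_sets) auto
  have "(LINT p:{0<..h} \<times> {0..}|N. bounce_integrand x v p) = (LINT p:{s} \<times> {0..a}|N. c)"
    unfolding set_lebesgue_integral_def
  proof (rule integral_cong_AE)
    show "(\<lambda>p. indicator ({0<..h} \<times> {0..}) p *\<^sub>R bounce_integrand x v p) \<in> borel_measurable N"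
      using bounce_integrable_from_0[of h] s by (simp add: set_integrable_def borel_measurable_integrable)
    show "(\<lambda>p. indicator ({s} \<times> {0..a}) p *\<^sub>R c) \<in> borel_measurable N"
      using sset by measurable
    show "AE p in N. indicator ({0<..h} \<times> {0..}) p *\<^sub>R bounce_integrand x v p = indicator ({s} \<times> {0..a}) p *\<^sub>R c"
      using AE
    proof eventually_elim
      case (elim p)
      obtain r z where p: "p = (r, z)" by force
      consider "p \<in> {s} \<times> {0..a}" | "p \<notin> {s} \<times> {0..a}" "r \<in> {0<..h}" "K < z" | "p \<notin> {s} \<times> {0..a}" "p \<notin> {0<..h} \<times> {0..}"
        using elim p by fastforce
      then show ?case
      proof cases
        case 1
        then have "z \<le> max 0 (x s \<bullet> v 0)" "r = s" "0 \<le> z"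
          using p mom a s by (auto simp: max_def)
        then show ?thesis
          using p 1 s by (simp add: bounce_integrand_def c_def lv position_left_limit)
      next
        case 2
        then have "max 0 (left_limit x r \<bullet> left_limit v r) \<le> K"
          using left_momentum_le_norm[of r] K aK a by auto
        then have "z \<notin> {..max 0 (left_limit x r \<bullet> left_limit v r)}"
          using 2 by auto
        then show ?thesis
          using 2 p by (simp add: bounce_integrand_def)
      next
        case 3
        then show ?thesis by simp
      qed
    qed
  qed
  also have "\<dots> = c"
    using on sset by (simp add: set_lebesgue_integral_def measure_def)
  finally have "v h = v 0 + c"
    using velocity_increment[of 0 h] refresh_integral_zero[OF _ R0] s by simp
  moreover have "clock h - clock 0 = (x 0 + s *\<^sub>R v 0) \<bullet> (v h - v 0)"
    using s by (intro clock_single_velocity_change[OF _ _ before] const) auto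
  ultimately have "clock h - clock 0 = x s \<bullet> c" using xs by simp
  also have "\<dots> = - 2 * (x 0 \<bullet> v 0 + s)"
  proof -
    have "x s \<noteq> 0" using mom pos s by auto
    then show ?thesis
      using mom by (simp add: c_def bounce_def inner_diff_right power2_norm_eq_inner)
  qed
  finally show ?thesis using pos s by auto
qed

end

section \<open>Projections of the Gaussian and points of the sphere\<close>

lemma sets_std_gaussian [simp, measurable_cong]: "sets (std_gaussian :: 'a::euclidean_space measure) = sets borel"
  by (simp add: std_gaussian_def)

lemma space_std_gaussian [simp]: "space (std_gaussian :: 'a::euclidean_space measure) = UNIV"
  by (simp add: std_gaussian_def)

text \<open>
  The density is a product over the coordinates, so the integral over a box factorises. Taking all
  but some factors to be the whole line gives the marginals and their independence.
\<close>

lemma emeasure_std_gaussian_box: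
  fixes A :: "'a::euclidean_space \<Rightarrow> real set"
  assumes [measurable]: "\<And>b. b \<in> Basis \<Longrightarrow> A b \<in> sets borel"
  shows "emeasure std_gaussian {x. \<forall>b\<in>Basis. x \<bullet> b \<in> A b} =
    (\<Prod>b\<in>(Basis::'a set). emeasure (density lborel std_normal_density) (A b))"
proof -
  have [measurable]: "{x. \<forall>b\<in>Basis. x \<bullet> b \<in> A b} \<in> sets borel"
    by measurable
  have "emeasure std_gaussian {x. \<forall>b\<in>Basis. x \<bullet> b \<in> A b} =
      (\<integral>\<^sup>+x. ennreal (\<Prod>b\<in>Basis. std_normal_density (x \<bullet> b)) * indicator {x. \<forall>b\<in>Basis. x \<bullet> b \<in> A b} x \<partial>lborel)"
    unfolding std_gaussian_def by (subst emeasure_density) auto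
  also have "\<dots> = (\<integral>\<^sup>+x. (\<Prod>b\<in>Basis. ennreal (std_normal_density (x \<bullet> b)) * indicator (A b) (x \<bullet> b)) \<partial>lborel)"
  proof (rule nn_integral_cong)
    fix x :: 'a
    have "(indicator {x. \<forall>b\<in>Basis. x \<bullet> b \<in> A b} x :: ennreal) = (\<Prod>b\<in>Basis. indicator (A b) (x \<bullet> b))"
      by (auto simp: indicator_def prod_zero_iff)
    then show "ennreal (\<Prod>b\<in>Basis. std_normal_density (x \<bullet> b)) * indicator {x. \<forall>b\<in>Basis. x \<bullet> b \<in> A b} x
        = (\<Prod>b\<in>Basis. ennreal (std_normal_density (x \<bullet> b)) * indicator (A b) (x \<bullet> b))"
      by (simp add: prod_ennreal prod.distrib)
  qed
  also have "\<dots> = (\<Prod>b\<in>Basis. \<integral>\<^sup>+x. ennreal (std_normal_density x) * indicator (A b) x \<partial>lborel)"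
    by (rule nn_integral_lborel_prod) auto
  also have "\<dots> = (\<Prod>b\<in>(Basis::'a set). emeasure (density lborel std_normal_density) (A b))"
    by (intro prod.cong) (auto simp: emeasure_density)
  finally show ?thesis .
qed

lemma emeasure_std_normal_UNIV: "emeasure (density lborel std_normal_density) (UNIV :: real set) = 1"
  using prob_space.emeasure_space_1[OF prob_space_normal_density[of 1 0]] by simp

lemma prob_space_std_gaussian: "prob_space (std_gaussian :: 'a::euclidean_space measure)"
proof
  show "emeasure std_gaussian (space (std_gaussian :: 'a measure)) = 1"
    using emeasure_std_gaussian_box[of "\<lambda>_::'a. UNIV"] by (simp add: emeasure_std_normal_UNIV)
qed

lemma std_gaussian_component:
  fixes b :: "'a::euclidean_space"
  assumes "b \<in> Basis"
  shows "distr std_gaussian lborel (\<lambda>x. x \<bullet> b) = density lborel std_normal_density"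
proof (rule measure_eqI)
  fix S assume "S \<in> sets (distr std_gaussian lborel (\<lambda>x. x \<bullet> b))"
  then have S: "S \<in> sets borel" by simp
  have "(\<lambda>x. x \<bullet> b) -` S = {x. \<forall>c\<in>Basis. x \<bullet> c \<in> (if c = b then S else UNIV)}"
    using assms by (auto split: if_splits)
  then have "emeasure (distr std_gaussian lborel (\<lambda>x. x \<bullet> b)) S =
     (\<Prod>c\<in>(Basis::'a set). emeasure (density lborel std_normal_density) (if c = b then S else UNIV))"
    using S by (subst emeasure_distr) (auto simp: emeasure_std_gaussian_box)
  also have "\<dots> = (\<Prod>c\<in>(Basis::'a set). if c = b then emeasure (density lborel std_normal_density) S else 1)"
    by (intro prod.cong) (auto simp: emeasure_std_normal_UNIV)
  also have "\<dots> = emeasure (density lborel std_normal_density) S"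
    using assms by (simp add: prod.delta)
  finally show "emeasure (distr std_gaussian lborel (\<lambda>x. x \<bullet> b)) S = emeasure (density lborel std_normal_density) S" .
qed simp

lemma std_gaussian_components_indep:
  "prob_space.indep_vars std_gaussian (\<lambda>_. borel) (\<lambda>b x. x \<bullet> b) (Basis :: 'a::euclidean_space set)"
proof -
  interpret prob_space "std_gaussian :: 'a measure" by (rule prob_space_std_gaussian)
  show ?thesis
    unfolding indep_vars_def2
  proof (intro conjI ballI indep_setsI)
    fix J :: "'a set" and E
    assume J: "J \<noteq> {}" "J \<subseteq> Basis" "finite J"
      and E: "\<forall>j\<in>J. E j \<in> {(\<lambda>x. x \<bullet> j) -` A \<inter> space std_gaussian |A. A \<in> sets borel}"
    then obtain B where B: "\<And>j. j \<in> J \<Longrightarrow> B j \<in> sets borel \<and> E j = (\<lambda>x. x \<bullet> j) -` B j"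
      by simp metis
    define C where "C c = (if c \<in> J then B c else UNIV)" for c
    have C: "C c \<in> sets borel" for c using B by (auto simp: C_def)
    have "(\<Inter>j\<in>J. E j) = {x. \<forall>c\<in>Basis. x \<bullet> c \<in> C c}"
      using J B by (auto simp: C_def split: if_splits)
    then have "emeasure std_gaussian (\<Inter>j\<in>J. E j) =
        (\<Prod>c\<in>(Basis::'a set). emeasure (density lborel std_normal_density) (C c))"
      using C by (simp add: emeasure_std_gaussian_box)
    also have "\<dots> = (\<Prod>c\<in>J. emeasure (density lborel std_normal_density) (C c))"
      using J by (intro prod.mono_neutral_right) (auto simp: C_def emeasure_std_normal_UNIV)
    also have "\<dots> = (\<Prod>j\<in>J. emeasure std_gaussian (E j))"
    proof (intro prod.cong refl)
      fix j assume j: "j \<in> J"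
      then have "emeasure (distr std_gaussian lborel (\<lambda>x. x \<bullet> j)) (B j) = emeasure std_gaussian (E j)"
        using B[OF j] by (subst emeasure_distr) auto
      then show "emeasure (density lborel std_normal_density) (C j) = emeasure std_gaussian (E j)"
        using j J std_gaussian_component[of j] by (auto simp: C_def)
    qed
    finally show "prob (\<Inter>j\<in>J. E j) = (\<Prod>j\<in>J. prob (E j))"
      by (simp add: emeasure_eq_measure prod_ennreal prod_nonneg)
  next
    fix b :: 'a
    have "(\<lambda>x. x \<bullet> b) \<in> borel_measurable (std_gaussian :: 'a measure)" by simp
    then show "{(\<lambda>x. x \<bullet> b) -` A \<inter> space std_gaussian |A. A \<in> sets borel} \<subseteq> events"
      by (blast dest: measurable_sets)
  qed auto
qed

text \<open>
  \<open>x \<bullet> e\<close> is a sum of independent centred normal variables whose variances \<open>(e \<bullet> b)\<^sup>2\<close> add up to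
  \<open>norm e ^ 2\<close>. Coordinates with \<open>e \<bullet> b = 0\<close> are left out of the sum because they would be normal
  variables of variance zero.
\<close>

lemma std_gaussian_projection:
  fixes e :: "'a::euclidean_space"
  assumes e: "norm e = 1"
  shows "distributed std_gaussian lborel (\<lambda>x. x \<bullet> e) std_normal_density"
proof -
  interpret prob_space "std_gaussian :: 'a measure" by (rule prob_space_std_gaussian)
  define I where "I = {b\<in>(Basis::'a set). e \<bullet> b \<noteq> 0}"
  have "I \<noteq> {}"
    using e euclidean_all_zero_iff[of e] by (auto simp: I_def)
  have "indep_vars (\<lambda>_. borel) (\<lambda>b x. x \<bullet> b) I"
    by (rule indep_vars_subset[OF std_gaussian_components_indep]) (auto simp: I_def)
  then have ind: "indep_vars (\<lambda>_. borel) (\<lambda>b x. (e \<bullet> b) * (x \<bullet> b)) I"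
    by (rule indep_vars_compose2) simp
  have comp: "distributed std_gaussian lborel (\<lambda>x. (e \<bullet> b) * (x \<bullet> b)) (normal_density 0 \<bar>e \<bullet> b\<bar>)"
    if b: "b \<in> I" for b
  proof -
    have "distributed std_gaussian lborel (\<lambda>x. x \<bullet> b) std_normal_density"
      using b std_gaussian_component[of b] by (auto simp: distributed_def I_def)
    from normal_density_affine[OF this, of "e \<bullet> b" 0] b show ?thesis
      by (simp add: I_def)
  qed
  have "distributed std_gaussian lborel (\<lambda>x. \<Sum>b\<in>I. (e \<bullet> b) * (x \<bullet> b))
      (normal_density (\<Sum>b\<in>I. 0) (sqrt (\<Sum>b\<in>I. \<bar>e \<bullet> b\<bar>\<^sup>2)))"
    using \<open>I \<noteq> {}\<close> ind comp by (intro sum_indep_normal) (auto simp: I_def)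
  moreover have "(\<Sum>b\<in>I. (e \<bullet> b) * (x \<bullet> b)) = x \<bullet> e" for x
    unfolding euclidean_inner[of x e] by (rule sum.mono_neutral_cong_left) (auto simp: I_def)
  moreover have "(\<Sum>b\<in>I. \<bar>e \<bullet> b\<bar>\<^sup>2) = e \<bullet> e"
    unfolding euclidean_inner[of e e] by (rule sum.mono_neutral_cong_left) (auto simp: I_def power2_eq_square)
  ultimately show ?thesis
    using e by (simp add: dot_square_norm)
qed

text \<open>
  \<open>max 0 x = (\<bar>x\<bar> + x) / 2\<close>, and the first absolute moment of the standard normal law is known.
\<close>

lemma std_normal_positive_part:
  "(\<integral>\<^sup>+x. ennreal (std_normal_density x) * ennreal (max 0 x) \<partial>lborel) = ennreal (1 / sqrt (2 * pi))"
proof -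
  have abs: "has_bochner_integral lborel (\<lambda>x. std_normal_density x * \<bar>x\<bar>) (sqrt (2 / pi))"
    using std_normal_moment_abs_odd[of 0] by simp
  have id: "has_bochner_integral lborel (\<lambda>x. std_normal_density x * x) 0"
    using std_normal_moment_odd[of 0] by simp
  have "has_bochner_integral lborel (\<lambda>x. (std_normal_density x * \<bar>x\<bar> + std_normal_density x * x) / 2) ((sqrt (2 / pi) + 0) / 2)"
    by (intro has_bochner_integral_divide_zero has_bochner_integral_add abs id)
  moreover have "(\<lambda>x. (std_normal_density x * \<bar>x\<bar> + std_normal_density x * x) / 2) = (\<lambda>x. std_normal_density x * max 0 x)"
    by (auto simp: max_def)
  moreover have "(sqrt (2 / pi) + 0) / 2 = 1 / sqrt (2 * pi)"
  proof -
    have "sqrt 2 * sqrt 2 = 2" by simp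
    then show ?thesis by (simp add: real_sqrt_divide real_sqrt_mult field_simps)
  qed
  ultimately have "has_bochner_integral lborel (\<lambda>x. std_normal_density x * max 0 x) (1 / sqrt (2 * pi))"
    by simp
  then have "(\<integral>\<^sup>+x. ennreal (std_normal_density x * max 0 x) \<partial>lborel) = ennreal (1 / sqrt (2 * pi))"
    by (intro nn_integral_eq_integral[THEN trans]) (auto simp: has_bochner_integral_iff)
  then show ?thesis by (simp add: ennreal_mult)
qed

lemma std_gaussian_positive_part:
  fixes e :: "'a::euclidean_space"
  assumes "norm e = 1"
  shows "(\<integral>\<^sup>+x. ennreal (max 0 (x \<bullet> e)) \<partial>std_gaussian) = ennreal (1 / sqrt (2 * pi))"
proof -
  have "(\<integral>\<^sup>+x. ennreal (max 0 (x \<bullet> e)) \<partial>std_gaussian) = (\<integral>\<^sup>+y. ennreal (std_normal_density y) * ennreal (max 0 y) \<partial>lborel)"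
    using distributed_nn_integral[OF std_gaussian_projection[OF assms], of "\<lambda>y. ennreal (max 0 y)"] by simp
  then show ?thesis using std_normal_positive_part by simp
qed

lemma lborel_hyperplane_null:
  fixes a :: "'a::euclidean_space"
  assumes "a \<noteq> 0" shows "{x. x \<bullet> a = c} \<in> null_sets lborel"
proof -
  have "negligible {x. a \<bullet> x = c}" using assms by (intro negligible_hyperplane) auto
  moreover have "{x. a \<bullet> x = c} \<in> sets lborel" by simp
  ultimately show ?thesis
    by (simp add: negligible_iff_null_sets null_sets_completion_iff inner_commute)
qed

lemma std_gaussian_hyperplane:
  fixes a :: "'a::euclidean_space"
  assumes "a \<noteq> 0" shows "emeasure std_gaussian {x. x \<bullet> a = c} = 0"
proof -
  have "AE x in lborel. x \<notin> {x. x \<bullet> a = c}"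
    using lborel_hyperplane_null[OF assms] by (rule AE_not_in)
  then show ?thesis
    unfolding std_gaussian_def
    by (subst emeasure_density) (auto simp: nn_integral_0_iff_AE elim!: eventually_mono)
qed

lemma sets_sphere_uniform [simp, measurable_cong]: "sets (sphere_uniform :: 'a::euclidean_space measure) = sets borel"
  by (simp add: sphere_uniform_def)

lemma unit_ball_emeasure:
  "emeasure lborel (ball (0::'a::euclidean_space) 1) \<noteq> 0" "emeasure lborel (ball (0::'a::euclidean_space) 1) \<noteq> \<infinity>"
  using emeasure_lborel_ball_finite[of "0::'a" 1] content_ball_pos[of 1 "0::'a"]
  by (auto simp: measure_def less_top[symmetric])

lemma prob_space_sphere_uniform: "prob_space (sphere_uniform :: 'a::euclidean_space measure)"
  unfolding sphere_uniform_def
  by (intro prob_space.prob_space_distr prob_space_uniform_measure unit_ball_emeasure) auto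

lemma emeasure_sphere_uniform_null:
  fixes S :: "'a::euclidean_space set"
  assumes S: "S \<in> sets borel" and null: "sgn -` S \<in> null_sets lborel"
  shows "emeasure sphere_uniform S = 0"
proof -
  have "emeasure sphere_uniform S = emeasure lborel (ball 0 1 \<inter> sgn -` S) / emeasure lborel (ball (0::'a) 1)"
    using S null unfolding sphere_uniform_def
    by (subst emeasure_distr) (auto simp: emeasure_uniform_measure)
  moreover have "emeasure lborel (ball 0 1 \<inter> sgn -` S) = 0"
    using null by (meson Int_lower2 emeasure_eq_0 null_setsD1 null_setsD2)
  ultimately show ?thesis by simp
qed

lemma AE_sphere_uniform: "AE u in (sphere_uniform :: 'a::euclidean_space measure). u \<in> sphere 0 1"
proof (rule AE_I)
  have "x \<in> sgn -` (- sphere 0 1) \<longleftrightarrow> x = 0" for x :: 'a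
    by (simp add: norm_sgn)
  then have "sgn -` (- sphere 0 1) = {0::'a}" by blast
  then show "emeasure sphere_uniform (- sphere 0 (1::real) :: 'a set) = 0"
    by (intro emeasure_sphere_uniform_null) (simp_all add: borel_open null_sets_def)
  show "- sphere 0 1 \<in> sets (sphere_uniform :: 'a measure)"
    by (simp add: borel_open)
  show "{u \<in> space sphere_uniform. u \<notin> sphere 0 1} \<subseteq> (- sphere 0 1 :: 'a set)"
    by blast
qed

text \<open>
  The directions equal to \<open>u\<close> come from a ray, which in dimension at least two lies in a hyperplane.
\<close>

lemma sphere_uniform_point:
  fixes u :: "'a::euclidean_space"
  assumes "2 \<le> DIM('a)" shows "emeasure sphere_uniform {u} = 0"
proof (rule emeasure_sphere_uniform_null)
  obtain w where w: "w \<noteq> 0" "orthogonal u w"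
    using orthogonal_to_vector_exists[OF assms] by blast
  have "sgn -` {u} \<subseteq> {x. x \<bullet> w = 0}"
  proof
    fix x assume "x \<in> sgn -` {u}"
    then have "x = norm x *\<^sub>R u"
      by (cases "x = 0") (auto simp: sgn_div_norm)
    then have "x \<bullet> w = norm x * (u \<bullet> w)" by (metis inner_scaleR_left)
    then show "x \<in> {x. x \<bullet> w = 0}"
      using w by (simp add: orthogonal_def)
  qed
  moreover have "sgn -` {u} \<in> sets lborel"
    using measurable_sets[of sgn borel borel "{u}"] by simp
  ultimately show "sgn -` {u} \<in> null_sets lborel"
    by (intro null_sets_subset[OF lborel_hyperplane_null[OF w(1), of 0]])
qed simp

section \<open>Poisson counts and independent conditioning\<close>

context prob_space
begin

lemma poisson_count_measurable:
  "poisson_random_measure M \<mu> N \<Longrightarrow> A \<in> sets \<mu> \<Longrightarrow> (\<lambda>\<omega>. emeasure (N \<omega>) A) \<in> borel_measurable M"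
  by (simp add: poisson_random_measure_def)

lemma poisson_count_law:
  assumes "poisson_random_measure M \<mu> N" "A \<in> sets \<mu>" "emeasure \<mu> A = ennreal m" "0 \<le> m"
  shows "prob {\<omega>\<in>space M. emeasure (N \<omega>) A = of_nat k} = m ^ k / fact k * exp (- m)"
proof -
  have "measure \<mu> A = m" "emeasure \<mu> A < \<infinity>"
    using assms by (simp_all add: measure_def)
  then show ?thesis
    using assms(1,2) unfolding poisson_random_measure_def by auto
qed

text \<open>
  The Poisson probabilities of the natural numbers add up to one.
\<close>

lemma poisson_count_integer:
  assumes P: "poisson_random_measure M \<mu> N" and A: "A \<in> sets \<mu>" and fin: "emeasure \<mu> A < \<infinity>"
  shows "AE \<omega> in M. emeasure (N \<omega>) A \<in> range (of_nat :: nat \<Rightarrow> ennreal)"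
proof -
  note [measurable] = poisson_count_measurable[OF P A]
  define m where "m = measure \<mu> A"
  have m: "emeasure \<mu> A = ennreal m" "0 \<le> m"
    using fin by (simp_all add: m_def emeasure_eq_ennreal_measure)
  define E where "E k = {\<omega>\<in>space M. emeasure (N \<omega>) A = of_nat k}" for k :: nat
  have E [measurable]: "E k \<in> events" for k unfolding E_def by measurable
  have "(\<lambda>k. prob (E k)) sums prob (\<Union>k. E k)"
    by (rule finite_measure_UNION) (auto simp: disjoint_family_on_def E_def)
  moreover have "(\<lambda>k. m ^ k / fact k * exp (- m)) sums (exp m * exp (- m))"
    using exp_converges[of m] by (intro sums_mult2) (simp add: field_simps)
  ultimately have "prob (\<Union>k. E k) = exp m * exp (- m)"
    using poisson_count_law[OF P A m] by (simp add: E_def sums_iff)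
  then have "prob (\<Union>k. E k) = 1" by (simp flip: exp_add)
  then have "AE \<omega> in M. \<omega> \<in> (\<Union>k. E k)"
    by (intro prob_eq_1[THEN iffD1]) auto
  then show ?thesis
    by eventually_elim (auto simp: E_def)
qed

lemma prob_poisson_zero:
  assumes "poisson_random_measure M \<mu> N" "A \<in> sets \<mu>" "emeasure \<mu> A = ennreal m" "0 \<le> m"
  shows "prob {\<omega>\<in>space M. emeasure (N \<omega>) A = 0} = exp (- m)"
  using poisson_count_law[OF assms, of 0] by simp

lemma prob_poisson_one:
  assumes "poisson_random_measure M \<mu> N" "A \<in> sets \<mu>" "emeasure \<mu> A = ennreal m" "0 \<le> m"
  shows "prob {\<omega>\<in>space M. emeasure (N \<omega>) A = 1} = m * exp (- m)"
  using poisson_count_law[OF assms, of 1] by simp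

lemma emeasure_poisson_nonzero_le:
  assumes P: "poisson_random_measure M \<mu> N" and A: "A \<in> sets \<mu>" and m: "emeasure \<mu> A = ennreal m" "0 \<le> m"
  shows "emeasure M {\<omega>\<in>space M. emeasure (N \<omega>) A \<noteq> 0} \<le> ennreal m"
proof -
  note [measurable] = poisson_count_measurable[OF P A]
  have "prob {\<omega>\<in>space M. emeasure (N \<omega>) A \<noteq> 0} = 1 - prob {\<omega>\<in>space M. emeasure (N \<omega>) A = 0}"
    by (subst prob_neg[symmetric]) auto
  also have "\<dots> \<le> m"
    using prob_poisson_zero[OF assms] exp_ge_add_one_self[of "- m"] by simp
  finally show ?thesis
    by (simp add: emeasure_eq_measure ennreal_leI)
qed

lemma poisson_time_counts:
  assumes P: "poisson_random_measure M \<mu> N"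
    and \<mu>: "sets \<mu> = sets (restrict_space lborel {0..} \<Otimes>\<^sub>M K)"
    and C: "\<And>B. B \<in> sets borel \<Longrightarrow> B \<subseteq> {0..} \<Longrightarrow> B \<times> C \<in> sets \<mu>"
    and fin: "\<And>p q. 0 \<le> p \<Longrightarrow> p < q \<Longrightarrow> emeasure \<mu> ({p<..q} \<times> C) < \<infinity>"
  shows "AE \<omega> in M. counts_on_line (time_count (N \<omega>) ({0..} \<times> C))"
proof -
  have "AE \<omega> in M. \<forall>p\<in>\<rat>. \<forall>q\<in>\<rat>. 0 \<le> p \<and> p < q \<longrightarrow>
      emeasure (N \<omega>) ({p<..q} \<times> C) \<in> range (of_nat :: nat \<Rightarrow> ennreal)"
  proof (intro AE_ball_countable[THEN iffD2] countable_rat ballI)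
    fix p q :: real
    show "AE \<omega> in M. 0 \<le> p \<and> p < q \<longrightarrow>
        emeasure (N \<omega>) ({p<..q} \<times> C) \<in> range (of_nat :: nat \<Rightarrow> ennreal)"
    proof (cases "0 \<le> p \<and> p < q")
      case True
      then have "{p<..q} \<times> C \<in> sets \<mu>" by (intro C) auto
      with True show ?thesis
        using poisson_count_integer[OF P, of "{p<..q} \<times> C"] fin[of p q] by simp
    qed auto
  qed
  moreover have "AE \<omega> in M. sets (N \<omega>) = sets \<mu>"
    using P by (auto simp: poisson_random_measure_def)
  ultimately show ?thesis
  proof eventually_elim
    case (elim \<omega>)
    have "emeasure (time_count (N \<omega>) ({0..} \<times> C)) {p<..q} = emeasure (N \<omega>) ({p<..q} \<times> C)" if "0 \<le> p" for p q
    proof -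
      have "{z \<in> {0..} \<times> C. fst z \<in> {p<..q}} = {p<..q} \<times> C" using that by auto
      then show ?thesis
        using emeasure_time_count[of "N \<omega>" K "{0..} \<times> C" "{p<..q}"] elim \<mu> C[of "{0..}"] by simp
    qed
    then show ?case
      using elim by (simp add: counts_on_line_def)
  qed
qed

text \<open>
  The sigma-algebra generated by the random measure, packaged as a measure space so that a function of
  the counts can be called measurable with respect to it.
\<close>

definition count_algebra :: "'e measure \<Rightarrow> ('a \<Rightarrow> 'e measure) \<Rightarrow> 'a measure" where
  "count_algebra \<mu> N = vimage_algebra (space M) (\<lambda>\<omega>. \<lambda>A\<in>sets \<mu>. emeasure (N \<omega>) A) (PiM (sets \<mu>) (\<lambda>_. borel))"

lemma sets_count_algebra: "sets (count_algebra \<mu> N) = random_measure_sigma M \<mu> N"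
  by (simp add: count_algebra_def random_measure_sigma_def)

lemma space_count_algebra [simp]: "space (count_algebra \<mu> N) = space M"
  by (simp add: count_algebra_def)

lemma measurable_count_algebra:
  assumes A: "A \<in> sets \<mu>"
  shows "(\<lambda>\<omega>. emeasure (N \<omega>) A) \<in> borel_measurable (count_algebra \<mu> N)"
proof -
  have "(\<lambda>\<omega>. \<lambda>A\<in>sets \<mu>. emeasure (N \<omega>) A) \<in> count_algebra \<mu> N \<rightarrow>\<^sub>M PiM (sets \<mu>) (\<lambda>_. borel)"
    unfolding count_algebra_def by (rule measurable_vimage_algebra1) (auto simp: space_PiM)
  from measurable_compose[OF this measurable_component_singleton[OF A]]
  show ?thesis using A by simp
qed

lemma nn_integral_measurable_count_algebra:
  assumes N: "\<And>\<omega>. \<omega> \<in> space M \<Longrightarrow> sets (N \<omega>) = sets \<mu>" and f: "f \<in> borel_measurable \<mu>"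
  shows "(\<lambda>\<omega>. \<integral>\<^sup>+x. f x \<partial>N \<omega>) \<in> borel_measurable (count_algebra \<mu> N)"
  using f
proof (induction rule: borel_measurable_induct)
  case (cong f g)
  have "(\<integral>\<^sup>+x. f x \<partial>N \<omega>) = (\<integral>\<^sup>+x. g x \<partial>N \<omega>)" if "\<omega> \<in> space M" for \<omega>
    using cong(3) sets_eq_imp_space_eq[OF N[OF that]] by (intro nn_integral_cong) simp
  then show ?case
    using cong(4) by (subst measurable_cong[where g="\<lambda>\<omega>. \<integral>\<^sup>+x. g x \<partial>N \<omega>"]) auto
next
  case (set A)
  then show ?case
    by (subst measurable_cong[where g="\<lambda>\<omega>. emeasure (N \<omega>) A"])
       (auto intro: measurable_count_algebra simp: N)
next
  case (mult u c)
  have [measurable_cong]: "sets (N \<omega>) = sets \<mu>" if "\<omega> \<in> space M" for \<omega> using N that .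
  have "(\<integral>\<^sup>+x. c * u x \<partial>N \<omega>) = c * (\<integral>\<^sup>+x. u x \<partial>N \<omega>)" if "\<omega> \<in> space M" for \<omega>
    using mult(2) N[OF that] by (intro nn_integral_cmult) (simp cong: measurable_cong_sets)
  then show ?case
    using mult(4) by (subst measurable_cong[where g="\<lambda>\<omega>. c * (\<integral>\<^sup>+x. u x \<partial>N \<omega>)"]) auto
next
  case (add u v)
  have "(\<integral>\<^sup>+x. v x + u x \<partial>N \<omega>) = (\<integral>\<^sup>+x. v x \<partial>N \<omega>) + (\<integral>\<^sup>+x. u x \<partial>N \<omega>)" if "\<omega> \<in> space M" for \<omega>
    using add(1,3) N[OF that] by (intro nn_integral_add) (simp_all cong: measurable_cong_sets)
  then show ?case
    using add.IH by (subst measurable_cong[where g="\<lambda>\<omega>. (\<integral>\<^sup>+x. v x \<partial>N \<omega>) + (\<integral>\<^sup>+x. u x \<partial>N \<omega>)"]) auto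
next
  case (seq U)
  have "(\<integral>\<^sup>+x. f x \<partial>N \<omega>) = (SUP i. \<integral>\<^sup>+x. U i x \<partial>N \<omega>)" if "\<omega> \<in> space M" for \<omega>
    using seq.hyps N[OF that] unfolding seq.hyps(4) SUP_apply
    by (intro nn_integral_monotone_convergence_SUP) (simp_all cong: measurable_cong_sets)
  then show ?case
    using seq.IH unfolding seq.hyps(4)[symmetric]
    by (subst measurable_cong[where g="\<lambda>\<omega>. SUP i. \<integral>\<^sup>+x. U i x \<partial>N \<omega>"]) auto
qed

text \<open>
  Independence of an event \<open>G j\<close> and a random index \<open>J\<close> allows the insertion of \<open>J\<close> for \<open>j\<close>: the
  probability is the mean of the function \<open>j \<mapsto> P (G j)\<close> at \<open>J\<close>. As \<open>J\<close> has countably many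
  values, this is a sum over the values.
\<close>

lemma emeasure_random_index:
  fixes J :: "'a \<Rightarrow> nat"
  assumes J: "\<And>j. {\<omega>\<in>space M. J \<omega> = j} \<in> events" and G: "\<And>j. G j \<in> events"
    and ind: "\<And>j. prob ({\<omega>\<in>space M. J \<omega> = j} \<inter> G j) = prob {\<omega>\<in>space M. J \<omega> = j} * prob (G j)"
  shows "{\<omega>\<in>space M. \<omega> \<in> G (J \<omega>)} \<in> events"
    and "emeasure M {\<omega>\<in>space M. \<omega> \<in> G (J \<omega>)} = (\<integral>\<^sup>+\<omega>. emeasure M (G (J \<omega>)) \<partial>M)"
proof -
  define E where "E j = {\<omega>\<in>space M. J \<omega> = j}" for j
  have E: "E j \<in> events" for j using J by (simp add: E_def)
  have eq: "{\<omega>\<in>space M. \<omega> \<in> G (J \<omega>)} = (\<Union>j. E j \<inter> G j)" by (auto simp: E_def)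
  show "{\<omega>\<in>space M. \<omega> \<in> G (J \<omega>)} \<in> events" unfolding eq using E G by auto
  have "emeasure M {\<omega>\<in>space M. \<omega> \<in> G (J \<omega>)} = (\<Sum>j. emeasure M (E j \<inter> G j))"
    unfolding eq using E G by (intro suminf_emeasure[symmetric]) (auto simp: disjoint_family_on_def E_def)
  also have "\<dots> = (\<Sum>j. emeasure M (G j) * emeasure M (E j))"
    using ind by (simp add: emeasure_eq_measure E_def ennreal_mult' mult.commute)
  also have "\<dots> = (\<Sum>j. \<integral>\<^sup>+\<omega>. emeasure M (G j) * indicator (E j) \<omega> \<partial>M)"
    using E by (simp add: nn_integral_cmult_indicator)
  also have "\<dots> = (\<integral>\<^sup>+\<omega>. (\<Sum>j. emeasure M (G j) * indicator (E j) \<omega>) \<partial>M)"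
    using E by (intro nn_integral_suminf[symmetric]) auto
  also have "\<dots> = (\<integral>\<^sup>+\<omega>. emeasure M (G (J \<omega>)) \<partial>M)"
  proof (rule nn_integral_cong)
    fix \<omega> assume "\<omega> \<in> space M"
    then have "(\<Sum>j. emeasure M (G j) * indicator (E j) \<omega>) = (\<Sum>j\<in>{J \<omega>}. emeasure M (G j) * indicator (E j) \<omega>)"
      by (intro suminf_finite) (auto simp: E_def)
    then show "(\<Sum>j. emeasure M (G j) * indicator (E j) \<omega>) = emeasure M (G (J \<omega>))"
      using \<open>\<omega> \<in> space M\<close> by (simp add: E_def)
  qed
  finally show "emeasure M {\<omega>\<in>space M. \<omega> \<in> G (J \<omega>)} = (\<integral>\<^sup>+\<omega>. emeasure M (G (J \<omega>)) \<partial>M)" .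
qed

lemma distr_pair_indep:
  assumes X [measurable]: "X \<in> M \<rightarrow>\<^sub>M S" and Y [measurable]: "Y \<in> M \<rightarrow>\<^sub>M T"
    and ind: "\<And>A B. A \<in> sets S \<Longrightarrow> B \<in> sets T \<Longrightarrow>
      prob ((X -` A \<inter> space M) \<inter> (Y -` B \<inter> space M)) = prob (X -` A \<inter> space M) * prob (Y -` B \<inter> space M)"
  shows "distr M S X \<Otimes>\<^sub>M distr M T Y = distr M (S \<Otimes>\<^sub>M T) (\<lambda>\<omega>. (X \<omega>, Y \<omega>))"
proof -
  interpret X: prob_space "distr M S X" by (rule prob_space_distr) simp
  interpret Y: prob_space "distr M T Y" by (rule prob_space_distr) simp
  show ?thesis
  proof (rule pair_measure_eqI)
    fix A B assume AB: "A \<in> sets (distr M S X)" "B \<in> sets (distr M T Y)"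
    have "(\<lambda>\<omega>. (X \<omega>, Y \<omega>)) -` (A \<times> B) \<inter> space M = (X -` A \<inter> space M) \<inter> (Y -` B \<inter> space M)" by auto
    then show "emeasure (distr M S X) A * emeasure (distr M T Y) B = emeasure (distr M (S \<Otimes>\<^sub>M T) (\<lambda>\<omega>. (X \<omega>, Y \<omega>))) (A \<times> B)"
      using AB ind[of A B] by (simp add: emeasure_distr emeasure_eq_measure ennreal_mult')
  qed (auto intro: X.sigma_finite_measure_axioms Y.sigma_finite_measure_axioms)
qed

text \<open>
  By Fubini's theorem for the joint law, which is a product measure.
\<close>

lemma AE_indep_avoids:
  assumes X [measurable]: "X \<in> M \<rightarrow>\<^sub>M S" and Y [measurable]: "Y \<in> M \<rightarrow>\<^sub>M T"
    and ind: "\<And>A B. A \<in> sets S \<Longrightarrow> B \<in> sets T \<Longrightarrow>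
      prob ((X -` A \<inter> space M) \<inter> (Y -` B \<inter> space M)) = prob (X -` A \<inter> space M) * prob (Y -` B \<inter> space M)"
    and Q: "Q \<in> sets (S \<Otimes>\<^sub>M T)"
    and null: "\<And>y. y \<in> space T \<Longrightarrow> emeasure (distr M S X) ((\<lambda>x. (x, y)) -` Q) = 0"
  shows "AE \<omega> in M. (X \<omega>, Y \<omega>) \<notin> Q"
proof -
  interpret X: prob_space "distr M S X" by (rule prob_space_distr) simp
  interpret Y: prob_space "distr M T Y" by (rule prob_space_distr) simp
  interpret pair_sigma_finite "distr M S X" "distr M T Y" ..
  have "emeasure (distr M S X \<Otimes>\<^sub>M distr M T Y) Q = (\<integral>\<^sup>+y. emeasure (distr M S X) ((\<lambda>x. (x, y)) -` Q) \<partial>distr M T Y)"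
    using Q by (intro emeasure_pair_measure_alt2) simp
  also have "\<dots> = (\<integral>\<^sup>+y. 0 \<partial>distr M T Y)"
    by (intro nn_integral_cong null) (simp only: space_distr)
  finally have zero: "emeasure (distr M S X \<Otimes>\<^sub>M distr M T Y) Q = 0" by simp
  have "distr M S X \<Otimes>\<^sub>M distr M T Y = distr M (S \<Otimes>\<^sub>M T) (\<lambda>\<omega>. (X \<omega>, Y \<omega>))"
    using X Y ind by (rule distr_pair_indep)
  with zero have "emeasure (distr M (S \<Otimes>\<^sub>M T) (\<lambda>\<omega>. (X \<omega>, Y \<omega>))) Q = 0" by simp
  then have "emeasure M ((\<lambda>\<omega>. (X \<omega>, Y \<omega>)) -` Q \<inter> space M) = 0"
    using Q by (subst (asm) emeasure_distr) auto
  moreover have "(\<lambda>\<omega>. (X \<omega>, Y \<omega>)) -` Q \<inter> space M \<in> events"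
    using Q by measurable
  ultimately have "AE \<omega> in M. \<omega> \<notin> (\<lambda>\<omega>. (X \<omega>, Y \<omega>)) -` Q \<inter> space M"
    by (intro AE_not_in) (simp add: null_sets_def)
  then show ?thesis
    using AE_space by eventually_elim auto
qed

end

section \<open>Laws and independence of the driving randomness\<close>

lemma half_line_set: "B \<in> sets borel \<Longrightarrow> B \<subseteq> {0..} \<Longrightarrow> B \<in> sets (restrict_space lborel {0::real..})"
  by (auto simp: sets_restrict_space_iff)

lemma sigma_finite_half_line: "sigma_finite_measure (restrict_space lborel {0::real..})"
  by (intro sigma_finite_measure_restrict_space sigma_finite_lborel) simp

lemma sets_bounce_intensity:
  "sets bounce_intensity = sets (restrict_space lborel {0..} \<Otimes>\<^sub>M restrict_space lborel {0::real..})"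
  by (simp add: bounce_intensity_def)

lemma bounce_intensity_rectangle:
  assumes "B \<in> sets borel" "B \<subseteq> {0..}" "C \<in> sets borel" "C \<subseteq> {0..}"
  shows "B \<times> C \<in> sets bounce_intensity"
    and "emeasure bounce_intensity (B \<times> C) = emeasure lborel B * emeasure lborel C"
proof -
  interpret sigma_finite_measure "restrict_space lborel {0::real..}" by (rule sigma_finite_half_line)
  have BC: "B \<in> sets (restrict_space lborel {0::real..})" "C \<in> sets (restrict_space lborel {0::real..})"
    using assms by (auto intro: half_line_set)
  then show "B \<times> C \<in> sets bounce_intensity" by (simp add: bounce_intensity_def)
  have "emeasure bounce_intensity (B \<times> C) =
      emeasure (restrict_space lborel {0..}) B * emeasure (restrict_space lborel {0..}) C"
    unfolding bounce_intensity_def using BC by (rule emeasure_pair_measure_Times)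
  then show "emeasure bounce_intensity (B \<times> C) = emeasure lborel B * emeasure lborel C"
    using assms by (simp add: emeasure_restrict_space)
qed

lemma bounce_intensity_window:
  assumes "0 \<le> p" "p \<le> q" "0 \<le> a"
  shows "emeasure bounce_intensity ({p<..q} \<times> {0..a}) = ennreal ((q - p) * a)"
    and "a \<le> b \<Longrightarrow> emeasure bounce_intensity ({p<..q} \<times> {a<..b}) = ennreal ((q - p) * (b - a))"
  using assms by (subst bounce_intensity_rectangle; auto simp: ennreal_mult)+

lemma sets_refresh_intensity:
  "sets (refresh_intensity \<rho> :: (real \<times> 'a::euclidean_space) measure) =
    sets (restrict_space lborel {0..} \<Otimes>\<^sub>M restrict_space sphere_uniform (sphere 0 1))"
  by (simp add: refresh_intensity_def)

lemma refresh_intensity_cylinder: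
  assumes "B \<in> sets borel" "B \<subseteq> {0..}"
  shows "B \<times> sphere 0 1 \<in> sets (refresh_intensity \<rho> :: (real \<times> 'a::euclidean_space) measure)"
    and "emeasure (refresh_intensity \<rho> :: (real \<times> 'a) measure) (B \<times> sphere 0 1) = ennreal \<rho> * emeasure lborel B"
proof -
  let ?U = "restrict_space sphere_uniform (sphere 0 1 :: 'a set)"
  interpret U: prob_space "sphere_uniform :: 'a measure" by (rule prob_space_sphere_uniform)
  have sph: "sphere 0 1 \<in> sets (sphere_uniform :: 'a measure)" by simp
  have total: "emeasure sphere_uniform (sphere 0 1 :: 'a set) = 1"
    using AE_sphere_uniform sph by (intro U.emeasure_eq_1_AE)
  have space: "space ?U = sphere 0 1"
    using sets.sets_into_space[OF sph] by (simp add: space_restrict_space Int_absorb2)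
  then have S: "sphere 0 1 \<in> sets ?U" by (metis sets.top)
  have "emeasure ?U (sphere 0 1) = 1"
    using total sph by (subst emeasure_restrict_space) auto
  then interpret S: prob_space ?U by (intro prob_spaceI) (simp add: space)
  have B: "B \<in> sets (restrict_space lborel {0::real..})"
    using assms by (rule half_line_set)
  show "B \<times> sphere 0 1 \<in> sets (refresh_intensity \<rho> :: (real \<times> 'a) measure)"
    unfolding sets_refresh_intensity using B S by (rule pair_measureI)
  have "emeasure (restrict_space lborel {0..} \<Otimes>\<^sub>M ?U) (B \<times> sphere 0 1) =
      emeasure (restrict_space lborel {0..}) B * emeasure ?U (sphere 0 1)"
    using B S by (rule S.emeasure_pair_measure_Times)
  also have "\<dots> = emeasure lborel B"
    using assms \<open>emeasure ?U (sphere 0 1) = 1\<close> by (simp add: emeasure_restrict_space)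
  finally show "emeasure (refresh_intensity \<rho> :: (real \<times> 'a) measure) (B \<times> sphere 0 1) = ennreal \<rho> * emeasure lborel B"
    by (simp add: refresh_intensity_def)
qed

lemma refresh_intensity_window:
  assumes "0 \<le> p" "p \<le> q" "0 \<le> \<rho>"
  shows "emeasure (refresh_intensity \<rho> :: (real \<times> 'a::euclidean_space) measure) ({p<..q} \<times> sphere 0 1) = ennreal (\<rho> * (q - p))"
  using assms by (subst refresh_intensity_cylinder) (auto simp: ennreal_mult)

lemma measurable_larger_algebra:
  "f \<in> F \<rightarrow>\<^sub>M K \<Longrightarrow> sets F \<subseteq> sets F' \<Longrightarrow> space F = space F' \<Longrightarrow> f \<in> F' \<rightarrow>\<^sub>M K"
  by (auto simp: measurable_def)

context stationary_bps
begin

definition initial_algebra :: "'w measure" where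
  "initial_algebra = sigma (space M) (random_variable_sigma M (\<xi> 0) \<union> random_variable_sigma M (v 0))"

lemma sets_driving [simp]: "\<omega> \<in> space M \<Longrightarrow> sets (N \<omega>) = sets bounce_intensity"
   "\<omega> \<in> space M \<Longrightarrow> sets (R \<omega>) = sets (refresh_intensity \<rho>)"
  using bounce_poisson refresh_poisson by (auto simp: poisson_random_measure_def)

lemma random_variable_sigma_subset: "random_variable_sigma M X \<subseteq> Pow (space M)"
  unfolding random_variable_sigma_def using sets.space_closed[of "vimage_algebra (space M) X borel"] by simp

lemma space_initial_algebra [simp]: "space initial_algebra = space M"
  by (simp add: initial_algebra_def space_measure_of_conv)

lemma sets_initial_algebra:
  "sets initial_algebra = sigma_sets (space M) (random_variable_sigma M (\<xi> 0) \<union> random_variable_sigma M (v 0))"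
  unfolding initial_algebra_def using random_variable_sigma_subset by (intro sets_measure_of) blast

lemma measurable_random_variable_sigma:
  fixes X :: "'w \<Rightarrow> 'c::topological_space"
  assumes "random_variable_sigma M X \<subseteq> sets F" "space F = space M"
  shows "X \<in> borel_measurable F"
proof (rule measurableI)
  fix A :: "'c set" assume "A \<in> sets borel"
  then have "X -` A \<inter> space M \<in> random_variable_sigma M X"
    unfolding random_variable_sigma_def by (rule in_vimage_algebra)
  then show "X -` A \<inter> space F \<in> sets F" using assms by auto
qed simp

lemma measurable_initial:
  "\<xi> 0 \<in> borel_measurable initial_algebra" "v 0 \<in> borel_measurable initial_algebra"
  by (rule measurable_random_variable_sigma; auto simp: sets_initial_algebra intro: sigma_sets.Basic)+

text \<open>
  The four independent sigma-algebras of the model, as a family that can be grouped into independent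
  joins.
\<close>

definition source :: "nat \<Rightarrow> 'w set set" where
  "source i = [random_variable_sigma M (\<xi> 0), random_variable_sigma M (v 0),
     random_measure_sigma M bounce_intensity N, random_measure_sigma M (refresh_intensity \<rho>) R] ! i"

lemma source_simps [simp]:
  "source 0 = random_variable_sigma M (\<xi> 0)" "source (Suc 0) = random_variable_sigma M (v 0)"
  "source 2 = random_measure_sigma M bounce_intensity N"
  "source 3 = random_measure_sigma M (refresh_intensity \<rho>) R"
  by (simp_all add: source_def eval_nat_numeral)

lemma source_grouping:
  assumes "(\<Union>j\<in>L. I j) \<subseteq> {..<4}" "disjoint_family_on I L"
  shows "indep_sets (\<lambda>j. sigma_sets (space M) (\<Union>i\<in>I j. source i)) L"
proof (rule indep_sets_collect_sigma)
  show "indep_sets source (\<Union>j\<in>L. I j)"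
    using independence assms(1) unfolding source_def[symmetric] by (rule indep_sets_mono_index[rotated])
  fix i j assume "j \<in> L" "i \<in> I j"
  then have "i < 4" using assms by auto
  then have "i \<in> {0, 1, 2, 3}" by auto
  then show "Int_stable (source i)"
    by (auto simp: random_variable_sigma_def random_measure_sigma_def intro: sets.Int_stable)
qed fact

lemma source_pair_indep:
  assumes "I0 \<union> I1 \<subseteq> {..<4}" "I0 \<inter> I1 = {}"
    and A: "A \<in> sigma_sets (space M) (\<Union>i\<in>I0. source i)" and B: "B \<in> sigma_sets (space M) (\<Union>i\<in>I1. source i)"
  shows "prob (A \<inter> B) = prob A * prob B"
proof -
  have "indep_sets (\<lambda>j. sigma_sets (space M) (\<Union>i\<in>case_bool I0 I1 j. source i)) UNIV"
    using assms(1,2) by (intro source_grouping) (auto simp: disjoint_family_on_def split: bool.splits)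
  then have "prob (\<Inter>j\<in>UNIV. case_bool A B j) = (\<Prod>j\<in>UNIV. prob (case_bool A B j))"
    using A B by (intro indep_setsD) (auto split: bool.splits)
  then show ?thesis by (simp add: UNIV_bool Int_commute mult.commute)
qed

lemma indep_initial_bounce_refresh:
  assumes "A \<in> sets initial_algebra" "B \<in> random_measure_sigma M bounce_intensity N"
    and "C \<in> random_measure_sigma M (refresh_intensity \<rho>) R"
  shows "A \<in> events" "B \<in> events" "C \<in> events"
    and "prob (A \<inter> (B \<inter> C)) = prob A * prob (B \<inter> C)" "prob (B \<inter> C) = prob B * prob C"
proof -
  define I :: "nat \<Rightarrow> nat set" where "I j = [{0, 1}, {2}, {3}] ! j" for j
  have I: "I 0 = {0, 1}" "I (Suc 0) = {2}" "I 2 = {3}"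
    by (simp_all add: I_def eval_nat_numeral)
  have L: "{..<3} = {0, Suc 0, 2}" by auto
  have ind: "indep_sets (\<lambda>j. sigma_sets (space M) (\<Union>i\<in>I j. source i)) {..<3}"
    by (rule source_grouping) (auto simp: L I disjoint_family_on_def)
  define E where "E j = [A, B, C] ! j" for j
  have E: "E 0 = A" "E (Suc 0) = B" "E 2 = C"
    by (simp_all add: E_def eval_nat_numeral)
  have mem: "\<forall>j\<in>{..<3}. E j \<in> sigma_sets (space M) (\<Union>i\<in>I j. source i)"
    using assms unfolding L by (auto simp: E I sets_initial_algebra intro: sigma_sets.Basic)
  have "\<forall>j\<in>{..<3}. sigma_sets (space M) (\<Union>i\<in>I j. source i) \<subseteq> events"
    using ind by (simp add: indep_sets_def)
  then show "A \<in> events" "B \<in> events" "C \<in> events"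
    using mem unfolding L by (auto simp: E)
  have "prob (\<Inter>j\<in>{..<3}. E j) = (\<Prod>j\<in>{..<3}. prob (E j))"
    using mem by (intro indep_setsD[OF ind]) (auto simp: L)
  moreover have BC: "prob (\<Inter>j\<in>{Suc 0, 2}. E j) = (\<Prod>j\<in>{Suc 0, 2}. prob (E j))"
    using mem by (intro indep_setsD[OF ind]) (auto simp: L)
  ultimately show "prob (A \<inter> (B \<inter> C)) = prob A * prob (B \<inter> C)" "prob (B \<inter> C) = prob B * prob C"
    unfolding L by (simp_all add: E Int_ac)
qed

lemma realisation:
  "AE \<omega> in M. bps_realisation (N \<omega>) (R \<omega>) (\<lambda>t. \<xi> t \<omega>) (\<lambda>t. v t \<omega>)"
proof -
  have "AE \<omega> in M. counts_on_line (time_count (N \<omega>) ({0..} \<times> {0..real k}))" for k :: nat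
    by (rule poisson_time_counts[OF bounce_poisson sets_bounce_intensity])
      (auto simp: bounce_intensity_rectangle(1) bounce_intensity_window)
  then have "AE \<omega> in M. \<forall>k::nat. counts_on_line (time_count (N \<omega>) ({0..} \<times> {0..real k}))"
    by (simp add: AE_all_countable)
  moreover have "AE \<omega> in M. counts_on_line (time_count (R \<omega>) ({0..} \<times> sphere 0 1))"
    by (rule poisson_time_counts[OF refresh_poisson sets_refresh_intensity])
      (use rate_pos in \<open>auto simp: refresh_intensity_cylinder(1) refresh_intensity_window\<close>)
  ultimately show ?thesis
    using paths AE_space
    by eventually_elim (auto intro!: bps_realisation.intro simp: sets_bounce_intensity sets_refresh_intensity)
qed

lemma bounce_counts:
  assumes "0 \<le> a" shows "AE \<omega> in M. counts_on_line (time_count (N \<omega>) ({0..} \<times> {0..a}))"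
  using assms by (intro poisson_time_counts[OF bounce_poisson sets_bounce_intensity])
    (auto simp: bounce_intensity_rectangle(1) bounce_intensity_window)

lemma norm_initial_velocity: "AE \<omega> in M. norm (v 0 \<omega>) = 1"
  using realisation by eventually_elim (rule bps_realisation.norm_velocity, auto)

definition momentum :: "'w \<Rightarrow> real" where
  "momentum \<omega> = max 0 (\<xi> 0 \<omega> \<bullet> v 0 \<omega>)"

lemma measurable_initial_M [measurable]: "\<xi> 0 \<in> borel_measurable M" "v 0 \<in> borel_measurable M"
  by (auto intro: position_measurable velocity_measurable)

lemma expected_momentum: "(\<integral>\<^sup>+\<omega>. ennreal (momentum \<omega>) \<partial>M) = ennreal (1 / sqrt (2 * pi))"
proof -
  have "prob ((\<xi> 0 -` A \<inter> space M) \<inter> (v 0 -` B \<inter> space M)) = prob (\<xi> 0 -` A \<inter> space M) * prob (v 0 -` B \<inter> space M)"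
    if "A \<in> sets borel" "B \<in> sets borel" for A B
    using that by (intro source_pair_indep[of "{0}" "{1}"])
      (auto intro!: sigma_sets.Basic in_vimage_algebra simp: random_variable_sigma_def)
  then have joint: "distr M borel (\<xi> 0) \<Otimes>\<^sub>M distr M borel (v 0) = distr M (borel \<Otimes>\<^sub>M borel) (\<lambda>\<omega>. (\<xi> 0 \<omega>, v 0 \<omega>))"
    by (intro distr_pair_indep) auto
  interpret G: prob_space "std_gaussian :: 'a measure" by (rule prob_space_std_gaussian)
  interpret U: prob_space "sphere_uniform :: 'a measure" by (rule prob_space_sphere_uniform)
  interpret pair_sigma_finite "std_gaussian :: 'a measure" "sphere_uniform :: 'a measure" ..
  let ?f = "\<lambda>(x, w::'a). ennreal (max 0 (x \<bullet> w))"
  have [measurable]: "?f \<in> borel_measurable (borel \<Otimes>\<^sub>M borel)" by measurable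
  have "(\<integral>\<^sup>+\<omega>. ennreal (momentum \<omega>) \<partial>M) = (\<integral>\<^sup>+p. ?f p \<partial>distr M (borel \<Otimes>\<^sub>M borel) (\<lambda>\<omega>. (\<xi> 0 \<omega>, v 0 \<omega>)))"
    by (subst nn_integral_distr) (auto simp: momentum_def)
  also have "\<dots> = (\<integral>\<^sup>+p. ?f p \<partial>(std_gaussian \<Otimes>\<^sub>M sphere_uniform))"
    unfolding joint[symmetric] initial_position initial_velocity ..
  also have "\<dots> = (\<integral>\<^sup>+w. \<integral>\<^sup>+x. ennreal (max 0 (x \<bullet> (w::'a))) \<partial>std_gaussian \<partial>sphere_uniform)"
    by (subst nn_integral_snd[symmetric]) auto
  also have "\<dots> = (\<integral>\<^sup>+w. ennreal (1 / sqrt (2 * pi)) \<partial>(sphere_uniform :: 'a measure))"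
  proof (rule nn_integral_cong_AE)
    show "AE w in sphere_uniform. (\<integral>\<^sup>+x. ennreal (max 0 (x \<bullet> (w::'a))) \<partial>std_gaussian) = ennreal (1 / sqrt (2 * pi))"
      using AE_sphere_uniform by (rule eventually_mono) (rule std_gaussian_positive_part, simp)
  qed
  also have "\<dots> = ennreal (1 / sqrt (2 * pi))"
    by (simp add: U.emeasure_space_1)
  finally show ?thesis .
qed

section \<open>A single refreshment\<close>

text \<open>
  If the refreshment measure has mass one on the time window, these are the time and the direction of
  the refreshment. In \<open>refresh_velocity\<close>, the shift by one makes the integrand nonnegative, because the coordinates of unit vectors lie between
  \<open>-1\<close> and \<open>1\<close>; it is compensated by the total mass one.
\<close>

definition refresh_time :: "real \<Rightarrow> 'w \<Rightarrow> real" where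
  "refresh_time h \<omega> = enn2real (\<integral>\<^sup>+p. ennreal (indicator ({0<..h} \<times> sphere 0 1) p * fst p) \<partial>R \<omega>)"

definition refresh_velocity :: "real \<Rightarrow> 'w \<Rightarrow> 'a" where
  "refresh_velocity h \<omega> = (\<Sum>b\<in>Basis. (enn2real (\<integral>\<^sup>+p.
      ennreal (indicator ({0<..h} \<times> sphere 0 1) p * (snd p \<bullet> b + 1)) \<partial>R \<omega>) - 1) *\<^sub>R b)"

lemma measurable_refresh_marks:
  "refresh_time h \<in> borel_measurable (count_algebra (refresh_intensity \<rho>) R)"
  "refresh_velocity h \<in> borel_measurable (count_algebra (refresh_intensity \<rho>) R)"
proof -
  note [measurable] = mark_measurable[OF sets_refresh_intensity[of \<rho>]]
  have [measurable]: "{0<..h} \<times> sphere 0 1 \<in> sets (refresh_intensity \<rho> :: (real \<times> 'a) measure)"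
    by (intro refresh_intensity_cylinder) auto
  have "(\<lambda>\<omega>. \<integral>\<^sup>+p. ennreal (indicator ({0<..h} \<times> sphere 0 1) p * fst p) \<partial>R \<omega>)
      \<in> borel_measurable (count_algebra (refresh_intensity \<rho>) R)"
    by (intro nn_integral_measurable_count_algebra sets_driving) measurable
  then show "refresh_time h \<in> borel_measurable (count_algebra (refresh_intensity \<rho>) R)"
    unfolding refresh_time_def by measurable
  have "(\<lambda>\<omega>. \<integral>\<^sup>+p. ennreal (indicator ({0<..h} \<times> sphere 0 1) p * (snd p \<bullet> b + 1)) \<partial>R \<omega>)
      \<in> borel_measurable (count_algebra (refresh_intensity \<rho>) R)" for b
    by (intro nn_integral_measurable_count_algebra sets_driving) measurable
  then show "refresh_velocity h \<in> borel_measurable (count_algebra (refresh_intensity \<rho>) R)"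
    unfolding refresh_velocity_def by measurable
qed

lemma refresh_marks:
  assumes \<omega>: "\<omega> \<in> space M" and one: "emeasure (R \<omega>) ({0<..h} \<times> sphere 0 1) = 1"
  shows "(LINT p:{0<..h} \<times> sphere 0 1|R \<omega>. fst p) = refresh_time h \<omega>"
    and "(LINT p:{0<..h} \<times> sphere 0 1|R \<omega>. snd p) = refresh_velocity h \<omega>"
proof -
  note [measurable] = mark_measurable[OF trans[OF sets_driving(2)[OF \<omega>] sets_refresh_intensity]]
  let ?A = "{0<..h} \<times> sphere (0::'a) 1"
  have A [measurable]: "?A \<in> sets (R \<omega>)"
    unfolding sets_driving(2)[OF \<omega>] by (intro refresh_intensity_cylinder) auto
  show "(LINT p:?A|R \<omega>. fst p) = refresh_time h \<omega>"
    unfolding set_lebesgue_integral_def refresh_time_def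
    by (subst integral_eq_nn_integral) (auto simp: indicator_def)
  have int: "set_integrable (R \<omega>) ?A snd"
    unfolding set_integrable_def using one A
    by (intro integrableI_bounded_set_indicator[where B=1]) (auto simp: less_top[symmetric])
  have int1: "set_integrable (R \<omega>) ?A (\<lambda>_. 1::real)"
    unfolding set_integrable_def using one A by simp
  have "(LINT p:?A|R \<omega>. snd p) \<bullet> b = enn2real (\<integral>\<^sup>+p. ennreal (indicator ?A p * (snd p \<bullet> b + 1)) \<partial>R \<omega>) - 1"
    if b: "b \<in> Basis" for b
  proof -
    have intb: "set_integrable (R \<omega>) ?A (\<lambda>p. snd p \<bullet> b)"
      using integrable_inner_left[of b "R \<omega>" "\<lambda>p. indicator ?A p *\<^sub>R snd p"] int
      by (simp add: set_integrable_def)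
    have "(LINT p:?A|R \<omega>. snd p) \<bullet> b = (LINT p:?A|R \<omega>. snd p \<bullet> b)"
      using int unfolding set_integrable_def set_lebesgue_integral_def
      by (subst integral_inner_left[symmetric]) auto
    also have "\<dots> = (LINT p:?A|R \<omega>. snd p \<bullet> b + 1) - (LINT p:?A|R \<omega>. 1)"
      using set_integral_add(2)[OF intb int1] by simp
    also have "(LINT p:?A|R \<omega>. (1::real)) = 1"
      using one A by (simp add: set_lebesgue_integral_def measure_def)
    also have "(LINT p:?A|R \<omega>. snd p \<bullet> b + 1) = enn2real (\<integral>\<^sup>+p. ennreal (indicator ?A p * (snd p \<bullet> b + 1)) \<partial>R \<omega>)"
    proof -
      have "0 \<le> u \<bullet> b + 1" if "norm u = 1" for u
        using Basis_le_norm[OF b, of u] that by auto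
      then show ?thesis
        unfolding set_lebesgue_integral_def
        by (subst integral_eq_nn_integral) (auto simp: indicator_def)
    qed
    finally show ?thesis .
  qed
  then have "(LINT p:?A|R \<omega>. snd p) = (\<Sum>b\<in>Basis. (enn2real (\<integral>\<^sup>+p.
      ennreal (indicator ?A p * (snd p \<bullet> b + 1)) \<partial>R \<omega>) - 1) *\<^sub>R b)"
    by (subst euclidean_representation[symmetric]) (rule sum.cong, simp_all)
  then show "(LINT p:?A|R \<omega>. snd p) = refresh_velocity h \<omega>"
    by (simp only: refresh_velocity_def)
qed

lemma source_events: "i < 4 \<Longrightarrow> source i \<subseteq> events"
  using independence unfolding source_def[symmetric] by (simp add: indep_sets_def)

lemma refresh_marks_events [measurable]:
  "refresh_time h \<in> borel_measurable M" "refresh_velocity h \<in> borel_measurable M"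
  using measurable_refresh_marks[of h] source_events[of 3]
  by (auto intro!: measurable_larger_algebra[where F="count_algebra (refresh_intensity \<rho>) R" and F'=M]
      simp: sets_count_algebra)

text \<open>
  By the independence of \<open>v 0\<close> from the new direction \<open>u\<close>, and as points of the sphere are null, \<open>u\<close>
  differs from \<open>v 0\<close>. Given \<open>v 0\<close>, \<open>u\<close> and the time of the refreshment, the vanishing of the inner
  product then says that \<open>\<xi> 0\<close> lies on a fixed hyperplane.
\<close>

lemma refresh_not_degenerate:
  assumes dim: "2 \<le> DIM('a)"
  shows "AE \<omega> in M. (\<xi> 0 \<omega> + refresh_time h \<omega> *\<^sub>R v 0 \<omega>) \<bullet> (refresh_velocity h \<omega> - v 0 \<omega>) \<noteq> 0"
proof -
  \<comment> \<open>The new direction differs from the old one, so that the hyperplane below is a proper one.\<close>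
  have "AE \<omega> in M. (v 0 \<omega>, refresh_velocity h \<omega>) \<notin> {p. fst p = snd p}"
  proof (rule AE_indep_avoids[where S=borel and T=borel])
    fix A B :: "'a set" assume "A \<in> sets borel" "B \<in> sets borel"
    then show "prob (v 0 -` A \<inter> space M \<inter> (refresh_velocity h -` B \<inter> space M)) =
        prob (v 0 -` A \<inter> space M) * prob (refresh_velocity h -` B \<inter> space M)"
      using measurable_sets[OF measurable_refresh_marks(2), of B h]
      by (intro source_pair_indep[of "{1}" "{3}"])
        (auto intro!: sigma_sets.Basic in_vimage_algebra simp: random_variable_sigma_def sets_count_algebra)
  next
    show "{p. fst p = snd p} \<in> sets (borel \<Otimes>\<^sub>M borel :: ('a \<times> 'a) measure)"
    proof -
      have "(\<lambda>p::'a \<times> 'a. fst p - snd p) \<in> borel_measurable (borel \<Otimes>\<^sub>M borel)" by measurable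
      then have "(\<lambda>p::'a \<times> 'a. fst p - snd p) -` {0} \<inter> space (borel \<Otimes>\<^sub>M borel) \<in> sets (borel \<Otimes>\<^sub>M borel)"
        by (rule measurable_sets) simp
      moreover have "(\<lambda>p::'a \<times> 'a. fst p - snd p) -` {0} \<inter> space (borel \<Otimes>\<^sub>M borel) = {p. fst p = snd p}"
        by (auto simp: space_pair_measure)
      ultimately show ?thesis by simp
    qed
  next
    fix u :: 'a
    have "(\<lambda>x. (x, u)) -` {p. fst p = snd p} = {u}" by auto
    then show "emeasure (distr M borel (v 0)) ((\<lambda>x. (x, u)) -` {p. fst p = snd p}) = 0"
      using sphere_uniform_point[OF dim, of u] by (simp add: initial_velocity)
  qed simp_all
  moreover define Q :: "('a \<times> 'a \<times> real \<times> 'a) set" where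
    "Q = {(x, w, s, u). u \<noteq> w \<and> (x + s *\<^sub>R w) \<bullet> (u - w) = 0}"
  have "AE \<omega> in M. (\<xi> 0 \<omega>, v 0 \<omega>, refresh_time h \<omega>, refresh_velocity h \<omega>) \<notin> Q"
  proof (rule AE_indep_avoids[where S=borel and T="borel \<Otimes>\<^sub>M borel \<Otimes>\<^sub>M borel"])
    define F where "F = sigma (space M) (source 1 \<union> source 3)"
    have "source 1 \<union> source 3 \<subseteq> Pow (space M)"
      using source_events[of 1] source_events[of 3] sets.space_closed[of M] by auto
    then have sF: "sets F = sigma_sets (space M) (source 1 \<union> source 3)" "space F = space M"
      by (auto simp: F_def space_measure_of_conv)
    have [measurable]: "v 0 \<in> borel_measurable F"
      using sF by (intro measurable_random_variable_sigma) (auto intro: sigma_sets.Basic)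
    have [measurable]: "refresh_time h \<in> borel_measurable F" "refresh_velocity h \<in> borel_measurable F"
      using measurable_refresh_marks[of h] sF
      by (auto intro!: measurable_larger_algebra[where F'=F] sigma_sets.Basic simp: sets_count_algebra)
    have Y: "(\<lambda>\<omega>. (v 0 \<omega>, refresh_time h \<omega>, refresh_velocity h \<omega>)) \<in> F \<rightarrow>\<^sub>M borel \<Otimes>\<^sub>M borel \<Otimes>\<^sub>M borel"
      by measurable
    fix A :: "'a set" and B :: "('a \<times> real \<times> 'a) set"
    assume "A \<in> sets borel" "B \<in> sets (borel \<Otimes>\<^sub>M borel \<Otimes>\<^sub>M borel)"
    then show "prob (\<xi> 0 -` A \<inter> space M \<inter> ((\<lambda>\<omega>. (v 0 \<omega>, refresh_time h \<omega>, refresh_velocity h \<omega>)) -` B \<inter> space M)) =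
        prob (\<xi> 0 -` A \<inter> space M) * prob ((\<lambda>\<omega>. (v 0 \<omega>, refresh_time h \<omega>, refresh_velocity h \<omega>)) -` B \<inter> space M)"
      using measurable_sets[OF Y, of B] sF
      by (intro source_pair_indep[of "{0}" "{1, 3}"])
        (auto intro!: sigma_sets.Basic in_vimage_algebra simp: random_variable_sigma_def)
  next
    show "Q \<in> sets (borel \<Otimes>\<^sub>M borel \<Otimes>\<^sub>M borel \<Otimes>\<^sub>M borel)"
    proof -
      let ?P = "borel \<Otimes>\<^sub>M borel \<Otimes>\<^sub>M borel \<Otimes>\<^sub>M borel :: ('a \<times> 'a \<times> real \<times> 'a) measure"
      let ?d = "\<lambda>(x::'a, w::'a, s::real, u::'a). u - w"
      let ?g = "\<lambda>(x::'a, w::'a, s::real, u::'a). (x + s *\<^sub>R w) \<bullet> (u - w)"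
      have d: "?d \<in> borel_measurable ?P" and g: "?g \<in> borel_measurable ?P" by measurable
      have "(?d -` (- {0}) \<inter> space ?P) \<inter> (?g -` {0} \<inter> space ?P) \<in> sets ?P"
        by (rule sets.Int[OF measurable_sets[OF d] measurable_sets[OF g]]) simp_all
      moreover have "(?d -` (- {0}) \<inter> space ?P) \<inter> (?g -` {0} \<inter> space ?P) = Q"
        by (auto simp: Q_def space_pair_measure)
      ultimately show ?thesis by simp
    qed
  next
    fix y :: "'a \<times> real \<times> 'a"
    obtain w s u where y: "y = (w, s, u)" by (metis prod_cases3)
    show "emeasure (distr M borel (\<xi> 0)) ((\<lambda>x. (x, y)) -` Q) = 0"
    proof (cases "u = w")
      case True
      then have "(\<lambda>x. (x, y)) -` Q = {}" by (auto simp: Q_def y)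
      then show ?thesis by simp
    next
      case False
      then have "(\<lambda>x. (x, y)) -` Q = {x. x \<bullet> (u - w) = - (s *\<^sub>R w \<bullet> (u - w))}"
        by (auto simp: Q_def y inner_add_left)
      then show ?thesis
        using std_gaussian_hyperplane[of "u - w"] False by (simp add: initial_position)
    qed
  qed simp_all
  ultimately show ?thesis
    by eventually_elim (auto simp: Q_def)
qed

section \<open>The probability of a switch in a short interval\<close>

definition clock_at :: "real \<Rightarrow> 'w \<Rightarrow> real" where
  "clock_at t \<omega> = \<xi> t \<omega> \<bullet> v t \<omega> - t"

lemma clock_at_eq:
  assumes "bps_realisation (N \<omega>) (R \<omega>) (\<lambda>t. \<xi> t \<omega>) (\<lambda>t. v t \<omega>)"
  shows "bps_realisation.clock (\<lambda>t. \<xi> t \<omega>) (\<lambda>t. v t \<omega>) t = clock_at t \<omega>"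
  using bps_realisation.clock_def[OF assms] by (simp add: clock_at_def)

lemma measurable_clock_at [measurable]: "0 \<le> t \<Longrightarrow> clock_at t \<in> borel_measurable M"
  unfolding clock_at_def using position_measurable[of t] velocity_measurable[of t] by measurable

lemma measurable_momentum: "momentum \<in> borel_measurable initial_algebra"
  unfolding momentum_def using measurable_initial by measurable

lemma momentum_M [measurable]: "momentum \<in> borel_measurable M"
  unfolding momentum_def by measurable

lemma momentum_nonneg: "0 \<le> momentum \<omega>"
  by (simp add: momentum_def)

text \<open>
  The momentum is rounded down to a multiple of \<open>h\<close>. The rounded value takes countably many values,
  and the error of order \<open>h\<close> is negligible in the limit.
\<close>

definition grid_index :: "real \<Rightarrow> 'w \<Rightarrow> nat" where
  "grid_index h \<omega> = nat \<lfloor>momentum \<omega> / h\<rfloor>"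

lemma measurable_grid_index [measurable]: "grid_index h \<in> initial_algebra \<rightarrow>\<^sub>M count_space UNIV"
  unfolding grid_index_def using measurable_momentum by measurable

lemma grid_index_bounds:
  assumes "0 < h"
  shows "real (grid_index h \<omega>) * h \<le> momentum \<omega>" "momentum \<omega> < real (grid_index h \<omega>) * h + h"
proof -
  have "0 \<le> momentum \<omega> / h" using assms momentum_nonneg by simp
  then have "real (grid_index h \<omega>) \<le> momentum \<omega> / h" "momentum \<omega> / h < real (grid_index h \<omega>) + 1"
    unfolding grid_index_def by linarith+
  then show "real (grid_index h \<omega>) * h \<le> momentum \<omega>" "momentum \<omega> < real (grid_index h \<omega>) * h + h"
    using assms by (simp_all add: field_simps)
qed

lemma bounce_event:
  assumes "A \<in> sets bounce_intensity"
  shows "{\<omega>\<in>space M. emeasure (N \<omega>) A = c} \<in> random_measure_sigma M bounce_intensity N"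
proof -
  note [measurable] = measurable_count_algebra[OF assms, of N]
  have "{\<omega>\<in>space (count_algebra bounce_intensity N). emeasure (N \<omega>) A = c} \<in> sets (count_algebra bounce_intensity N)"
    by measurable
  then show ?thesis by (simp add: sets_count_algebra)
qed

lemma refresh_event:
  assumes "A \<in> sets (refresh_intensity \<rho>)"
  shows "{\<omega>\<in>space M. emeasure (R \<omega>) A = c} \<in> random_measure_sigma M (refresh_intensity \<rho>) R"
proof -
  note [measurable] = measurable_count_algebra[OF assms, of R]
  have "{\<omega>\<in>space (count_algebra (refresh_intensity \<rho>) R). emeasure (R \<omega>) A = c} \<in> sets (count_algebra (refresh_intensity \<rho>) R)"
    by measurable
  then show ?thesis by (simp add: sets_count_algebra)
qed

lemma initial_event:
  assumes "J \<in> initial_algebra \<rightarrow>\<^sub>M count_space UNIV"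
  shows "{\<omega>\<in>space M. J \<omega> = i} \<in> sets initial_algebra"
proof -
  have "J -` {i} \<inter> space initial_algebra \<in> sets initial_algebra"
    using assms by (rule measurable_sets) simp
  moreover have "J -` {i} \<inter> space initial_algebra = {\<omega>\<in>space M. J \<omega> = i}" by auto
  ultimately show ?thesis by simp
qed

lemma space_in_random_measure_sigma: "space M \<in> random_measure_sigma M \<mu> P"
  using sets.top[of "count_algebra \<mu> P"] by (simp add: sets_count_algebra)

text \<open>
  Without refreshment and without bounce marks below \<open>S\<^sup>+ + h\<close> nothing happens up to time \<open>h\<close>, where
  \<open>S\<^sup>+\<close> is the positive part of the initial momentum. The level \<open>j * h + 2 * h\<close> is at least \<open>S\<^sup>+ + h\<close>
  if \<open>j\<close> is the grid index. The probability of a nonzero Poisson count is at most its mean.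
\<close>

lemma change_probability_upper:
  assumes h: "0 < h"
  shows "emeasure M {\<omega>\<in>space M. clock_at h \<omega> \<noteq> clock_at 0 \<omega>} \<le> ennreal (h * (\<rho> + 1 / sqrt (2 * pi) + 2 * h))"
proof -
  define b where "b j = real j * h + 2 * h" for j :: nat
  define A where "A j = {0<..h} \<times> {0..b j}" for j
  have b: "0 \<le> b j" for j using h by (simp add: b_def)
  have A: "A j \<in> sets bounce_intensity" for j
    unfolding A_def by (intro bounce_intensity_rectangle) auto
  have mA: "emeasure bounce_intensity (A j) = ennreal (h * b j)" for j
    using bounce_intensity_window(1)[of 0 h "b j"] h b by (simp add: A_def)
  define G where "G j = space M - {\<omega>\<in>space M. emeasure (N \<omega>) (A j) = 0}" for j
  have G_sigma: "G j \<in> random_measure_sigma M bounce_intensity N" for j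
    unfolding G_def using sets.compl_sets[of _ "count_algebra bounce_intensity N"] bounce_event[OF A, of j 0]
    by (simp add: sets_count_algebra)
  have full: "space M \<in> random_measure_sigma M (refresh_intensity \<rho>) R"
    by (rule space_in_random_measure_sigma)
  have J: "{\<omega>\<in>space M. grid_index h \<omega> = j} \<in> sets initial_algebra" for j
    by (rule initial_event) measurable
  note ind = indep_initial_bounce_refresh[OF J G_sigma full]
  have [simp]: "G j \<inter> space M = G j" for j by (auto simp: G_def)
  have jump: "{\<omega>\<in>space M. \<omega> \<in> G (grid_index h \<omega>)} \<in> events"
    "emeasure M {\<omega>\<in>space M. \<omega> \<in> G (grid_index h \<omega>)} = (\<integral>\<^sup>+\<omega>. emeasure M (G (grid_index h \<omega>)) \<partial>M)"
    using ind(1,2,4) by (auto intro!: emeasure_random_index)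
  define C where "C = {\<omega>\<in>space M. emeasure (R \<omega>) ({0<..h} \<times> sphere 0 1) \<noteq> 0}"
  have cyl: "{0<..h} \<times> sphere 0 1 \<in> sets (refresh_intensity \<rho> :: (real \<times> 'a) measure)"
    by (intro refresh_intensity_cylinder) auto
  have C: "emeasure M C \<le> ennreal (\<rho> * h)"
    unfolding C_def using refresh_intensity_window[of 0 h \<rho>] h rate_pos
    by (intro emeasure_poisson_nonzero_le[OF refresh_poisson cyl]) auto
  have C_ev: "C \<in> events"
    unfolding C_def using poisson_count_measurable[OF refresh_poisson cyl] by measurable
  have "emeasure M {\<omega>\<in>space M. clock_at h \<omega> \<noteq> clock_at 0 \<omega>} \<le> emeasure M (C \<union> {\<omega>\<in>space M. \<omega> \<in> G (grid_index h \<omega>)})"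
  proof (rule emeasure_mono_AE)
    show "AE \<omega> in M. \<omega> \<in> {\<omega>\<in>space M. clock_at h \<omega> \<noteq> clock_at 0 \<omega>} \<longrightarrow> \<omega> \<in> C \<union> {\<omega>\<in>space M. \<omega> \<in> G (grid_index h \<omega>)}"
      using realisation
    proof eventually_elim
      case (elim \<omega>)
      show ?case
      proof (rule impI, rule ccontr)
        assume \<omega>: "\<omega> \<in> {\<omega>\<in>space M. clock_at h \<omega> \<noteq> clock_at 0 \<omega>}"
          and no: "\<omega> \<notin> C \<union> {\<omega>\<in>space M. \<omega> \<in> G (grid_index h \<omega>)}"
        interpret bps_realisation "N \<omega>" "R \<omega>" "\<lambda>t. \<xi> t \<omega>" "\<lambda>t. v t \<omega>" by (rule elim)
        have "emeasure (R \<omega>) ({0<..h} \<times> sphere 0 1) = 0" using \<omega> no by (auto simp: C_def)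
        moreover have "emeasure (N \<omega>) ({0<..h} \<times> {0..b (grid_index h \<omega>)}) = 0"
          using \<omega> no by (auto simp: G_def A_def)
        moreover have "max 0 (\<xi> 0 \<omega> \<bullet> v 0 \<omega>) + h \<le> b (grid_index h \<omega>)"
          using grid_index_bounds(2)[OF h, of \<omega>] by (simp add: momentum_def b_def)
        ultimately have "clock_at h \<omega> = clock_at 0 \<omega>"
          using clock_undisturbed[of h "b (grid_index h \<omega>)"] h clock_at_eq[OF elim] by simp
        then show False using \<omega> by simp
      qed
    qed
    show "C \<union> {\<omega>\<in>space M. \<omega> \<in> G (grid_index h \<omega>)} \<in> events" using C_ev jump(1) by auto
  qed
  also have "\<dots> \<le> emeasure M C + (\<integral>\<^sup>+\<omega>. emeasure M (G (grid_index h \<omega>)) \<partial>M)"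
    unfolding jump(2)[symmetric] using C_ev jump(1) by (rule emeasure_subadditive)
  also have "\<dots> \<le> ennreal (\<rho> * h) + (\<integral>\<^sup>+\<omega>. (ennreal h * ennreal (momentum \<omega>) + ennreal (2 * h * h)) \<partial>M)"
  proof (intro add_mono C nn_integral_mono)
    fix \<omega>
    have "G j = {\<omega>\<in>space M. emeasure (N \<omega>) (A j) \<noteq> 0}" for j by (auto simp: G_def)
    then have "emeasure M (G (grid_index h \<omega>)) \<le> ennreal (h * b (grid_index h \<omega>))"
      using emeasure_poisson_nonzero_le[OF bounce_poisson A mA] h b by simp
    also have "\<dots> \<le> ennreal (h * (momentum \<omega> + 2 * h))"
      using grid_index_bounds(1)[OF h, of \<omega>] h by (intro ennreal_leI mult_left_mono) (auto simp: b_def)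
    also have "\<dots> = ennreal h * ennreal (momentum \<omega>) + ennreal (2 * h * h)"
      using h momentum_nonneg[of \<omega>]
      by (simp add: ennreal_mult[symmetric] ennreal_plus[symmetric] algebra_simps del: ennreal_plus)
    finally show "emeasure M (G (grid_index h \<omega>)) \<le> ennreal h * ennreal (momentum \<omega>) + ennreal (2 * h * h)" .
  qed
  also have "\<dots> = ennreal (\<rho> * h) + (ennreal h * ennreal (1 / sqrt (2 * pi)) + ennreal (2 * h * h))"
    by (subst nn_integral_add) (auto simp: nn_integral_cmult expected_momentum emeasure_space_1)
  also have "\<dots> = ennreal (h * (\<rho> + 1 / sqrt (2 * pi) + 2 * h))"
    using h rate_pos
    by (simp add: ennreal_mult[symmetric] ennreal_plus[symmetric] algebra_simps del: ennreal_plus)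
  finally show ?thesis .
qed

definition radius_bound :: "real \<Rightarrow> 'w \<Rightarrow> nat" where
  "radius_bound h \<omega> = nat \<lceil>norm (\<xi> 0 \<omega>) + h\<rceil>"

lemma radius_bound_bounds:
  assumes "0 < h"
  shows "norm (\<xi> 0 \<omega>) + h \<le> real (radius_bound h \<omega>)" "real (radius_bound h \<omega>) \<le> norm (\<xi> 0 \<omega>) + h + 1"
proof -
  have "0 < norm (\<xi> 0 \<omega>) + h" using assms norm_ge_zero[of "\<xi> 0 \<omega>"] by linarith
  then show "norm (\<xi> 0 \<omega>) + h \<le> real (radius_bound h \<omega>)" "real (radius_bound h \<omega>) \<le> norm (\<xi> 0 \<omega>) + h + 1"
    unfolding radius_bound_def by linarith+
qed

lemma measurable_radius_bound [measurable]: "radius_bound h \<in> initial_algebra \<rightarrow>\<^sub>M count_space UNIV"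
  unfolding radius_bound_def using measurable_initial by measurable

text \<open>
  In both events, \<open>K\<close> stands for a level that the momentum cannot exceed up to time \<open>h\<close>, and \<open>a\<close> for a
  level that the initial momentum attains.
\<close>

definition lone_refreshment :: "real \<Rightarrow> real \<Rightarrow> 'w set" where
  "lone_refreshment h K = {\<omega>\<in>space M. emeasure (N \<omega>) ({0<..h} \<times> {0..K}) = 0} \<inter>
     {\<omega>\<in>space M. emeasure (R \<omega>) ({0<..h} \<times> sphere 0 1) = 1}"

definition lone_bounce :: "real \<Rightarrow> real \<Rightarrow> real \<Rightarrow> 'w set" where
  "lone_bounce h a K = ({\<omega>\<in>space M. emeasure (N \<omega>) ({0<..h} \<times> {0..a}) = 1} \<inter>
      {\<omega>\<in>space M. emeasure (N \<omega>) ({0<..h} \<times> {a<..K}) = 0}) \<inter>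
     {\<omega>\<in>space M. emeasure (R \<omega>) ({0<..h} \<times> sphere 0 1) = 0}"

lemma cylinder_in_sets: "{0<..h} \<times> sphere 0 1 \<in> sets (refresh_intensity \<rho> :: (real \<times> 'a) measure)"
  by (intro refresh_intensity_cylinder) auto

lemma window_in_sets: "0 \<le> a \<Longrightarrow> {0<..h} \<times> {a<..b} \<in> sets bounce_intensity" "{0<..h} \<times> {0..b} \<in> sets bounce_intensity"
  by (intro bounce_intensity_rectangle; auto)+

lemma random_measure_sigma_Int:
  "A \<in> random_measure_sigma M \<mu> P \<Longrightarrow> B \<in> random_measure_sigma M \<mu> P \<Longrightarrow> A \<inter> B \<in> random_measure_sigma M \<mu> P"
  unfolding random_measure_sigma_def by (rule sets.Int)

lemma lone_refreshment:
  assumes "0 \<le> h" "0 \<le> K" "A \<in> sets initial_algebra"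
  shows "lone_refreshment h K \<in> events"
    and "prob (A \<inter> lone_refreshment h K) = prob A * prob (lone_refreshment h K)"
    and "prob (lone_refreshment h K) = exp (- (h * K)) * (\<rho> * h * exp (- (\<rho> * h)))"
proof -
  note ind = indep_initial_bounce_refresh[OF assms(3) bounce_event[OF window_in_sets(2)] refresh_event[OF cylinder_in_sets]]
  show "lone_refreshment h K \<in> events"
    "prob (A \<inter> lone_refreshment h K) = prob A * prob (lone_refreshment h K)"
    unfolding lone_refreshment_def using ind(2,3,4) by auto
  show "prob (lone_refreshment h K) = exp (- (h * K)) * (\<rho> * h * exp (- (\<rho> * h)))"
    unfolding lone_refreshment_def ind(5)
    using prob_poisson_zero[OF bounce_poisson window_in_sets(2), of h K "h * K"]
      prob_poisson_one[OF refresh_poisson cylinder_in_sets, of h "\<rho> * h"]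
      bounce_intensity_window(1)[of 0 h K] refresh_intensity_window[of 0 h \<rho>] assms rate_pos
    by simp
qed

lemma lone_bounce:
  assumes "0 < h" "0 \<le> a" "a \<le> K" "A \<in> sets initial_algebra"
  shows "lone_bounce h a K \<in> events"
    and "prob (A \<inter> lone_bounce h a K) = prob A * prob (lone_bounce h a K)"
    and "prob (lone_bounce h a K) = h * a * exp (- (h * K)) * exp (- (\<rho> * h))"
proof -
  let ?X = "{0<..h} \<times> {0..a}" and ?Y = "{0<..h} \<times> {a<..K}"
  note sets = window_in_sets(2)[of h a] window_in_sets(1)[OF \<open>0 \<le> a\<close>, of h K]
  note ind = indep_initial_bounce_refresh[OF assms(4)
      random_measure_sigma_Int[OF bounce_event[OF sets(1)] bounce_event[OF sets(2)]] refresh_event[OF cylinder_in_sets]]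
  show "lone_bounce h a K \<in> events"
    "prob (A \<inter> lone_bounce h a K) = prob A * prob (lone_bounce h a K)"
    unfolding lone_bounce_def using ind(2,3,4) by auto
  \<comment> \<open>Independence is available for distinct members of a set of disjoint windows, so the two windows
    must not coincide; \<open>?X\<close> is nonempty even if \<open>a = 0\<close>.\<close>
  have "(h, 0) \<in> ?X" "(h, 0) \<notin> ?Y" using assms by auto
  then have ne: "?X \<noteq> ?Y" by metis
  have "?X \<inter> ?Y = {}" by auto
  then have "disjoint {?X, ?Y}" by (auto simp: disjoint_def)
  then have iv: "indep_vars (\<lambda>_. borel) (\<lambda>A \<omega>. emeasure (N \<omega>) A) {?X, ?Y}"
    using bounce_poisson sets unfolding poisson_random_measure_def by auto
  have "prob (\<Inter>A\<in>{?X, ?Y}. (\<lambda>\<omega>. emeasure (N \<omega>) A) -` {if A = ?X then 1 else 0} \<inter> space M) =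
      (\<Prod>A\<in>{?X, ?Y}. prob ((\<lambda>\<omega>. emeasure (N \<omega>) A) -` {if A = ?X then 1 else 0} \<inter> space M))"
    by (rule indep_varsD[OF iv]) auto
  moreover have "(\<lambda>\<omega>. emeasure (N \<omega>) A) -` {c} \<inter> space M = {\<omega>\<in>space M. emeasure (N \<omega>) A = c}" for A c
    by auto
  ultimately have "prob ({\<omega>\<in>space M. emeasure (N \<omega>) ?X = 1} \<inter> {\<omega>\<in>space M. emeasure (N \<omega>) ?Y = 0}) =
      prob {\<omega>\<in>space M. emeasure (N \<omega>) ?X = 1} * prob {\<omega>\<in>space M. emeasure (N \<omega>) ?Y = 0}"
    using ne by simp
  also have "prob {\<omega>\<in>space M. emeasure (N \<omega>) ?X = 1} = h * a * exp (- (h * a))"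
    using bounce_intensity_window(1)[of 0 h a] assms
    by (intro prob_poisson_one[OF bounce_poisson sets(1)]) auto
  also have "prob {\<omega>\<in>space M. emeasure (N \<omega>) ?Y = 0} = exp (- (h * (K - a)))"
    using bounce_intensity_window(2)[of 0 h a K] assms
    by (intro prob_poisson_zero[OF bounce_poisson sets(2)]) auto
  also have "h * a * exp (- (h * a)) * exp (- (h * (K - a))) = h * a * exp (- (h * K))"
    by (simp add: exp_add[symmetric] algebra_simps flip: mult.assoc)
  finally have N: "prob ({\<omega>\<in>space M. emeasure (N \<omega>) ?X = 1} \<inter> {\<omega>\<in>space M. emeasure (N \<omega>) ?Y = 0}) =
      h * a * exp (- (h * K))" .
  have "prob {\<omega>\<in>space M. emeasure (R \<omega>) ({0<..h} \<times> sphere 0 1) = 0} = exp (- (\<rho> * h))"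
    using refresh_intensity_window[of 0 h \<rho>] assms rate_pos
    by (intro prob_poisson_zero[OF refresh_poisson cylinder_in_sets]) auto
  with N show "prob (lone_bounce h a K) = h * a * exp (- (h * K)) * exp (- (\<rho> * h))"
    unfolding lone_bounce_def ind(5) by simp
qed

text \<open>
  The two events \<open>lone_refreshment\<close> and \<open>lone_bounce\<close> are disjoint, and almost surely each of them changes the
  clock, the second one if \<open>a\<close> is positive. With the grid index \<open>j\<close> and the level \<open>K\<close>, both rounded functions of the initial state, the
  conditional probability of their union is \<open>h * exp (- h * (\<rho> + K)) * (\<rho> + j * h)\<close>.
\<close>

lemma change_probability_lower:
  assumes h: "0 < h" and dim: "2 \<le> DIM('a)"
  shows "(\<integral>\<^sup>+\<omega>. ennreal (h * (exp (- (h * (\<rho> + norm (\<xi> 0 \<omega>) + h + 1))) * (\<rho> + momentum \<omega> - h))) \<partial>M)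
    \<le> emeasure M {\<omega>\<in>space M. clock_at h \<omega> \<noteq> clock_at 0 \<omega>}"
proof -
  define J where "J \<omega> = prod_encode (grid_index h \<omega>, radius_bound h \<omega>)" for \<omega>
  \<comment> \<open>For \<open>j = 0\<close> the initial momentum may be zero, and a bounce at momentum zero changes nothing, so only
    the lone refreshment is kept. The probability of the lone bounce is zero in this case.\<close>
  define H where "H j k = (if real j * h \<le> real k then
      lone_refreshment h (real k) \<union> (if j = 0 then {} else lone_bounce h (real j * h) (real k)) else {})" for j k :: nat
  define G where "G i = case_prod H (prod_decode i)" for i
  have JI: "{\<omega>\<in>space M. J \<omega> = i} \<in> sets initial_algebra" for i
    by (rule initial_event) (simp add: J_def)
  have H_prob: "H j k \<in> events \<and> prob (A \<inter> H j k) = prob A * prob (H j k) \<and>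
      (real j * h \<le> real k \<longrightarrow> prob (H j k) = h * (exp (- (h * (\<rho> + real k))) * (\<rho> + real j * h)))"
    if A: "A \<in> sets initial_algebra" for j k A
  proof (cases "real j * h \<le> real k")
    case True
    note r = lone_refreshment[OF less_imp_le[OF h] _ A, of "real k"]
    have A_ev: "A \<in> events" using indep_initial_bounce_refresh(1)[OF A space_in_random_measure_sigma space_in_random_measure_sigma] .
    have split_exp: "exp (- (h * (\<rho> + real k))) = exp (- (h * real k)) * exp (- (\<rho> * h))"
      by (simp add: exp_add[symmetric] algebra_simps)
    show ?thesis
    proof (cases "j = 0")
      case True
      then have H: "H j k = lone_refreshment h (real k)" by (simp add: H_def)
      have "prob (H j k) = h * (exp (- (h * (\<rho> + real k))) * (\<rho> + real j * h))"
        unfolding H r(3)[OF of_nat_0_le_iff] split_exp using True by simp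
      then show ?thesis using r(1,2) H by simp
    next
      case False
      have "0 \<le> real j * h" using h by simp
      note b = lone_bounce[OF h this \<open>real j * h \<le> real k\<close> A]
      have disj: "lone_refreshment h (real k) \<inter> lone_bounce h (real j * h) (real k) = {}"
        by (auto simp: lone_refreshment_def lone_bounce_def)
      have H: "H j k = lone_refreshment h (real k) \<union> lone_bounce h (real j * h) (real k)"
        using True False by (simp add: H_def)
      have P: "prob (H j k) = prob (lone_refreshment h (real k)) + prob (lone_bounce h (real j * h) (real k))"
        unfolding H using r(1) b(1) disj by (intro finite_measure_Union) auto
      have "prob (A \<inter> H j k) = prob (A \<inter> lone_refreshment h (real k)) + prob (A \<inter> lone_bounce h (real j * h) (real k))"
        unfolding H Int_Un_distrib using r(1) b(1) disj A_ev by (intro finite_measure_Union) auto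
      also have "\<dots> = prob A * prob (H j k)"
        unfolding P using r(2) b(2) by (simp add: distrib_left)
      finally have "prob (A \<inter> H j k) = prob A * prob (H j k)" .
      moreover have "prob (H j k) = h * (exp (- (h * (\<rho> + real k))) * (\<rho> + real j * h))"
        unfolding P r(3)[OF of_nat_0_le_iff] b(3) split_exp by (simp add: algebra_simps)
      ultimately show ?thesis using r(1) b(1) by (simp add: H)
    qed
  next
    case False
    then show ?thesis by (simp add: H_def)
  qed
  have G: "G i \<in> events" "prob ({\<omega>\<in>space M. J \<omega> = i} \<inter> G i) = prob {\<omega>\<in>space M. J \<omega> = i} * prob (G i)" for i
    using H_prob[OF JI[of i]] by (auto simp: G_def split: prod.splits)
  have J_ev: "{\<omega>\<in>space M. J \<omega> = i} \<in> events" for i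
    using indep_initial_bounce_refresh(1)[OF JI space_in_random_measure_sigma space_in_random_measure_sigma] .
  note random = emeasure_random_index[OF J_ev G]
  have index_le: "real (grid_index h \<omega>) * h \<le> real (radius_bound h \<omega>)" if "norm (v 0 \<omega>) = 1" for \<omega>
  proof -
    have "momentum \<omega> \<le> norm (\<xi> 0 \<omega>)"
      using norm_cauchy_schwarz[of "\<xi> 0 \<omega>" "v 0 \<omega>"] that by (simp add: momentum_def)
    then show ?thesis
      using grid_index_bounds(1)[OF h, of \<omega>] radius_bound_bounds(1)[OF h, of \<omega>] h by linarith
  qed
  have "(\<integral>\<^sup>+\<omega>. ennreal (h * (exp (- (h * (\<rho> + norm (\<xi> 0 \<omega>) + h + 1))) * (\<rho> + momentum \<omega> - h))) \<partial>M)
      \<le> (\<integral>\<^sup>+\<omega>. emeasure M (G (J \<omega>)) \<partial>M)"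
  proof (rule nn_integral_mono_AE)
    show "AE \<omega> in M. ennreal (h * (exp (- (h * (\<rho> + norm (\<xi> 0 \<omega>) + h + 1))) * (\<rho> + momentum \<omega> - h)))
        \<le> emeasure M (G (J \<omega>))"
      using norm_initial_velocity
    proof eventually_elim
      case (elim \<omega>)
      let ?j = "real (grid_index h \<omega>)" and ?k = "real (radius_bound h \<omega>)"
      have "exp (- (h * (\<rho> + norm (\<xi> 0 \<omega>) + h + 1))) * (\<rho> + momentum \<omega> - h) \<le> exp (- (h * (\<rho> + ?k))) * (\<rho> + ?j * h)"
      proof (cases "0 \<le> \<rho> + momentum \<omega> - h")
        case True
        have "h * (\<rho> + ?k) \<le> h * (\<rho> + norm (\<xi> 0 \<omega>) + h + 1)"
          using radius_bound_bounds(2)[OF h, of \<omega>] h by (intro mult_left_mono) auto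
        then show ?thesis
          using grid_index_bounds(2)[OF h, of \<omega>] True by (intro mult_mono) auto
      next
        case False
        then have "exp (- (h * (\<rho> + norm (\<xi> 0 \<omega>) + h + 1))) * (\<rho> + momentum \<omega> - h) \<le> 0"
          by (intro mult_nonneg_nonpos) auto
        also have "0 \<le> exp (- (h * (\<rho> + ?k))) * (\<rho> + ?j * h)"
          using h rate_pos by (intro mult_nonneg_nonneg add_nonneg_nonneg) auto
        finally show ?thesis .
      qed
      then have "h * (exp (- (h * (\<rho> + norm (\<xi> 0 \<omega>) + h + 1))) * (\<rho> + momentum \<omega> - h)) \<le> prob (G (J \<omega>))"
        using H_prob[OF JI[of 0], of "grid_index h \<omega>" "radius_bound h \<omega>"] index_le[OF elim] h
        by (simp add: G_def J_def mult_left_mono)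
      then show ?case by (simp add: emeasure_eq_measure ennreal_leI)
    qed
  qed
  also have "\<dots> = emeasure M {\<omega>\<in>space M. \<omega> \<in> G (J \<omega>)}"
    by (rule random(2)[symmetric])
  also have "\<dots> \<le> emeasure M {\<omega>\<in>space M. clock_at h \<omega> \<noteq> clock_at 0 \<omega>}"
  proof (rule emeasure_mono_AE)
    have "AE \<omega> in M. \<forall>j::nat. counts_on_line (time_count (N \<omega>) ({0..} \<times> {0..real j * h}))"
      using h by (subst AE_all_countable) (auto intro: bounce_counts)
    then show "AE \<omega> in M. \<omega> \<in> {\<omega>\<in>space M. \<omega> \<in> G (J \<omega>)} \<longrightarrow> \<omega> \<in> {\<omega>\<in>space M. clock_at h \<omega> \<noteq> clock_at 0 \<omega>}"
      using realisation refresh_not_degenerate[OF dim, of h]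
    proof eventually_elim
      case (elim \<omega>)
      show ?case
      proof
        assume "\<omega> \<in> {\<omega>\<in>space M. \<omega> \<in> G (J \<omega>)}"
        then have \<omega>: "\<omega> \<in> space M" "\<omega> \<in> H (grid_index h \<omega>) (radius_bound h \<omega>)"
          by (auto simp: G_def J_def)
        interpret bps_realisation "N \<omega>" "R \<omega>" "\<lambda>t. \<xi> t \<omega>" "\<lambda>t. v t \<omega>" by (rule elim)
        note [simp] = clock_at_eq[OF elim(2)]
        let ?j = "real (grid_index h \<omega>)" and ?k = "real (radius_bound h \<omega>)"
        consider "\<omega> \<in> lone_refreshment h ?k" | "0 < grid_index h \<omega>" "\<omega> \<in> lone_bounce h (?j * h) ?k"
          using \<omega>(2) by (auto simp: H_def split: if_splits)
        then show "\<omega> \<in> {\<omega>\<in>space M. clock_at h \<omega> \<noteq> clock_at 0 \<omega>}"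
        proof cases
          case 1
          then have one: "emeasure (R \<omega>) ({0<..h} \<times> sphere 0 1) = 1" "emeasure (N \<omega>) ({0<..h} \<times> {0..?k}) = 0"
            by (auto simp: lone_refreshment_def)
          show ?thesis
            using clock_one_refresh[OF one radius_bound_bounds(1)[OF h]] elim(3) \<omega>(1)
            unfolding refresh_marks[OF \<omega>(1) one(1)] by auto
        next
          case 2
          then have one: "emeasure (R \<omega>) ({0<..h} \<times> sphere 0 1) = 0" "emeasure (N \<omega>) ({0<..h} \<times> {0..?j * h}) = 1"
            "emeasure (N \<omega>) ({0<..h} \<times> {?j * h<..?k}) = 0"
            by (auto simp: lone_bounce_def)
          have "0 < ?j * h" using 2 h by simp
          moreover have "?j * h \<le> max 0 (\<xi> 0 \<omega> \<bullet> v 0 \<omega>)"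
            using grid_index_bounds(1)[OF h, of \<omega>] by (simp add: momentum_def)
          ultimately have "0 \<le> ?j * h" "?j * h \<le> \<xi> 0 \<omega> \<bullet> v 0 \<omega>" "0 < \<xi> 0 \<omega> \<bullet> v 0 \<omega>"
            by (auto simp: max_def split: if_splits)
          then show ?thesis
            using clock_one_bounce[OF one radius_bound_bounds(1)[OF h] spec[OF elim(1)]] \<omega>(1) by auto
        qed
      qed
    qed
    have [measurable]: "clock_at h \<in> borel_measurable M" "clock_at 0 \<in> borel_measurable M"
      using h by auto
    show "{\<omega>\<in>space M. clock_at h \<omega> \<noteq> clock_at 0 \<omega>} \<in> events"
      by measurable
  qed
  finally show ?thesis .
qed

section \<open>The expected number of switches\<close>

text \<open>
  The event depends on the process only through its values at two times.
\<close>

lemma change_probability_stationary: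
  assumes "0 \<le> t" "0 \<le> h"
  shows "emeasure M {\<omega>\<in>space M. clock_at (t + h) \<omega> \<noteq> clock_at t \<omega>} =
    emeasure M {\<omega>\<in>space M. clock_at h \<omega> \<noteq> clock_at 0 \<omega>}"
proof -
  let ?P = "PiM {0..} (\<lambda>_. borel) :: (real \<Rightarrow> 'a \<times> 'a) measure"
  let ?Z = "\<lambda>s \<omega>. \<lambda>r\<in>{0..}. (\<xi> (r + s) \<omega>, v (r + s) \<omega>)"
  define Q where "Q = {f\<in>space ?P. (fst (f h) \<bullet> snd (f h) - h) - fst (f 0) \<bullet> snd (f 0) \<noteq> 0}"
  have "(\<lambda>f. f h) \<in> ?P \<rightarrow>\<^sub>M borel" "(\<lambda>f. f 0) \<in> ?P \<rightarrow>\<^sub>M borel"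
    using assms by (auto intro!: measurable_component_singleton)
  then have [measurable]: "(\<lambda>f. f h) \<in> ?P \<rightarrow>\<^sub>M borel \<Otimes>\<^sub>M borel" "(\<lambda>f. f 0) \<in> ?P \<rightarrow>\<^sub>M borel \<Otimes>\<^sub>M borel"
    by (simp_all add: borel_prod)
  have Q: "Q \<in> sets ?P" unfolding Q_def by measurable
  have Z: "?Z s \<in> M \<rightarrow>\<^sub>M ?P" if "0 \<le> s" for s
  proof (rule measurable_restrict)
    fix r :: real assume "r \<in> {0..}"
    then show "(\<lambda>\<omega>. (\<xi> (r + s) \<omega>, v (r + s) \<omega>)) \<in> M \<rightarrow>\<^sub>M borel"
      using position_measurable[of "r + s"] velocity_measurable[of "r + s"] that by simp
  qed
  have ev: "emeasure (distr M ?P (?Z s)) Q = emeasure M {\<omega>\<in>space M. clock_at (s + h) \<omega> \<noteq> clock_at s \<omega>}" if "0 \<le> s" for s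
  proof -
    have "?Z s -` Q \<inter> space M = {\<omega>\<in>space M. clock_at (s + h) \<omega> \<noteq> clock_at s \<omega>}"
      using measurable_space[OF Z[OF that]] assms by (auto simp: Q_def clock_at_def add.commute)
    then show ?thesis using Z[OF that] Q by (simp add: emeasure_distr)
  qed
  have "distr M ?P (?Z t) = distr M ?P (?Z 0)"
    using stationary assms unfolding stationary_process_def by simp
  then show ?thesis using ev[OF assms(1)] ev[of 0] by simp
qed

lemma expected_switches_eq_SUP:
  assumes "0 \<le> T"
  shows "(\<integral>\<^sup>+\<omega>. switches (\<lambda>t. \<xi> t \<omega> \<bullet> v t \<omega>) T \<partial>M) =
    (SUP n. 2 ^ n * emeasure M {\<omega>\<in>space M. clock_at (T / 2 ^ n) \<omega> \<noteq> clock_at 0 \<omega>})"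
    and "incseq (\<lambda>n. 2 ^ n * emeasure M {\<omega>\<in>space M. clock_at (T / 2 ^ n) \<omega> \<noteq> clock_at 0 \<omega>})"
proof -
  define c where "c n \<omega> = (of_nat (card (dyadic_changes (\<lambda>t. clock_at t \<omega>) T n)) :: ennreal)" for n \<omega>
  define E where "E n k = {\<omega>\<in>space M. clock_at (real k * (T / 2 ^ n)) \<omega> \<noteq> clock_at (real (Suc k) * (T / 2 ^ n)) \<omega>}" for n k
  have E [measurable]: "E n k \<in> events" for n k
  proof -
    have [measurable]: "clock_at (real k * (T / 2 ^ n)) \<in> borel_measurable M"
      "clock_at (real (Suc k) * (T / 2 ^ n)) \<in> borel_measurable M"
      using assms by (auto intro!: measurable_clock_at)
    show ?thesis unfolding E_def by measurable
  qed
  have c_sum: "c n \<omega> = (\<Sum>k<2 ^ n. indicator (E n k) \<omega>)" if "\<omega> \<in> space M" for n \<omega>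
  proof -
    have "dyadic_changes (\<lambda>t. clock_at t \<omega>) T n = {k. k < 2 ^ n \<and> \<omega> \<in> E n k}"
      using that by (simp only: dyadic_changes_def E_def mem_Collect_eq) blast
    then have "c n \<omega> = (\<Sum>k\<in>{k. k < 2 ^ n \<and> \<omega> \<in> E n k}. 1)" by (simp add: c_def)
    also have "\<dots> = (\<Sum>k<2 ^ n. indicator (E n k) \<omega>)"
      by (rule sum.mono_neutral_cong_left) (auto simp: indicator_def)
    finally show ?thesis .
  qed
  have c_meas: "c n \<in> borel_measurable M" for n
    by (subst measurable_cong[OF c_sum]) auto
  have "emeasure M (E n k) = emeasure M {\<omega>\<in>space M. clock_at (T / 2 ^ n) \<omega> \<noteq> clock_at 0 \<omega>}" for n k
  proof -
    let ?h = "T / 2 ^ n"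
    have "real (Suc k) * ?h = real k * ?h + ?h" by (simp only: of_nat_Suc distrib_right mult_1 add.commute)
    then have "E n k = {\<omega>\<in>space M. clock_at (real k * ?h + ?h) \<omega> \<noteq> clock_at (real k * ?h) \<omega>}"
      unfolding E_def by (simp only:) metis
    then show ?thesis
      using change_probability_stationary[of "real k * ?h" ?h] assms by simp
  qed
  then have c_int: "(\<integral>\<^sup>+\<omega>. c n \<omega> \<partial>M) = 2 ^ n * emeasure M {\<omega>\<in>space M. clock_at (T / 2 ^ n) \<omega> \<noteq> clock_at 0 \<omega>}" for n
    by (simp add: c_sum nn_integral_sum cong: nn_integral_cong)
  have c_mono: "incseq c"
    by (rule incseq_SucI) (simp add: le_fun_def c_def card_dyadic_changes_mono)
  then have "incseq (\<lambda>n. \<integral>\<^sup>+\<omega>. c n \<omega> \<partial>M)"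
    by (auto simp: incseq_def le_fun_def intro: nn_integral_mono)
  then show "incseq (\<lambda>n. 2 ^ n * emeasure M {\<omega>\<in>space M. clock_at (T / 2 ^ n) \<omega> \<noteq> clock_at 0 \<omega>})"
    by (simp only: c_int)
  have "(\<integral>\<^sup>+\<omega>. switches (\<lambda>t. \<xi> t \<omega> \<bullet> v t \<omega>) T \<partial>M) = (\<integral>\<^sup>+\<omega>. (SUP n. c n \<omega>) \<partial>M)"
  proof (rule nn_integral_cong_AE)
    show "AE \<omega> in M. switches (\<lambda>t. \<xi> t \<omega> \<bullet> v t \<omega>) T = (SUP n. c n \<omega>)"
      using realisation
    proof eventually_elim
      case (elim \<omega>)
      interpret bps_realisation "N \<omega>" "R \<omega>" "\<lambda>t. \<xi> t \<omega>" "\<lambda>t. v t \<omega>" by (rule elim)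
      have clk: "clock = (\<lambda>t. \<xi> t \<omega> \<bullet> v t \<omega> - t)" by (rule ext) (simp add: clock_def)
      show ?case
        unfolding c_def clock_at_def
        by (rule switches_eq_SUP_dyadic) (use clock_right_step clock_left_step assms clk in auto)
    qed
  qed
  also have "\<dots> = (SUP n. \<integral>\<^sup>+\<omega>. c n \<omega> \<partial>M)"
    using c_mono c_meas by (rule nn_integral_monotone_convergence_SUP)
  finally show "(\<integral>\<^sup>+\<omega>. switches (\<lambda>t. \<xi> t \<omega> \<bullet> v t \<omega>) T \<partial>M) =
      (SUP n. 2 ^ n * emeasure M {\<omega>\<in>space M. clock_at (T / 2 ^ n) \<omega> \<noteq> clock_at 0 \<omega>})"
    by (simp only: c_int)
qed

theorem expected_switches:
  assumes dim: "2 \<le> DIM('a)" and T: "0 \<le> T"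
  shows "(\<integral>\<^sup>+\<omega>. switches (\<lambda>t. \<xi> t \<omega> \<bullet> v t \<omega>) T \<partial>M) = ennreal (T * (1 / sqrt (2 * pi) + \<rho>))"
proof (cases "T = 0")
  case True
  then show ?thesis using expected_switches_eq_SUP(1)[of 0] by simp
next
  case False
  then have T: "0 < T" using T by simp
  define h where "h n = T / 2 ^ n" for n :: nat
  have h: "0 < h n" for n using T by (simp add: h_def)
  have h0: "h \<longlonglongrightarrow> 0"
    unfolding h_def using LIMSEQ_divide_realpow_zero[of 2 T] by simp
  have scale: "2 ^ n * h n = T" for n by (simp add: h_def)
  define a where "a n = 2 ^ n * emeasure M {\<omega>\<in>space M. clock_at (h n) \<omega> \<noteq> clock_at 0 \<omega>}" for n
  define L where "L = (\<integral>\<^sup>+\<omega>. switches (\<lambda>t. \<xi> t \<omega> \<bullet> v t \<omega>) T \<partial>M)"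
  have "L = (SUP n. a n)" "incseq a"
    using expected_switches_eq_SUP[of T] T unfolding L_def a_def h_def by auto
  then have lim: "a \<longlonglongrightarrow> L" using LIMSEQ_SUP by metis
  have two: "(2 ^ n :: ennreal) = ennreal (2 ^ n)" for n
    by (simp add: ennreal_power[symmetric])
  have "L \<le> ennreal (T * (\<rho> + 1 / sqrt (2 * pi) + 2 * 0))"
  proof (rule LIMSEQ_le[OF lim])
    show "(\<lambda>n. ennreal (T * (\<rho> + 1 / sqrt (2 * pi) + 2 * h n))) \<longlonglongrightarrow> ennreal (T * (\<rho> + 1 / sqrt (2 * pi) + 2 * 0))"
      by (intro tendsto_ennrealI tendsto_intros h0)
    have "a n \<le> ennreal (T * (\<rho> + 1 / sqrt (2 * pi) + 2 * h n))" for n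
    proof -
      have "a n \<le> ennreal (2 ^ n) * ennreal (h n * (\<rho> + 1 / sqrt (2 * pi) + 2 * h n))"
        unfolding a_def two by (intro mult_left_mono change_probability_upper h) simp
      also have "\<dots> = ennreal (2 ^ n * h n * (\<rho> + 1 / sqrt (2 * pi) + 2 * h n))"
        using h[of n] rate_pos by (simp add: ennreal_mult[symmetric] mult.assoc)
      finally show ?thesis by (simp add: scale)
    qed
    then show "\<exists>n0. \<forall>n\<ge>n0. a n \<le> ennreal (T * (\<rho> + 1 / sqrt (2 * pi) + 2 * h n))" by blast
  qed
  moreover have "ennreal (T * (\<rho> + 1 / sqrt (2 * pi))) \<le> L"
  proof -
    define u where "u n \<omega> = ennreal (T * (exp (- (h n * (\<rho> + norm (\<xi> 0 \<omega>) + h n + 1))) * (\<rho> + momentum \<omega> - h n)))" for n \<omega>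
    have [measurable]: "u n \<in> borel_measurable M" for n
      unfolding u_def by measurable
    have "(\<lambda>n. u n \<omega>) \<longlonglongrightarrow> ennreal (T * (exp (- (0 * (\<rho> + norm (\<xi> 0 \<omega>) + 0 + 1))) * (\<rho> + momentum \<omega> - 0)))" for \<omega>
      unfolding u_def by (intro tendsto_ennrealI tendsto_intros h0)
    then have u_lim: "liminf (\<lambda>n. u n \<omega>) = ennreal T * (ennreal \<rho> + ennreal (momentum \<omega>))" for \<omega>
      using lim_imp_Liminf[OF sequentially_bot, of "\<lambda>n. u n \<omega>"] T rate_pos momentum_nonneg[of \<omega>]
      by (simp add: ennreal_mult[symmetric] ennreal_plus[symmetric] del: ennreal_plus)
    have u_le: "(\<integral>\<^sup>+\<omega>. u n \<omega> \<partial>M) \<le> a n" for n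
    proof -
      have "(\<integral>\<^sup>+\<omega>. u n \<omega> \<partial>M) = (\<integral>\<^sup>+\<omega>. ennreal (2 ^ n) * ennreal (h n * (exp (- (h n * (\<rho> + norm (\<xi> 0 \<omega>) + h n + 1))) * (\<rho> + momentum \<omega> - h n))) \<partial>M)"
        unfolding u_def scale[of n, symmetric]
        by (intro nn_integral_cong) (simp add: ennreal_mult'[symmetric] mult.assoc)
      also have "\<dots> = ennreal (2 ^ n) * (\<integral>\<^sup>+\<omega>. ennreal (h n * (exp (- (h n * (\<rho> + norm (\<xi> 0 \<omega>) + h n + 1))) * (\<rho> + momentum \<omega> - h n))) \<partial>M)"
        by (intro nn_integral_cmult) measurable
      also have "\<dots> \<le> a n"
        unfolding a_def two by (intro mult_left_mono change_probability_lower h dim) simp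
      finally show ?thesis .
    qed
    have "ennreal (T * (\<rho> + 1 / sqrt (2 * pi))) = ennreal T * (ennreal \<rho> + (\<integral>\<^sup>+\<omega>. ennreal (momentum \<omega>) \<partial>M))"
      unfolding expected_momentum using T rate_pos
      by (simp add: ennreal_mult[symmetric] ennreal_plus[symmetric] del: ennreal_plus)
    also have "\<dots> = (\<integral>\<^sup>+\<omega>. liminf (\<lambda>n. u n \<omega>) \<partial>M)"
      unfolding u_lim by (simp add: nn_integral_cmult nn_integral_add emeasure_space_1)
    also have "\<dots> \<le> liminf (\<lambda>n. \<integral>\<^sup>+\<omega>. u n \<omega> \<partial>M)"
      by (intro nn_integral_liminf) measurable
    also have "\<dots> \<le> liminf a"
      using u_le by (intro Liminf_mono always_eventually) auto
    also have "\<dots> = L"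
      using lim by (intro lim_imp_Liminf) auto
    finally show ?thesis .
  qed
  ultimately show ?thesis
    unfolding L_def[symmetric] by (simp add: add.commute)
qed

end

theorem corollary2p7:
  fixes M :: "'w measure" and \<rho> T :: real
    and N :: "'w \<Rightarrow> (real \<times> real) measure"
    and R :: "'w \<Rightarrow> (real \<times> (real ^ 'd::finite)) measure"
    and \<xi> v :: "real \<Rightarrow> 'w \<Rightarrow> real ^ 'd"
  assumes "CARD('d) \<ge> 2"
    and "stationary_bps M \<rho> N R \<xi> v"
    and "T \<ge> 0"
  shows "(\<integral>\<^sup>+\<omega>. switches (\<lambda>t. angular_momentum \<xi> v t \<omega>) T \<partial>M) =
           ennreal (T * (1 / sqrt (2 * pi) + \<rho>))"
proof -
  interpret stationary_bps M \<rho> N R \<xi> v by fact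
  have "2 \<le> DIM(real ^ 'd)" using assms(1) by simp
  then show ?thesis
    unfolding angular_momentum_def using assms(3) by (rule expected_switches)
qed

end
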